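(* Let $f\in\mathrm{Bound}(k,n)$ and suppose $\Pi_f=\bigcap_i\Pi_{f_i}$ where each $\Pi_{f_i}$ is a basic positroid variety. Then $B_f(n,k,d)=\bigcap_iB_{f_i}(n,k,d)$ for every $d\ge1$.
   Context: Let $\Bbbk$ be algebraically closed of characteristic $0$, $1\le k<n$. Points $V\in\mathrm{Gr}(k,n)$ are represented by $k\times n$ matrices with columns $v_1,\dots,v_n$, extended by $v_{i+n}=v_i$. $\mathrm{Bound}(k,n)$ is the set of bijections $f:\mathbb Z\to\mathbb Z$ with $f(i+n)=f(i)+n$, $\sum_{i=1}^n(f(i)-i)=kn$, $i\le f(i)\le i+n$. For $V$, $f_V(i)=\min\{j\ge i:v_i\in\operatorname{span}(v_{i+1},\dots,v_j)\}$, and $\Pi_f$ is the closure of $\{V:f_V=f\}$. For a cyclic interval $S$ of $[n]$ (a set $\{\alpha+1,\dots,\alpha+m\}$ read modulo $n$) and $r\ge0$, $X_{S\le r}=\{V:\operatorname{rank}(\text{columns indexed by }S)\le r\}$; such varieties are positroid varieties, called basic positroid varieties. $R(k,n)$ is the polynomial ring in Plücker variables $[\mathbf a]$, $\mathbf a\in\binom{[n]}{k}$, and $\mathcal J_f$ is the defining ideal of $\Pi_f$ under the Plücker embedding. Plücker poset: $\mathbf a\le\mathbf b$ iff $a_i\le b_i$ for all $i$. $<_\omega$ is degree revlex for a variable ordering that is a fixed linear extension of the Plücker poset (poset-larger variables larger); $\operatorname{In}$ is the initial ideal. $B(n,k,d)$ is the set of semistandard $k\times d$ rectangular tableaux with entries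 in $[n]$, identified with standard monomials $\prod_i[\mathbf a^{(i)}]$ ($\mathbf a^{(i)}$ the entries of column $i$), and $B_f(n,k,d)=\{\mathbf m\in B(n,k,d):\mathbf m\notin\operatorname{In}(\mathcal J_f)\}$. *)

theory Defs
  imports "HOL-Library.Poly_Mapping" "HOL-Computational_Algebra.Polynomial"
    "Jordan_Normal_Form.Determinant"
begin

(* Columns are indexed by [n] = {1..n}; rows by {0..<k}.  A matrix is a function
   M :: nat => nat => 'a, entry M r c (row r < k, column c in {1..n}). *)

definition col :: "nat \<Rightarrow> int \<Rightarrow> nat" where
  "col n i = nat ((i - 1) mod int n) + 1"   (* v_{i+n} = v_i *)

definition Vars :: "nat \<Rightarrow> nat \<Rightarrow> nat set set" where
  "Vars k n = {a. a \<subseteq> {1..n} \<and> card a = k}"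

definition plk :: "nat \<Rightarrow> (nat \<Rightarrow> nat \<Rightarrow> 'a::comm_ring_1) \<Rightarrow> nat set \<Rightarrow> 'a" where
  "plk k M a = det (mat k k (\<lambda>(i, j). M i (sorted_list_of_set a ! j)))"

(* points of Gr(k,n): k x n matrices of full rank k *)
definition Gr :: "nat \<Rightarrow> nat \<Rightarrow> (nat \<Rightarrow> nat \<Rightarrow> 'a::field) set" where
  "Gr k n = {M. \<exists>a \<in> Vars k n. plk k M a \<noteq> 0}"

type_synonym 'a plpoly = "(nat set \<Rightarrow>\<^sub>0 nat) \<Rightarrow>\<^sub>0 'a"

definition R :: "nat \<Rightarrow> nat \<Rightarrow> 'a::comm_ring_1 plpoly set" where
  "R k n = {p. \<forall>m \<in> Poly_Mapping.keys p. Poly_Mapping.keys m \<subseteq> Vars k n}"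

definition peval :: "'a::comm_ring_1 plpoly \<Rightarrow> (nat set \<Rightarrow> 'a) \<Rightarrow> 'a" where
  "peval p x = (\<Sum>m \<in> Poly_Mapping.keys p. Poly_Mapping.lookup p m * (\<Prod>v \<in> Poly_Mapping.keys m. x v ^ Poly_Mapping.lookup m v))"

definition zar_closure :: "nat \<Rightarrow> nat \<Rightarrow> (nat \<Rightarrow> nat \<Rightarrow> 'a::field) set \<Rightarrow> (nat \<Rightarrow> nat \<Rightarrow> 'a) set" where
  "zar_closure k n S = {M \<in> Gr k n. \<forall>p \<in> R k n.
      (\<forall>N \<in> S. peval p (plk k N) = 0) \<longrightarrow> peval p (plk k M) = 0}"

definition Bound :: "nat \<Rightarrow> nat \<Rightarrow> (int \<Rightarrow> int) set" where
  "Bound k n = {f. bij f \<and> (\<forall>i. f (i + int n) = f i + int n)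
      \<and> (\<Sum>i\<in>{1..int n}. f i - i) = int k * int n
      \<and> (\<forall>i. i \<le> f i \<and> f i \<le> i + int n)}"

definition in_span :: "nat \<Rightarrow> nat \<Rightarrow> (nat \<Rightarrow> nat \<Rightarrow> 'a::field) \<Rightarrow> int \<Rightarrow> int \<Rightarrow> bool" where
  "in_span k n M i j = (\<exists>c :: int \<Rightarrow> 'a. \<forall>r<k.
      M r (col n i) = (\<Sum>l\<in>{i+1..j}. c l * M r (col n l)))"

definition fV :: "nat \<Rightarrow> nat \<Rightarrow> (nat \<Rightarrow> nat \<Rightarrow> 'a::field) \<Rightarrow> int \<Rightarrow> int" where
  "fV k n M i = i + int (LEAST t::nat. in_span k n M i (i + int t))"

definition cell :: "nat \<Rightarrow> nat \<Rightarrow> (int \<Rightarrow> int) \<Rightarrow> (nat \<Rightarrow> nat \<Rightarrow> 'a::field) set" where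
  "cell k n f = {M \<in> Gr k n. \<forall>i. fV k n M i = f i}"

definition Pi_pos :: "nat \<Rightarrow> nat \<Rightarrow> (int \<Rightarrow> int) \<Rightarrow> (nat \<Rightarrow> nat \<Rightarrow> 'a::field) set" where
  "Pi_pos k n f = zar_closure k n (cell k n f)"

definition lin_indep_cols :: "nat \<Rightarrow> (nat \<Rightarrow> nat \<Rightarrow> 'a::field) \<Rightarrow> nat set \<Rightarrow> bool" where
  "lin_indep_cols k M U = (\<forall>c :: nat \<Rightarrow> 'a.
      (\<forall>r<k. (\<Sum>l\<in>U. c l * M r l) = 0) \<longrightarrow> (\<forall>l\<in>U. c l = 0))"

definition col_rank :: "nat \<Rightarrow> (nat \<Rightarrow> nat \<Rightarrow> 'a::field) \<Rightarrow> nat set \<Rightarrow> nat" where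
  "col_rank k M S = Max {card U | U. U \<subseteq> S \<and> lin_indep_cols k M U}"

definition cyc_int :: "nat \<Rightarrow> int \<Rightarrow> nat \<Rightarrow> nat set" where
  "cyc_int n \<alpha> m = {col n (\<alpha> + int t) | t. 1 \<le> t \<and> t \<le> m}"

definition X_rank :: "nat \<Rightarrow> nat \<Rightarrow> nat set \<Rightarrow> nat \<Rightarrow> (nat \<Rightarrow> nat \<Rightarrow> 'a::field) set" where
  "X_rank k n S r = {M \<in> Gr k n. col_rank k M S \<le> r}"

definition is_basic :: "'a::field itself \<Rightarrow> nat \<Rightarrow> nat \<Rightarrow> (int \<Rightarrow> int) \<Rightarrow> bool" where
  "is_basic _ k n g = (\<exists>\<alpha> m r. m \<le> n \<and>
      (Pi_pos k n g :: (nat \<Rightarrow> nat \<Rightarrow> 'a) set) = X_rank k n (cyc_int n \<alpha> m) r)"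

definition Jf :: "nat \<Rightarrow> nat \<Rightarrow> (int \<Rightarrow> int) \<Rightarrow> 'a::field plpoly set" where
  "Jf k n f = {p \<in> R k n. \<forall>M \<in> Pi_pos k n f. peval p (plk k M) = 0}"

definition pl_le :: "nat \<Rightarrow> nat set \<Rightarrow> nat set \<Rightarrow> bool" where
  "pl_le k a b = (\<forall>i<k. sorted_list_of_set a ! i \<le> sorted_list_of_set b ! i)"

(* w encodes a linear order on the variables: x larger than y iff w x > w y *)
definition lin_ext :: "nat \<Rightarrow> nat \<Rightarrow> (nat set \<Rightarrow> nat) \<Rightarrow> bool" where
  "lin_ext k n w = (inj_on w (Vars k n) \<and>
      (\<forall>a\<in>Vars k n. \<forall>b\<in>Vars k n. pl_le k a b \<and> a \<noteq> b \<longrightarrow> w a < w b))"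

definition mdeg :: "(nat set \<Rightarrow>\<^sub>0 nat) \<Rightarrow> nat" where
  "mdeg m = (\<Sum>v\<in>Poly_Mapping.keys m. Poly_Mapping.lookup m v)"

definition revlex_less :: "(nat set \<Rightarrow> nat) \<Rightarrow> (nat set \<Rightarrow>\<^sub>0 nat) \<Rightarrow> (nat set \<Rightarrow>\<^sub>0 nat) \<Rightarrow> bool" where
  "revlex_less w m1 m2 = (mdeg m1 < mdeg m2 \<or>
     (mdeg m1 = mdeg m2 \<and> (\<exists>x. Poly_Mapping.lookup m1 x > Poly_Mapping.lookup m2 x \<and>
        (\<forall>y. Poly_Mapping.lookup m1 y \<noteq> Poly_Mapping.lookup m2 y \<longrightarrow> w x \<le> w y))))"

definition lead_mon :: "(nat set \<Rightarrow> nat) \<Rightarrow> 'a::zero plpoly \<Rightarrow> (nat set \<Rightarrow>\<^sub>0 nat)" where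
  "lead_mon w p = (THE m. m \<in> Poly_Mapping.keys p \<and> (\<forall>m'\<in>Poly_Mapping.keys p. m' \<noteq> m \<longrightarrow> revlex_less w m' m))"

definition ideal_R :: "nat \<Rightarrow> nat \<Rightarrow> 'a::comm_ring_1 plpoly set \<Rightarrow> 'a plpoly set" where
  "ideal_R k n G = {p. \<exists>A q. finite A \<and> A \<subseteq> G \<and> (\<forall>g\<in>A. q g \<in> R k n) \<and> p = (\<Sum>g\<in>A. q g * g)}"

definition In_ideal :: "nat \<Rightarrow> nat \<Rightarrow> (nat set \<Rightarrow> nat) \<Rightarrow> 'a::comm_ring_1 plpoly set \<Rightarrow> 'a plpoly set" where
  "In_ideal k n w J = ideal_R k n {Poly_Mapping.single (lead_mon w g) 1 | g. g \<in> J \<and> g \<noteq> 0}"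

(* standard monomials of semistandard k x d tableaux with entries in [n] *)
definition Bmon :: "nat \<Rightarrow> nat \<Rightarrow> nat \<Rightarrow> (nat set \<Rightarrow>\<^sub>0 nat) set" where
  "Bmon n k d = {m. \<exists>cs. length cs = d \<and> set cs \<subseteq> Vars k n \<and> sorted_wrt (pl_le k) cs
      \<and> m = sum_list (map (\<lambda>a. Poly_Mapping.single a 1) cs)}"

definition Bf :: "'a::field itself \<Rightarrow> nat \<Rightarrow> nat \<Rightarrow> nat \<Rightarrow> (nat set \<Rightarrow> nat) \<Rightarrow> (int \<Rightarrow> int) \<Rightarrow> (nat set \<Rightarrow>\<^sub>0 nat) set" where
  "Bf _ n k d w f = {m \<in> Bmon n k d.
      Poly_Mapping.single m (1::'a) \<notin> In_ideal k n w (Jf k n f :: 'a plpoly set)}"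

end

theory Submission
  imports Defs
begin

text \<open>
  Let \<open>m\<close> be a standard monomial with columns \<open>a\<^sub>1 \<le> \<dots> \<le> a\<^sub>d\<close>. Completing each column greedily to a
  permutation gives a chain in Bruhat order, hence Richardson strata of matrices whose closures are
  nested. On the stratum of the first column \<open>[a\<^sub>1]\<close> does not vanish, while every Pluecker coordinate
  that is not above \<open>a\<^sub>1\<close> does; peeling off the columns one at a time, \<open>m\<close> is not the leading monomial
  of any polynomial vanishing on the first stratum.

  Conversely, the rank of a cyclic interval of columns on that stratum is bounded by the size of a
  set \<open>D\<close> of tableau entries running monotonically through the columns. If \<open>D\<close> is too large for the
  rank condition \<open>X\<^bsub>S \<le> r\<^esub>\<close>, antisymmetrizing the product of the minors \<open>[a\<^sub>j]\<close> over \<open>D\<close> produces a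
  polynomial that vanishes on \<open>X\<^bsub>S \<le> r\<^esub>\<close> and has leading monomial \<open>m\<close>. So if \<open>m\<close> is standard for
  every \<open>\<Pi>\<^bsub>f\<^sub>i\<^esub>\<close>, the stratum lies in the intersection \<open>\<Pi>\<^sub>f\<close>, and therefore \<open>m\<close> is standard for \<open>\<Pi>\<^sub>f\<close>.
\<close>

section \<open>Greedy chains of columns\<close>

text \<open>The core is a min-max fact, \<open>greedy_chain\<close>: the bound that the first and
  last permutation put on the rank of an interval, for any matrix of the stratum, never exceeds the
  one given by a monotone set \<open>D\<close>. A matrix violating a rank condition therefore always
  comes with a \<open>D\<close> large enough to antisymmetrize. The greedy choice serves this
  purpose; the Bruhat chain alone would follow from any completion that is monotone along the chain.
  Each permutation lists a column on the positions below \<open>k\<close> and its complement on the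
  others. The first block governs intervals that wrap around: there \<open>D\<close> consists of
  numbers missing from columns, and minors are written through complementary rows, that is, in the
  dual matroid. The second block governs the other intervals, with \<open>D\<close> made of entries.
  Closures are not computed. Each Bruhat swap is realised by an explicit curve, linear in a
  parameter, and a polynomial vanishing for almost all parameters vanishes for all. Characteristic
  zero enters there, in the sign argument for repeated entries, and in a leading coefficient that is
  a multiple of the order of a stabilizer.\<close>

lemma nth_sorted_less_iff:
  fixes A :: "'b::linorder set"
  assumes "finite A"
  shows "i < card (A \<inter> {..<X}) \<longleftrightarrow> i < card A \<and> sorted_list_of_set A ! i < X"
proof -
  let ?l = "sorted_list_of_set A"
  have len: "length ?l = card A" by simp
  have set: "A \<inter> {..<X} = (\<lambda>i. ?l ! i) ` {i. i < card A \<and> ?l ! i < X}"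
    using set_conv_nth[of ?l] assms by auto
  have inj: "inj_on (\<lambda>i. ?l ! i) {i. i < card A \<and> ?l ! i < X}"
    using nth_eq_iff_index_eq[OF distinct_sorted_list_of_set[of A]] by (auto simp: inj_on_def)
  have c: "card (A \<inter> {..<X}) = card {i. i < card A \<and> ?l ! i < X}"
    unfolding set by (rule card_image[OF inj])
  define S where "S = {i. i < card A \<and> ?l ! i < X}"
  have down: "j \<in> S" if "i \<in> S" "j \<le> i" for i j
  proof -
    have "?l ! j \<le> ?l ! i" using that unfolding S_def by (intro sorted_nth_mono) auto
    with that show ?thesis unfolding S_def by auto
  qed
  have fS: "finite S" unfolding S_def by auto
  have "S = {..<card S}"
  proof (rule card_subset_eq[symmetric])
    show "{..<card S} \<subseteq> S"
    proof
      fix i assume i: "i \<in> {..<card S}"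
      show "i \<in> S"
      proof (rule ccontr)
        assume "i \<notin> S"
        then have "S \<subseteq> {..<i}" using down by (metis lessThan_iff linorder_le_less_linear subsetI)
        then have "card S \<le> i" using card_mono[of "{..<i}" S] by auto
        with i show False by auto
      qed
    qed
  qed (use fS in auto)
  then show ?thesis using c unfolding S_def by auto
qed

text \<open>For sets of equal size this is the Gale order, the entrywise comparison of sorted lists,
  in counting form. It is stated for integers so that it also applies to negated sets.\<close>

definition dominated :: "int set \<Rightarrow> int set \<Rightarrow> bool" where
  "dominated A B \<longleftrightarrow> (\<forall>z. card (B \<inter> {..z}) \<le> card (A \<inter> {..z}))"

text \<open>Greedy rule: position \<open>i\<close> receives the largest element of \<open>A\<close>
  that is at most \<open>b i\<close> and not yet taken. The last conjunct records this maximality,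
  on which \<open>greedy_chain\<close> relies.\<close>

lemma greedy_matching_partial:
  fixes b :: "nat \<Rightarrow> int" and A :: "int set"
  assumes A: "finite A" "card A = k" and b: "inj_on b {..<k}"
    and dom: "dominated A (b ` {..<k})" and "c \<le> k"
  shows "\<exists>b'. inj_on b' {..<c} \<and> b' ` {..<c} \<subseteq> A \<and> (\<forall>i<c. b' i \<le> b i) \<and>
    (\<forall>i<c. \<forall>x\<in>A. x \<le> b i \<longrightarrow> x \<in> b' ` {..<i} \<or> x \<le> b' i)"
  using \<open>c \<le> k\<close>
proof (induction c)
  case 0
  show ?case by auto
next
  case (Suc c)
  then obtain b' where b': "inj_on b' {..<c}" "b' ` {..<c} \<subseteq> A" "\<forall>i<c. b' i \<le> b i"
    "\<forall>i<c. \<forall>x\<in>A. x \<le> b i \<longrightarrow> x \<in> b' ` {..<i} \<or> x \<le> b' i" by auto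
  let ?U = "b' ` {..<c}"
  let ?C = "{x \<in> A. x \<le> b c \<and> x \<notin> ?U}"
  have cU: "card ?U = c" using card_image[OF b'(1)] by simp
  have ne: "?C \<noteq> {}"
  proof
    assume empty: "?C = {}"
    have "A - ?U \<noteq> {}"
    proof
      assume "A - ?U = {}"
      then have "card A \<le> c" using card_mono[of ?U A] cU by auto
      with A Suc.prems show False by auto
    qed
    define x0 where "x0 = Min (A - ?U)"
    have x0: "x0 \<in> A - ?U" using \<open>A - ?U \<noteq> {}\<close> A unfolding x0_def by (intro Min_in) auto
    have x0min: "x0 \<le> x" if "x \<in> A - ?U" for x using that A unfolding x0_def by (intro Min_le) auto
    have bc: "b c < x0"
    proof (rule ccontr)
      assume "\<not> b c < x0"
      then have "x0 \<in> ?C" using x0 by auto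
      with empty show False by blast
    qed
    define z where "z = x0 - 1"
    have 1: "A \<inter> {..z} \<subseteq> b' ` {l. l < c \<and> b l \<le> z}"
    proof
      fix x assume x: "x \<in> A \<inter> {..z}"
      then have "x \<in> ?U" using x0min[of x] by (auto simp: z_def)
      then obtain l where l: "l < c" "x = b' l" by auto
      have "b l \<le> z"
      proof (rule ccontr)
        assume "\<not> b l \<le> z"
        then have "x0 \<le> b l" by (simp add: z_def)
        with b'(4) l x0 have "x0 \<in> b' ` {..<l} \<or> x0 \<le> b' l" by auto
        then show False
        proof
          assume "x0 \<in> b' ` {..<l}" then show False using x0 l by auto
        next
          assume "x0 \<le> b' l" then show False using l x by (auto simp: z_def)
        qed
      qed
      with l show "x \<in> b' ` {l. l < c \<and> b l \<le> z}" by auto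
    qed
    have "card (A \<inter> {..z}) \<le> card {l. l < c \<and> b l \<le> z}"
      by (rule order_trans[OF card_mono[OF _ 1] card_image_le]) auto
    moreover have "card (insert c {l. l < c \<and> b l \<le> z}) \<le> card (b ` {..<k} \<inter> {..z})"
    proof -
      have "b ` insert c {l. l < c \<and> b l \<le> z} \<subseteq> b ` {..<k} \<inter> {..z}"
        using Suc.prems bc by (auto simp: z_def)
      moreover have "inj_on b (insert c {l. l < c \<and> b l \<le> z})"
        using Suc.prems by (intro inj_on_subset[OF b]) auto
      ultimately show ?thesis
        by (metis card_image card_mono finite_Int finite_imageI finite_lessThan)
    qed
    ultimately show False using dom unfolding dominated_def by (auto dest: spec[of _ z])
  qed
  have fin: "finite ?C" using A by auto
  define x1 where "x1 = Max ?C"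
  have x1: "x1 \<in> ?C" unfolding x1_def by (rule Max_in[OF fin ne])
  have x1max: "x \<le> x1" if "x \<in> ?C" for x unfolding x1_def using that fin by simp
  let ?b = "b'(c := x1)"
  have img: "?b ` {..<i} = b' ` {..<i}" if "i \<le> c" for i using that by auto
  have "inj_on ?b {..<Suc c}" using b'(1) x1
    by (auto simp: lessThan_Suc inj_on_def)
  moreover have "?b ` {..<Suc c} \<subseteq> A" using b'(2) x1 by (auto simp: lessThan_Suc)
  moreover have "\<forall>i<Suc c. ?b i \<le> b i" using b'(3) x1 by (auto simp: less_Suc_eq)
  moreover have "\<forall>i<Suc c. \<forall>x\<in>A. x \<le> b i \<longrightarrow> x \<in> ?b ` {..<i} \<or> x \<le> ?b i"
  proof (intro allI impI ballI)
    fix i x assume i: "i < Suc c" and x: "x \<in> A" "x \<le> b i"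
    show "x \<in> ?b ` {..<i} \<or> x \<le> ?b i"
    proof (cases "i = c")
      case True
      then show ?thesis using x x1max img[of c] by auto
    next
      case False
      then show ?thesis using b'(4) x i img[of i] by auto
    qed
  qed
  ultimately show ?case by blast
qed

lemma greedy_matching:
  fixes b :: "nat \<Rightarrow> int" and A :: "int set"
  assumes A: "finite A" "card A = k" and b: "inj_on b {..<k}"
    and dom: "dominated A (b ` {..<k})"
  obtains b' where "bij_betw b' {..<k} A" "\<And>i. i < k \<Longrightarrow> b' i \<le> b i"
    "\<And>i x. i < k \<Longrightarrow> x \<in> A \<Longrightarrow> x \<le> b i \<Longrightarrow> x \<notin> b' ` {..<i} \<Longrightarrow> x \<le> b' i"
proof -
  obtain b' where b': "inj_on b' {..<k}" "b' ` {..<k} \<subseteq> A" "\<forall>i<k. b' i \<le> b i"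
    "\<forall>i<k. \<forall>x\<in>A. x \<le> b i \<longrightarrow> x \<in> b' ` {..<i} \<or> x \<le> b' i"
    using greedy_matching_partial[OF A b dom order_refl] by blast
  have "b' ` {..<k} = A" using b'(1,2) A by (intro card_subset_eq) (auto simp: card_image)
  then have "bij_betw b' {..<k} A" using b'(1) by (simp add: bij_betw_def)
  then show thesis using b'(3,4) by (intro that[of b']) auto
qed

text \<open>Monotonicity of \<open>\<gamma>\<close> is what later forces an exchange of elements
  between columns to lower the first column that it changes.\<close>

definition col_witness :: "(nat \<Rightarrow> int \<Rightarrow> bool) \<Rightarrow> nat \<Rightarrow> int set \<Rightarrow> (int \<Rightarrow> nat) \<Rightarrow> bool" where
  "col_witness P d D \<gamma> \<longleftrightarrow> (\<forall>s\<in>D. \<gamma> s < d \<and> P (\<gamma> s) s) \<and> (\<forall>s\<in>D. \<forall>t\<in>D. s < t \<longrightarrow> \<gamma> s \<le> \<gamma> t)"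

lemma card_sorted_list_less:
  fixes A :: "int set"
  assumes "finite A"
  shows "{i. i < card (A \<inter> {..<X}) \<and> y < sorted_list_of_set A ! i}
     = {i. i < card A \<and> sorted_list_of_set A ! i \<in> {y<..<X}}"
  using nth_sorted_less_iff[OF assms] by auto

text \<open>Min-max duality, by induction from the last column backwards. The last listing is
  increasing, so the positions below \<open>card (last As \<inter> {..<X})\<close> are exactly those
  whose last value is below \<open>X\<close>. The final conjunct says that whatever part of an
  interval exceeds the number of first values above \<open>y\<close> at these positions is made up
  for by a monotone set of missing numbers.\<close>

lemma greedy_chain:
  fixes As :: "int set list"
  assumes "As \<noteq> []" and "\<forall>A\<in>set As. finite A \<and> card A = k"
    and "sorted_wrt dominated As"
  shows "\<exists>bs. length bs = length As \<and> (\<forall>j<length As. bij_betw (bs ! j) {..<k} (As ! j)) \<and>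
    (\<forall>j. Suc j < length As \<longrightarrow> (\<forall>i<k. (bs ! j) i \<le> (bs ! Suc j) i)) \<and>
    (\<forall>i<k. last bs i = sorted_list_of_set (last As) ! i) \<and>
    (\<forall>y X. \<exists>D \<gamma>. D \<subseteq> {y<..<X} \<and> col_witness (\<lambda>j s. s \<notin> As ! j) (length As) D \<gamma> \<and>
      card {y<..<X} \<le> card D + card {i. i < card (last As \<inter> {..<X}) \<and> y < hd bs i})"
  using assms
proof (induction As)
  case Nil
  then show ?case by simp
next
  case (Cons A As)
  show ?case
  proof (cases "As = []")
    case True
    let ?b = "\<lambda>i. sorted_list_of_set A ! i"
    from Cons.prems have A: "finite A" "card A = k" by auto
    have bij: "bij_betw ?b {..<k} A"
      using bij_betw_nth[OF distinct_sorted_list_of_set[of A], of "{..<k}" A] A by auto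
    have "\<exists>D \<gamma>. D \<subseteq> {y<..<X} \<and> col_witness (\<lambda>j s. s \<notin> [A] ! j) 1 D \<gamma> \<and>
      card {y<..<X} \<le> card D + card {i. i < card (A \<inter> {..<X}) \<and> y < ?b i}" for y X
    proof -
      let ?D = "{y<..<X} - A"
      have "{i. i < card (A \<inter> {..<X}) \<and> y < ?b i} = {i. i < k \<and> ?b i \<in> {y<..<X}}"
        using card_sorted_list_less[OF A(1), of X y] A by simp
      moreover have "A \<inter> {y<..<X} \<subseteq> ?b ` {i. i < k \<and> ?b i \<in> {y<..<X}}"
      proof
        fix x assume x: "x \<in> A \<inter> {y<..<X}"
        then have "x \<in> ?b ` {..<k}" using bij_betw_imp_surj_on[OF bij] by simp
        then obtain i where "i < k" "x = ?b i" by auto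
        then show "x \<in> ?b ` {i. i < k \<and> ?b i \<in> {y<..<X}}" using x by auto
      qed
      then have "card (A \<inter> {y<..<X}) \<le> card {i. i < k \<and> ?b i \<in> {y<..<X}}"
        by (rule order_trans[OF card_mono card_image_le, rotated]) auto
      ultimately have "card (A \<inter> {y<..<X}) \<le> card {i. i < card (A \<inter> {..<X}) \<and> y < ?b i}" by simp
      moreover have "card {y<..<X} \<le> card ?D + card (A \<inter> {y<..<X})"
        by (rule order_trans[OF card_mono card_Un_le]) (use A in auto)
      ultimately have "card {y<..<X} \<le> card ?D + card {i. i < card (A \<inter> {..<X}) \<and> y < ?b i}" by simp
      then show ?thesis
        by (intro exI[of _ ?D] exI[of _ "\<lambda>_. 0"]) (auto simp: col_witness_def)
    qed
    then show ?thesis using True bij by (intro exI[of _ "[?b]"]) auto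
  next
    case False
    with Cons obtain bs where bs: "length bs = length As"
      "\<And>j. j < length As \<Longrightarrow> bij_betw (bs ! j) {..<k} (As ! j)"
      "\<And>j i. Suc j < length As \<Longrightarrow> i < k \<Longrightarrow> (bs ! j) i \<le> (bs ! Suc j) i"
      "\<And>i. i < k \<Longrightarrow> last bs i = sorted_list_of_set (last As) ! i"
      and W: "\<And>y X. \<exists>D \<gamma>. D \<subseteq> {y<..<X} \<and> col_witness (\<lambda>j s. s \<notin> As ! j) (length As) D \<gamma> \<and>
      card {y<..<X} \<le> card D + card {i. i < card (last As \<inter> {..<X}) \<and> y < hd bs i}"
      by (smt (verit, ccfv_threshold) list.set_intros(2) sorted_wrt.simps(2))
    from Cons.prems have A: "finite A" "card A = k" by auto
    have ne: "bs \<noteq> []" using bs(1) False by auto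
    have hd: "hd bs = bs ! 0" "hd As = As ! 0" using ne False by (simp_all add: hd_conv_nth)
    have bij: "bij_betw (hd bs) {..<k} (hd As)" using bs(2)[of 0] False hd by simp
    have "dominated A (hd As)" using Cons.prems False by simp
    then have dom: "dominated A (hd bs ` {..<k})" using bij by (simp add: bij_betw_def)
    from bij have inj: "inj_on (hd bs) {..<k}" by (simp add: bij_betw_def)
    obtain b where b: "bij_betw b {..<k} A" "\<And>i. i < k \<Longrightarrow> b i \<le> hd bs i"
      "\<And>i x. i < k \<Longrightarrow> x \<in> A \<Longrightarrow> x \<le> hd bs i \<Longrightarrow> x \<notin> b ` {..<i} \<Longrightarrow> x \<le> b i"
      using greedy_matching[OF A inj dom] by metis
    have cl: "card (last As) = k" "finite (last As)" using Cons.prems False by auto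
    have WW: "\<exists>D \<gamma>. D \<subseteq> {y<..<X} \<and> col_witness (\<lambda>j s. s \<notin> (A # As) ! j) (length (A # As)) D \<gamma> \<and>
      card {y<..<X} \<le> card D + card {i. i < card (last As \<inter> {..<X}) \<and> y < b i}" for y X
    proof -
      define c where "c = card (last As \<inter> {..<X})"
      have ck: "c \<le> k" unfolding c_def using cl by (metis card_mono inf_le1)
      let ?Z = "{x \<in> A. y < x \<and> x < X \<and> x \<notin> b ` {..<c}}"
      show ?thesis
      proof (cases "?Z = {}")
        case True
        let ?D = "{y<..<X} - A"
        have "A \<inter> {y<..<X} \<subseteq> b ` {i. i < c \<and> y < b i}" using True by auto
        then have "card (A \<inter> {y<..<X}) \<le> card {i. i < c \<and> y < b i}"
          by (rule order_trans[OF card_mono card_image_le, rotated]) auto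
        moreover have "card {y<..<X} \<le> card ?D + card (A \<inter> {y<..<X})"
          by (rule order_trans[OF card_mono card_Un_le]) (use A in auto)
        ultimately show ?thesis unfolding c_def
          by (intro exI[of _ ?D] exI[of _ "\<lambda>_. 0"]) (auto simp: col_witness_def)
      next
        case False
        \<comment> \<open>\<open>x0\<close> is the first element of the new column inside the
          interval that no position below \<open>c\<close> uses. Below \<open>x0\<close>, the
          numbers missing from the new column serve as witness; from \<open>x0\<close> on, the
          witness of the later columns is used, with column indices shifted by one.\<close>
        define x0 where "x0 = Min ?Z"
        have fin: "finite ?Z" using A by auto
        have x0: "x0 \<in> ?Z" unfolding x0_def using False fin by (intro Min_in) auto
        have x0min: "x0 \<le> x" if "x \<in> ?Z" for x unfolding x0_def using that fin by simp
        obtain D' \<gamma>' where D': "D' \<subseteq> {x0 - 1<..<X}" "col_witness (\<lambda>j s. s \<notin> As ! j) (length As) D' \<gamma>'"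
          "card {x0 - 1<..<X} \<le> card D' + card {i. i < c \<and> x0 - 1 < hd bs i}"
          using W[of "x0 - 1" X] unfolding c_def by blast
        let ?D1 = "{y<..<x0} - A"
        let ?D = "?D1 \<union> D'"
        let ?\<gamma> = "\<lambda>s. if s < x0 then 0 else Suc (\<gamma>' s)"
        have finD: "finite D'" using D'(1) finite_subset by blast
        have cD: "card ?D = card ?D1 + card D'"
          using D'(1) finD by (intro card_Un_disjoint) auto
        have 1: "A \<inter> {y<..<x0} \<subseteq> b ` {i. i < c \<and> b i \<in> {y<..<x0}}"
        proof
          fix x assume x: "x \<in> A \<inter> {y<..<x0}"
          then have "x \<notin> ?Z" using x0min[of x] by auto
          then show "x \<in> b ` {i. i < c \<and> b i \<in> {y<..<x0}}" using x x0 by auto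
        qed
        have 2: "card (A \<inter> {y<..<x0}) \<le> card {i. i < c \<and> b i \<in> {y<..<x0}}"
          by (rule order_trans[OF card_mono[OF _ 1] card_image_le]) auto
        \<comment> \<open>\<open>x0\<close> was free and admissible at position \<open>i\<close>, so
          greediness gives a value of at least \<open>x0\<close>. Hence the positions counted below
          \<open>x0\<close> and those counted by the later columns are disjoint.\<close>
        have 3: "x0 \<le> b i" if "i < c" "x0 - 1 < hd bs i" for i
        proof -
          have "x0 \<notin> b ` {..<i}" using x0 that(1) by auto
          then show ?thesis using that x0 ck b(3)[of i x0] by auto
        qed
        have "card {i. i < c \<and> b i \<in> {y<..<x0}} + card {i. i < c \<and> x0 - 1 < hd bs i}
            = card ({i. i < c \<and> b i \<in> {y<..<x0}} \<union> {i. i < c \<and> x0 - 1 < hd bs i})"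
        proof (rule card_Un_disjoint[symmetric])
          show "{i. i < c \<and> b i \<in> {y<..<x0}} \<inter> {i. i < c \<and> x0 - 1 < hd bs i} = {}"
            using 3 by fastforce
        qed auto
        also have "\<dots> \<le> card {i. i < c \<and> y < b i}"
        proof (rule card_mono)
          show "{i. i < c \<and> b i \<in> {y<..<x0}} \<union> {i. i < c \<and> x0 - 1 < hd bs i} \<subseteq> {i. i < c \<and> y < b i}"
          proof
            fix i assume "i \<in> {i. i < c \<and> b i \<in> {y<..<x0}} \<union> {i. i < c \<and> x0 - 1 < hd bs i}"
            then show "i \<in> {i. i < c \<and> y < b i}" using 3[of i] x0 by auto
          qed
        qed auto
        finally have 4: "card {i. i < c \<and> b i \<in> {y<..<x0}} + card {i. i < c \<and> x0 - 1 < hd bs i}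
          \<le> card {i. i < c \<and> y < b i}" .
        have "card {y<..<X} \<le> card {y<..<x0} + card {x0 - 1<..<X}"
          by (rule order_trans[OF card_mono card_Un_le]) auto
        moreover have "card {y<..<x0} \<le> card ?D1 + card (A \<inter> {y<..<x0})"
          by (rule order_trans[OF card_mono card_Un_le]) (use A in auto)
        ultimately have "card {y<..<X} \<le> card ?D + card {i. i < c \<and> y < b i}"
          using D'(3) 2 4 cD by linarith
        moreover have "?D \<subseteq> {y<..<X}"
        proof
          fix s assume "s \<in> ?D"
          then show "s \<in> {y<..<X}"
          proof
            assume "s \<in> ?D1" then show ?thesis using x0 by auto
          next
            assume "s \<in> D'"
            then have "s \<in> {x0 - 1<..<X}" using D'(1) by blast
            then show ?thesis using x0 by auto
          qed
        qed
        moreover have "col_witness (\<lambda>j s. s \<notin> (A # As) ! j) (length (A # As)) ?D ?\<gamma>"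
        proof -
          have ge: "x0 \<le> s" if "s \<in> D'" for s
            using subsetD[OF D'(1) that] by simp
          have lt: "s < x0 \<and> s \<notin> A" if "s \<in> ?D1" for s using that by simp
          show ?thesis unfolding col_witness_def
          proof (intro conjI ballI impI)
            fix s assume s: "s \<in> ?D"
            have "?\<gamma> s < length (A # As) \<and> s \<notin> (A # As) ! ?\<gamma> s"
            proof (cases "s < x0")
              case True
              then have "s \<in> ?D1" using s ge[of s] by auto
              then show ?thesis using True lt[of s] by simp
            next
              case False
              then have "s \<in> D'" using s lt[of s] by blast
              then show ?thesis using False D'(2) unfolding col_witness_def by simp
            qed
            then show "?\<gamma> s < length (A # As)" "s \<notin> (A # As) ! ?\<gamma> s" by blast+
          next
            fix s t assume st: "s \<in> ?D" "t \<in> ?D" "s < t"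
            show "?\<gamma> s \<le> ?\<gamma> t"
            proof (cases "s < x0")
              case False
              then have nt: "\<not> t < x0" using st(3) by linarith
              have "s \<in> D'" using st(1) lt[of s] False by blast
              moreover have "t \<in> D'" using st(2) lt[of t] nt by blast
              moreover note nt
              ultimately have "s \<in> D'" "t \<in> D'" "\<not> t < x0" by blast+
              then show ?thesis using False st(3) D'(2) unfolding col_witness_def by simp
            qed simp
          qed
        qed
        ultimately show ?thesis unfolding c_def by blast
      qed
    qed
    have "(\<forall>j<length (A # As). bij_betw ((b # bs) ! j) {..<k} ((A # As) ! j))"
      using b(1) bs(2) by (auto simp: less_Suc_eq_0_disj nth_Cons split: nat.splits)
    moreover have "\<forall>j. Suc j < length (A # As) \<longrightarrow> (\<forall>i<k. ((b # bs) ! j) i \<le> ((b # bs) ! Suc j) i)"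
      using b(2) bs(3) hd by (auto simp: nth_Cons split: nat.splits)
    moreover have "\<forall>i<k. last (b # bs) i = sorted_list_of_set (last (A # As)) ! i"
      using bs(4) ne False by simp
    ultimately show ?thesis using bs(1) WW False by (intro exI[of _ "b # bs"]) auto
  qed
qed

section \<open>Bruhat order\<close>

text \<open>Corner counts of the permutation matrix; comparing them at all corners is the classical
  criterion for Bruhat order.\<close>

definition prefix_count :: "(nat \<Rightarrow> nat) \<Rightarrow> nat \<Rightarrow> nat \<Rightarrow> nat" where
  "prefix_count u c y = card {i. i < c \<and> u i \<le> y}"

text \<open>Descends from \<open>v\<close> to \<open>u\<close> in Bruhat order, each swap removing
  an inversion. The closure argument needs this form: it produces one curve per swap.\<close>

inductive bruhat_reach :: "nat \<Rightarrow> (nat \<Rightarrow> nat) \<Rightarrow> (nat \<Rightarrow> nat) \<Rightarrow> bool" for n where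
  bruhat_refl: "bruhat_reach n v v"
| bruhat_swap: "i < j \<Longrightarrow> j < n \<Longrightarrow> v j < v i \<Longrightarrow>
    bruhat_reach n (v(i := v j, j := v i)) u \<Longrightarrow> bruhat_reach n v u"

lemma prefix_count_split:
  assumes "i < c"
  shows "prefix_count u c y = card {l. l < c \<and> l \<noteq> i \<and> u l \<le> y} + (if u i \<le> y then 1 else 0)"
proof (cases "u i \<le> y")
  case True
  then have "{l. l < c \<and> u l \<le> y} = insert i {l. l < c \<and> l \<noteq> i \<and> u l \<le> y}" using assms by auto
  then show ?thesis using True by (simp add: prefix_count_def)
next
  case False
  then have "{l. l < c \<and> u l \<le> y} = {l. l < c \<and> l \<noteq> i \<and> u l \<le> y}" by auto
  then show ?thesis using False by (simp add: prefix_count_def)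
qed

lemma prefix_count_swap:
  assumes "i < j" "v j < v i"
  shows "prefix_count (v(i := v j, j := v i)) c y =
    prefix_count v c y + (if i < c \<and> c \<le> j \<and> v j \<le> y \<and> y < v i then 1 else 0)"
proof -
  let ?v = "v(i := v j, j := v i)"
  consider "c \<le> i" | "i < c" "c \<le> j" | "j < c" by linarith
  then show ?thesis
  proof cases
    case 1
    then have "{l. l < c \<and> ?v l \<le> y} = {l. l < c \<and> v l \<le> y}" using assms by auto
    then show ?thesis using 1 by (simp add: prefix_count_def)
  next
    case 2
    have "{l. l < c \<and> l \<noteq> i \<and> ?v l \<le> y} = {l. l < c \<and> l \<noteq> i \<and> v l \<le> y}" using 2 by auto
    then show ?thesis using 2 assms
      by (simp add: prefix_count_split[OF 2(1)])
  next
    case 3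
    have e: "?v l = v (transpose i j l)" for l by (auto simp: transpose_def)
    have tc: "transpose i j l < c \<longleftrightarrow> l < c" for l using 3 assms by (auto simp: transpose_def)
    have "bij_betw (transpose i j) {l. l < c \<and> v (transpose i j l) \<le> y} {l. l < c \<and> v l \<le> y}"
      by (rule bij_betw_byWitness[where f' = "transpose i j"]) (auto simp: tc)
    then have "prefix_count ?v c y = prefix_count v c y"
      unfolding prefix_count_def e by (rule bij_betw_same_card)
    then show ?thesis using 3 by simp
  qed
qed

text \<open>Induction on the total slack in the inequalities. The first position \<open>i\<close> of
  disagreement is swapped with the nearest later position \<open>j\<close> whose value lies between
  \<open>u i\<close> (included) and \<open>v i\<close> (excluded); one exists because the value
  \<open>u i\<close> occurs in \<open>v\<close> after \<open>i\<close>.\<close>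

lemma bruhat_reachI:
  assumes "bij_betw u {..<n} {1..n}" "bij_betw v {..<n} {1..n}"
    and "\<And>c y. c \<le> n \<Longrightarrow> prefix_count v c y \<le> prefix_count u c y"
    and "\<And>i. i \<ge> n \<Longrightarrow> v i = u i"
  shows "bruhat_reach n v u"
  using assms
proof (induction "\<Sum>c\<le>n. \<Sum>y\<le>n. prefix_count u c y - prefix_count v c y" arbitrary: v rule: less_induct)
  case less
  show ?case
  proof (cases "\<forall>i<n. v i = u i")
    case True
    then have "v = u" using less.prems(4) by (metis ext linorder_not_le)
    then show ?thesis by (simp add: bruhat_reach.bruhat_refl)
  next
    case False
    define i where "i = (LEAST i. i < n \<and> v i \<noteq> u i)"
    from False have i: "i < n" "v i \<noteq> u i" unfolding i_def by (metis (mono_tags, lifting) LeastI)+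
    have agree: "v l = u l" if "l < i" for l
      using not_less_Least[of l "\<lambda>i. i < n \<and> v i \<noteq> u i"] that i unfolding i_def[symmetric] by auto
    have "prefix_count v (Suc i) (v i) \<le> prefix_count u (Suc i) (v i)" using less.prems(3) i by simp
    moreover have "{l. l < Suc i \<and> l \<noteq> i \<and> v l \<le> v i} = {l. l < Suc i \<and> l \<noteq> i \<and> u l \<le> v i}"
      using agree by (auto simp: less_Suc_eq)
    ultimately have "u i \<le> v i"
      using prefix_count_split[of i "Suc i" v "v i"] prefix_count_split[of i "Suc i" u "v i"]
      by (auto split: if_splits)
    with i have ui: "u i < v i" by simp
    have "u i \<in> v ` {..<n}" using less.prems(1,2) i by (auto simp: bij_betw_def)
    then obtain j0 where j0: "j0 < n" "v j0 = u i" by auto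
    have "j0 \<noteq> i" using j0 i by auto
    moreover have "\<not> j0 < i"
    proof
      assume "j0 < i"
      then have "u j0 = u i" using agree[of j0] j0 by simp
      then show False using less.prems(1) \<open>j0 < i\<close> j0 i by (auto simp: bij_betw_def inj_on_def)
    qed
    ultimately have j0i: "i < j0" by simp
    define j where "j = (LEAST j. i < j \<and> u i \<le> v j \<and> v j < v i)"
    have j: "i < j \<and> u i \<le> v j \<and> v j < v i" unfolding j_def
      by (rule LeastI[of _ j0]) (use j0 j0i ui in auto)
    have jmin: "\<not> (u i \<le> v l \<and> v l < v i)" if "i < l" "l < j" for l
      using not_less_Least[of l "\<lambda>j. i < j \<and> u i \<le> v j \<and> v j < v i"] that unfolding j_def[symmetric] by auto
    have "j \<le> j0" unfolding j_def by (rule Least_le) (use j0 j0i ui in auto)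
    then have jn: "j < n" using j0 by simp
    let ?v = "v(i := v j, j := v i)"
    \<comment> \<open>Exactly where the swap raises the count there is room for it. By minimality of
      \<open>j\<close>, entries of \<open>v\<close> at positions from \<open>i\<close> to
      \<open>c - 1\<close> that are at most \<open>y\<close> are already below \<open>u i\<close>,
      so the inequality at height \<open>u i - 1\<close> applies, and \<open>u\<close> has one more
      entry up to \<open>y\<close>, namely \<open>u i\<close> itself.\<close>
    have slack: "prefix_count v c y + 1 \<le> prefix_count u c y"
      if c: "i < c" "c \<le> j" "v j \<le> y" "y < v i" for c y
    proof -
      have sp: "prefix_count f c z = card {l. l < i \<and> f l \<le> z} + card {l. i \<le> l \<and> l < c \<and> f l \<le> z}" for f z
      proof -
        have "prefix_count f c z = card ({l. l < i \<and> f l \<le> z} \<union> {l. i \<le> l \<and> l < c \<and> f l \<le> z})"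
          unfolding prefix_count_def by (rule arg_cong[where f = card]) (use c in auto)
        also have "\<dots> = card {l. l < i \<and> f l \<le> z} + card {l. i \<le> l \<and> l < c \<and> f l \<le> z}"
          by (rule card_Un_disjoint) auto
        finally show ?thesis .
      qed
      have ui1: "1 \<le> u i" using less.prems(1) i by (auto simp: bij_betw_def)
      have pre: "{l. l < i \<and> u l \<le> z} = {l. l < i \<and> v l \<le> z}" for z using agree by auto
      have "{l. i \<le> l \<and> l < c \<and> v l \<le> y} \<subseteq> {l. i \<le> l \<and> l < c \<and> v l \<le> u i - 1}"
      proof
        fix l assume l: "l \<in> {l. i \<le> l \<and> l < c \<and> v l \<le> y}"
        then have "i < l" using c by (cases "l = i") auto
        then show "l \<in> {l. i \<le> l \<and> l < c \<and> v l \<le> u i - 1}" using jmin[of l] l c by auto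
      qed
      then have 1: "card {l. i \<le> l \<and> l < c \<and> v l \<le> y} \<le> card {l. i \<le> l \<and> l < c \<and> v l \<le> u i - 1}"
        by (rule card_mono[rotated]) auto
      have "prefix_count v c (u i - 1) \<le> prefix_count u c (u i - 1)" using less.prems(3) c jn by simp
      then have 2: "card {l. i \<le> l \<and> l < c \<and> v l \<le> u i - 1} \<le> card {l. i \<le> l \<and> l < c \<and> u l \<le> u i - 1}"
        unfolding sp using pre by simp
      have "card (insert i {l. i \<le> l \<and> l < c \<and> u l \<le> u i - 1}) \<le> card {l. i \<le> l \<and> l < c \<and> u l \<le> y}"
        using c j by (intro card_mono) auto
      moreover have "i \<notin> {l. i \<le> l \<and> l < c \<and> u l \<le> u i - 1}" using ui1 by auto
      ultimately have 3: "card {l. i \<le> l \<and> l < c \<and> u l \<le> u i - 1} + 1 \<le> card {l. i \<le> l \<and> l < c \<and> u l \<le> y}"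
        by simp
      show ?thesis unfolding sp using pre 1 2 3 by simp
    qed
    have pc: "prefix_count ?v c y = prefix_count v c y + (if i < c \<and> c \<le> j \<and> v j \<le> y \<and> y < v i then 1 else 0)" for c y
      using prefix_count_swap j by blast
    have le: "prefix_count ?v c y \<le> prefix_count u c y" if "c \<le> n" for c y
      unfolding pc using slack[of c y] less.prems(3)[OF that, of y] by auto
    have vj: "v j \<le> n" using less.prems(2) jn by (auto simp: bij_betw_def)
    have "(\<Sum>c\<le>n. \<Sum>y\<le>n. prefix_count u c y - prefix_count ?v c y)
        < (\<Sum>c\<le>n. \<Sum>y\<le>n. prefix_count u c y - prefix_count v c y)"
    proof (rule sum_strict_mono_ex1)
      show "\<forall>c\<in>{..n}. (\<Sum>y\<le>n. prefix_count u c y - prefix_count ?v c y)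
        \<le> (\<Sum>y\<le>n. prefix_count u c y - prefix_count v c y)"
        unfolding pc by (intro ballI sum_mono) auto
      show "\<exists>c\<in>{..n}. (\<Sum>y\<le>n. prefix_count u c y - prefix_count ?v c y)
        < (\<Sum>y\<le>n. prefix_count u c y - prefix_count v c y)"
      proof (rule bexI[of _ j])
        show "(\<Sum>y\<le>n. prefix_count u j y - prefix_count ?v j y)
          < (\<Sum>y\<le>n. prefix_count u j y - prefix_count v j y)"
        proof (rule sum_strict_mono_ex1)
          show "\<forall>y\<in>{..n}. prefix_count u j y - prefix_count ?v j y \<le> prefix_count u j y - prefix_count v j y"
            unfolding pc by auto
          show "\<exists>y\<in>{..n}. prefix_count u j y - prefix_count ?v j y < prefix_count u j y - prefix_count v j y"
            using slack[of j "v j"] j vj unfolding pc by (intro bexI[of _ "v j"]) auto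
        qed simp
      qed (use jn in auto)
    qed simp
    moreover have "bij_betw ?v {..<n} {1..n}"
    proof -
      have "?v = v \<circ> transpose i j" by (auto simp: transpose_def fun_eq_iff)
      moreover have "bij_betw (transpose i j) {..<n} {..<n}"
        using i jn permutes_imp_bij[OF permutes_swap_id[of i "{..<n}" j]] by auto
      ultimately show ?thesis using bij_betw_trans[OF _ less.prems(2)] by metis
    qed
    moreover have "?v l = u l" if "l \<ge> n" for l using that i jn less.prems(4) by auto
    ultimately have st: "bruhat_reach n ?v u" using less.hyps[of ?v] less.prems(1) le by blast
    show ?thesis by (rule bruhat_reach.bruhat_swap[OF _ jn _ st]) (use j in auto)
  qed
qed

section \<open>Richardson strata\<close>

text \<open>Gaussian elimination of one equation and one unknown at a time. It supplies the
  dimension counts behind the rank bounds below.\<close>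

lemma homogeneous_system:
  fixes c :: "'i \<Rightarrow> 'j \<Rightarrow> 'a::field"
  assumes "finite A" "finite B" "card A < card B"
  shows "\<exists>x. (\<exists>b\<in>B. x b \<noteq> 0) \<and> (\<forall>a\<in>A. (\<Sum>b\<in>B. c a b * x b) = 0)"
  using assms
proof (induction "card A" arbitrary: A B c)
  case 0
  then obtain b where "b \<in> B" by (metis card.empty ex_in_conv less_irrefl)
  with 0 show ?case by (intro exI[of _ "\<lambda>_. 1"]) auto
next
  case (Suc m)
  then obtain a A' where A: "A = insert a A'" "a \<notin> A'" "card A' = m" "finite A'"
    by (metis card_Suc_eq finite_insert)
  show ?case
  proof (cases "\<forall>b\<in>B. c a b = 0")
    case True
    obtain x where "\<exists>b\<in>B. x b \<noteq> 0" "\<forall>a\<in>A'. (\<Sum>b\<in>B. c a b * x b) = 0"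
      using Suc.hyps(1)[of A' B c] A Suc.prems by auto
    then show ?thesis using True A by (intro exI[of _ x]) auto
  next
    case False
    then obtain b0 where b0: "b0 \<in> B" "c a b0 \<noteq> 0" by auto
    define B' where "B' = B - {b0}"
    have B: "finite B'" "b0 \<notin> B'" "B = insert b0 B'" "card B' = card B - 1"
      using b0 Suc.prems by (auto simp: B'_def)
    define c' where "c' = (\<lambda>i b. c i b - c i b0 / c a b0 * c a b)"
    have "card A' < card B'" using A Suc.prems B(4) by simp
    then obtain x where x: "\<exists>b\<in>B'. x b \<noteq> 0" "\<forall>i\<in>A'. (\<Sum>b\<in>B'. c' i b * x b) = 0"
      using Suc.hyps(1)[of A' B' c'] A Suc.prems B(1,4) by auto
    define x' where "x' = x(b0 := - (\<Sum>b\<in>B'. c a b * x b) / c a b0)"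
    have s: "(\<Sum>b\<in>B. c i b * x' b) = (\<Sum>b\<in>B'. c i b * x b) - c i b0 * (\<Sum>b\<in>B'. c a b * x b) / c a b0" for i
    proof -
      have "(\<Sum>b\<in>B'. c i b * x' b) = (\<Sum>b\<in>B'. c i b * x b)"
        using B(2) by (intro sum.cong) (auto simp: x'_def)
      then show ?thesis using B(1,2) by (subst B(3)) (simp add: x'_def)
    qed
    have "(\<Sum>b\<in>B. c a b * x' b) = 0" unfolding s using b0 by simp
    moreover have "(\<Sum>b\<in>B. c i b * x' b) = 0" if "i \<in> A'" for i
    proof -
      have "(\<Sum>b\<in>B'. c' i b * x b) = (\<Sum>b\<in>B'. c i b * x b) - c i b0 / c a b0 * (\<Sum>b\<in>B'. c a b * x b)"
        unfolding c'_def by (simp add: left_diff_distrib sum_subtractf sum_distrib_left mult.assoc)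
      then show ?thesis unfolding s using x(2) that by auto
    qed
    moreover have "\<exists>b\<in>B. x' b \<noteq> 0" using x(1) B(2) by (subst B(3)) (auto simp: x'_def)
    ultimately show ?thesis using A by auto
  qed
qed

text \<open>Rows of the matrix span a flag that ends according to w and, after a lower
  triangular change of basis, starts according to u.\<close>

definition richardson_up :: "nat \<Rightarrow> (nat \<Rightarrow> nat) \<Rightarrow> (nat \<Rightarrow> nat \<Rightarrow> 'a::field) \<Rightarrow> bool" where
  "richardson_up n w G \<longleftrightarrow> (\<forall>i<n. G i (w i) \<noteq> 0 \<and> (\<forall>c\<in>{1..n}. w i < c \<longrightarrow> G i c = 0))"

definition echelon :: "nat \<Rightarrow> (nat \<Rightarrow> nat) \<Rightarrow> (nat \<Rightarrow> nat \<Rightarrow> 'a::field) \<Rightarrow> bool" where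
  "echelon n u H \<longleftrightarrow> (\<forall>i<n. H i (u i) \<noteq> 0 \<and> (\<forall>c\<in>{1..n}. c < u i \<longrightarrow> H i c = 0))"

definition row_combination :: "nat \<Rightarrow> (nat \<Rightarrow> nat \<Rightarrow> 'a::field) \<Rightarrow> (nat \<Rightarrow> nat \<Rightarrow> 'a) \<Rightarrow> (nat \<Rightarrow> nat \<Rightarrow> 'a) \<Rightarrow> bool" where
  "row_combination n L G H \<longleftrightarrow> (\<forall>i<n. L i i \<noteq> 0 \<and> (\<forall>c\<in>{1..n}. H i c = (\<Sum>r\<le>i. L i r * G r c)))"

text \<open>A lower triangular \<open>L\<close> leaves the spans of initial rows unchanged, so this
  is an intersection of two opposite Schubert cells of flags. All \<open>n\<close> rows are kept
  although a point of \<open>Gr\<close> only sees the first \<open>k\<close>: the later rows control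
  intervals that do not wrap around.\<close>

definition richardson :: "nat \<Rightarrow> (nat \<Rightarrow> nat) \<Rightarrow> (nat \<Rightarrow> nat) \<Rightarrow> (nat \<Rightarrow> nat \<Rightarrow> 'a::field) \<Rightarrow> bool" where
  "richardson n u w G \<longleftrightarrow> richardson_up n w G \<and> (\<exists>L H. row_combination n L G H \<and> echelon n u H)"

text \<open>Forward substitution, the diagonal of \<open>L\<close> being nonzero.\<close>

lemma row_combination_zero:
  assumes rc: "row_combination n L G H" and "k \<le> n" "U \<subseteq> {1..n}"
    and "\<And>i. i < k \<Longrightarrow> (\<Sum>l\<in>U. H i l * x l) = 0" and "i < k"
  shows "(\<Sum>l\<in>U. G i l * x l) = (0::'a::field)"
  using \<open>i < k\<close>
proof (induction i rule: less_induct)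
  case (less i)
  have "0 = (\<Sum>l\<in>U. H i l * x l)" using assms less by simp
  also have "\<dots> = (\<Sum>l\<in>U. (\<Sum>r\<le>i. L i r * G r l) * x l)"
    using rc less \<open>k \<le> n\<close> \<open>U \<subseteq> {1..n}\<close>
    by (intro sum.cong) (auto simp: row_combination_def)
  also have "\<dots> = (\<Sum>r\<le>i. L i r * (\<Sum>l\<in>U. G r l * x l))"
    by (simp add: sum_distrib_right sum_distrib_left mult.assoc sum.swap[of _ U])
  also have "\<dots> = (\<Sum>r<i. L i r * (\<Sum>l\<in>U. G r l * x l)) + L i i * (\<Sum>l\<in>U. G i l * x l)"
    by (simp add: lessThan_Suc_atMost[symmetric])
  also have "(\<Sum>r<i. L i r * (\<Sum>l\<in>U. G r l * x l)) = 0" using less by (intro sum.neutral) auto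
  finally show ?case using rc less \<open>k \<le> n\<close> by (auto simp: row_combination_def)
qed

lemma lin_indep_colsD:
  assumes "lin_indep_cols k G U" and "\<And>i. i < k \<Longrightarrow> (\<Sum>l\<in>U. G i l * x l) = 0" and "l \<in> U"
  shows "x l = 0"
proof -
  have "(\<Sum>l\<in>U. x l * G i l) = 0" if "i < k" for i
    using assms(2)[OF that] by (simp only: mult.commute)
  then show ?thesis using assms(1,3) unfolding lin_indep_cols_def by blast
qed

text \<open>A row \<open>i < c\<close> of \<open>H\<close> with \<open>y < u i\<close> vanishes on
  the columns up to \<open>y\<close> by its leading position, and on the columns from
  \<open>X\<close> on because it combines rows of \<open>G\<close> that end before \<open>X\<close>.
  Such rows add nothing to the rank outside \<open>{y<..<X}\<close>.\<close>

lemma richardson_wrapped_rank: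
  fixes G :: "nat \<Rightarrow> nat \<Rightarrow> 'a::field"
  assumes "richardson n u w G" "k \<le> n" "c \<le> k"
    and wc: "\<And>i. i < c \<Longrightarrow> w i < X"
    and U: "U \<subseteq> {1..n} - {y<..<X}" "lin_indep_cols k G U"
  shows "card U + card {i. i < c \<and> y < u i} \<le> k"
proof (rule ccontr)
  from assms(1) obtain L H where up: "richardson_up n w G"
    and rc: "row_combination n L G H" and ec: "echelon n u H" by (auto simp: richardson_def)
  let ?Z = "{i. i < c \<and> y < u i}"
  have Z: "?Z \<subseteq> {..<k}" using assms by auto
  assume "\<not> card U + card ?Z \<le> k"
  moreover have "card ({..<k} - ?Z) = k - card ?Z" using Z by (simp add: card_Diff_subset finite_subset)
  moreover have "card ?Z \<le> k" using card_mono[OF _ Z] by simp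
  ultimately have "card ({..<k} - ?Z) < card U" by simp
  moreover have fU: "finite U" using U(1) finite_subset by blast
  ultimately obtain x where x: "\<exists>b\<in>U. x b \<noteq> 0" "\<forall>a\<in>{..<k} - ?Z. (\<Sum>b\<in>U. H a b * x b) = 0"
    using homogeneous_system[of "{..<k} - ?Z" U H] by auto
  have "(\<Sum>l\<in>U. H i l * x l) = 0" if "i < k" for i
  proof (cases "i \<in> ?Z")
    case True
    have "H i l = 0" if "l \<in> U" for l
    proof -
      have l: "l \<in> {1..n}" "l \<le> y \<or> X \<le> l" using that U(1) by auto
      from l(2) show ?thesis
      proof
        assume "l \<le> y"
        then show ?thesis using ec True l assms(2,3) by (auto simp: echelon_def)
      next
        assume "X \<le> l"
        have "G r l = 0" if "r \<le> i" for r
        proof -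
          have "w r < l" using wc[of r] that True \<open>X \<le> l\<close> by simp
          then show ?thesis using up l that True assms(2,3) by (auto simp: richardson_up_def)
        qed
        then show ?thesis using rc l True assms(2,3) by (auto simp: row_combination_def)
      qed
    qed
    then show ?thesis by simp
  next
    case False
    then show ?thesis using x(2) that by auto
  qed
  then have "(\<Sum>l\<in>U. G i l * x l) = 0" if "i < k" for i
    using row_combination_zero[OF rc \<open>k \<le> n\<close>, of U x i] U(1) that by auto
  then show False using x(1) lin_indep_colsD[OF U(2), of x] by blast
qed

text \<open>The dual bound. The columns \<open>{1..<x}\<close> are adjoined to \<open>U\<close>: on
  columns up to \<open>y\<close>, only rows of \<open>H\<close> with \<open>u i \<le> y\<close> are
  nonzero, so too many columns are dependent as far as the first \<open>c\<close> rows are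
  concerned. The dependency then proves to be carried by \<open>U\<close> alone.\<close>

lemma richardson_interval_rank:
  fixes G :: "nat \<Rightarrow> nat \<Rightarrow> 'a::field"
  assumes "richardson n u w G" "k \<le> c" "c \<le> n" and u: "bij_betw u {..<n} {1..n}"
    and w: "bij_betw w {..<n} {1..n}"
    and wc: "\<And>i. c \<le> i \<Longrightarrow> i < n \<Longrightarrow> x \<le> w i" and x: "1 \<le> x" "x \<le> Suc y" "y \<le> n"
    and U: "U \<subseteq> {x..y}" "lin_indep_cols k G U"
  shows "card U + card {i. c \<le> i \<and> i < n \<and> u i \<le> y} \<le> card {x..y}"
proof (rule ccontr)
  from assms(1) obtain L H where up: "richardson_up n w G"
    and rc: "row_combination n L G H" and ec: "echelon n u H" by (auto simp: richardson_def)
  let ?N = "{i. i < c \<and> u i \<le> y}" and ?M = "{i. c \<le> i \<and> i < n \<and> u i \<le> y}"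
  let ?U = "{1..<x} \<union> U"
  have inj: "inj_on u {..<n}" and im: "u ` {..<n} = {1..n}" using u by (auto simp: bij_betw_def)
  have "u ` (?N \<union> ?M) = {1..y}"
  proof
    show "u ` (?N \<union> ?M) \<subseteq> {1..y}" using im \<open>c \<le> n\<close> by auto
    show "{1..y} \<subseteq> u ` (?N \<union> ?M)"
    proof
      fix v assume v: "v \<in> {1..y}"
      then have "v \<in> u ` {..<n}" unfolding im using x by auto
      then obtain i where "i < n" "v = u i" by auto
      then show "v \<in> u ` (?N \<union> ?M)" using v by (cases "i < c") auto
    qed
  qed
  moreover have "inj_on u (?N \<union> ?M)" using \<open>c \<le> n\<close> by (intro inj_on_subset[OF inj]) auto
  ultimately have "card (?N \<union> ?M) = y" using card_image[of u "?N \<union> ?M"] by simp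
  moreover have "card (?N \<union> ?M) = card ?N + card ?M" by (rule card_Un_disjoint) auto
  ultimately have cNM: "card ?N + card ?M = y" by simp
  assume "\<not> card U + card ?M \<le> card {x..y}"
  then have "y < card U + card ?M + (x - 1)" using x by simp
  moreover have fU: "finite U" using U(1) finite_subset by blast
  moreover have "card ?U = (x - 1) + card U" using U fU by (subst card_Un_disjoint) auto
  ultimately have "card ?N < card ?U" using cNM by linarith
  then obtain z where z: "\<exists>b\<in>?U. z b \<noteq> 0" "\<forall>a\<in>?N. (\<Sum>b\<in>?U. H a b * z b) = 0"
    using homogeneous_system[of ?N ?U H] fU by auto
  have Usub: "?U \<subseteq> {1..n}" and Uy: "\<And>l. l \<in> ?U \<Longrightarrow> l \<le> y" using U x by force+
  have "(\<Sum>l\<in>?U. H i l * z l) = 0" if "i < c" for i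
  proof (cases "u i \<le> y")
    case True then show ?thesis using z(2) that by auto
  next
    case False
    have "H i l = 0" if "l \<in> ?U" for l
      using ec that \<open>i < c\<close> \<open>c \<le> n\<close> False Usub Uy[OF that] by (auto simp: echelon_def)
    then show ?thesis by simp
  qed
  then have G0: "(\<Sum>l\<in>?U. G i l * z l) = 0" if "i < c" for i
    using row_combination_zero[OF rc \<open>c \<le> n\<close> Usub, of z i] that by auto
  \<comment> \<open>Each column \<open>l < x\<close> is the last nonzero column of some row below
    \<open>c\<close>, since the rows from \<open>c\<close> on end at \<open>x\<close> or later. That
    row isolates \<open>z l\<close> once the coefficients of smaller columns are known to
    vanish.\<close>
  have z0: "l < x \<Longrightarrow> 1 \<le> l \<Longrightarrow> z l = 0" for l
  proof (induction l rule: less_induct)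
    case (less l)
    have "l \<in> w ` {..<n}" using w less x by (auto simp: bij_betw_def)
    then obtain i where i: "i < n" "w i = l" by auto
    then have "i < c" using wc[of i] less by (metis linorder_not_le)
    have "(\<Sum>l'\<in>?U. G i l' * z l') = (\<Sum>l'\<in>{l}. G i l' * z l')"
    proof (rule sum.mono_neutral_right)
      show "\<forall>l'\<in>?U - {l}. G i l' * z l' = 0"
      proof
        fix l' assume l': "l' \<in> ?U - {l}"
        show "G i l' * z l' = 0"
        proof (cases "l' < l")
          case True then show ?thesis using less l' Usub by auto
        next
          case False
          then have "w i < l'" "l' \<in> {1..n}" using l' i subsetD[OF Usub, of l'] by auto
          then show ?thesis using up i by (simp add: richardson_up_def)
        qed
      qed
    qed (use fU less in auto)
    then have "G i l * z l = 0" using G0[OF \<open>i < c\<close>] by simp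
    then show ?case using up i by (auto simp: richardson_up_def)
  qed
  have "(\<Sum>l\<in>U. G i l * z l) = 0" if "i < k" for i
  proof -
    have "(\<Sum>l\<in>?U. G i l * z l) = (\<Sum>l\<in>U. G i l * z l)"
      by (rule sum.mono_neutral_right) (use fU z0 in auto)
    then show ?thesis using G0[of i] that \<open>k \<le> c\<close> by simp
  qed
  then have "z l = 0" if "l \<in> U" for l using lin_indep_colsD[OF U(2), of z] that by blast
  then show False using z(1) z0 by auto
qed

text \<open>Take the largest column \<open>l = u i\<close> on which \<open>x\<close> is nonzero: row
  \<open>i\<close> vanishes on all smaller columns, so its equation isolates
  \<open>x l\<close>.\<close>

lemma echelon_kernel:
  fixes H :: "nat \<Rightarrow> nat \<Rightarrow> 'a::field"
  assumes ec: "echelon n u H" and "k \<le> n" and u: "u ` {..<n} \<subseteq> {1..n}"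
    and H0: "\<And>i. i < k \<Longrightarrow> (\<Sum>l\<in>u ` {..<k}. H i l * x l) = 0"
  shows "\<forall>l\<in>u ` {..<k}. x l = 0"
proof (rule ccontr)
  let ?U = "u ` {..<k}"
  have Usub: "?U \<subseteq> {1..n}" using u \<open>k \<le> n\<close> by auto
  assume "\<not> ?thesis"
  then have ne: "{l \<in> ?U. x l \<noteq> 0} \<noteq> {}" by auto
  define l where "l = Max {l \<in> ?U. x l \<noteq> 0}"
  have l: "l \<in> {l \<in> ?U. x l \<noteq> 0}" unfolding l_def by (rule Max_in[OF _ ne]) auto
  have lmax: "l' \<le> l" if "l' \<in> ?U" "x l' \<noteq> 0" for l' unfolding l_def using that by (intro Max_ge) auto
  from l obtain i where i: "i < k" "u i = l" by auto
  have "(\<Sum>l'\<in>?U. H i l' * x l') = (\<Sum>l'\<in>{l}. H i l' * x l')"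
  proof (rule sum.mono_neutral_right)
    show "\<forall>l'\<in>?U - {l}. H i l' * x l' = 0"
    proof
      fix l' assume l': "l' \<in> ?U - {l}"
      show "H i l' * x l' = 0"
      proof (cases "x l' = 0")
        case False
        then have "l' < u i" using lmax[of l'] l' i by force
        moreover have "l' \<in> {1..n}" using l' Usub by blast
        ultimately have "H i l' = 0" using ec i \<open>k \<le> n\<close> unfolding echelon_def by auto
        then show ?thesis by simp
      qed auto
    qed
  qed (use l in auto)
  then have "H i l * x l = 0" using H0[OF i(1)] by simp
  moreover have "i < n" using i \<open>k \<le> n\<close> by simp
  then have "H i (u i) \<noteq> 0" using ec unfolding echelon_def by blast
  ultimately show False using i l by simp
qed

lemma richardson_indep:
  fixes G :: "nat \<Rightarrow> nat \<Rightarrow> 'a::field"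
  assumes "richardson n u w G" "k \<le> n" and u: "u ` {..<n} \<subseteq> {1..n}"
  shows "lin_indep_cols k G (u ` {..<k})"
  unfolding lin_indep_cols_def
proof (intro allI impI)
  from assms(1) obtain L H where
    rc: "row_combination n L G H" and ec: "echelon n u H" by (auto simp: richardson_def)
  let ?U = "u ` {..<k}"
  have Usub: "?U \<subseteq> {1..n}" using u \<open>k \<le> n\<close> by auto
  fix x assume x: "\<forall>r<k. (\<Sum>l\<in>?U. x l * G r l) = 0"
  have H0: "(\<Sum>l\<in>?U. H i l * x l) = 0" if "i < k" for i
  proof -
    have "(\<Sum>l\<in>?U. H i l * x l) = (\<Sum>l\<in>?U. (\<Sum>r\<le>i. L i r * G r l) * x l)"
      using rc that \<open>k \<le> n\<close> Usub by (intro sum.cong) (auto simp: row_combination_def)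
    also have "\<dots> = (\<Sum>r\<le>i. L i r * (\<Sum>l\<in>?U. x l * G r l))"
      by (simp add: sum_distrib_right sum_distrib_left mult_ac sum.swap[of _ ?U])
    also have "\<dots> = 0" using x that by simp
    finally show ?thesis .
  qed
  show "\<forall>l\<in>?U. x l = 0" by (rule echelon_kernel[OF ec \<open>k \<le> n\<close> u H0])
qed

text \<open>The right-hand side becomes an additional column \<open>0\<close>, giving
  \<open>n + 1\<close> unknowns for \<open>n\<close> homogeneous equations. The unknown
  \<open>x 0\<close> cannot vanish by \<open>echelon_kernel\<close>, so the solution can be divided
  by it.\<close>

lemma echelon_solve:
  fixes H :: "nat \<Rightarrow> nat \<Rightarrow> 'a::field"
  assumes ec: "echelon n u H" and u: "bij_betw u {..<n} {1..n}"
  shows "\<exists>x. \<forall>m<n. (\<Sum>c\<in>{1..n}. H m c * x c) = rhs m"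
proof -
  let ?c = "\<lambda>m c. if c = 0 then - rhs m else H m c"
  have lt: "card {..<n} < card {0..n}" by simp
  obtain x where x: "\<exists>b\<in>{0..n}. x b \<noteq> 0" "\<forall>m\<in>{..<n}. (\<Sum>b\<in>{0..n}. ?c m b * x b) = 0"
    using homogeneous_system[OF finite_lessThan finite_atLeastAtMost lt, of ?c] by blast
  have s: "(\<Sum>b\<in>{0..n}. ?c m b * x b) = (\<Sum>b\<in>{1..n}. H m b * x b) - rhs m * x 0" for m
  proof -
    have "{0..n} = insert 0 {1..n}" by auto
    then have "(\<Sum>b\<in>{0..n}. ?c m b * x b) = - rhs m * x 0 + (\<Sum>b\<in>{1..n}. ?c m b * x b)" by simp
    also have "(\<Sum>b\<in>{1..n}. ?c m b * x b) = (\<Sum>b\<in>{1..n}. H m b * x b)" by (intro sum.cong) auto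
    finally show ?thesis by simp
  qed
  have eq: "(\<Sum>b\<in>{1..n}. H m b * x b) = rhs m * x 0" if "m < n" for m
    using x(2) s[of m] that by simp
  have im: "u ` {..<n} = {1..n}" using u by (simp add: bij_betw_def)
  have "x 0 \<noteq> 0"
  proof
    assume "x 0 = 0"
    then have "\<forall>l\<in>u ` {..<n}. x l = 0"
      using eq im by (intro echelon_kernel[OF ec]) auto
    then show False using x(1) \<open>x 0 = 0\<close> unfolding im by (metis One_nat_def Suc_leI atLeastAtMost_iff neq0_conv)
  qed
  have "(\<Sum>c\<in>{1..n}. H m c * (x c / x 0)) = rhs m" if "m < n" for m
  proof -
    have "(\<Sum>c\<in>{1..n}. H m c * (x c / x 0)) = (\<Sum>c\<in>{1..n}. H m c * x c) / x 0"
      by (simp add: sum_divide_distrib)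
    then show ?thesis using eq[OF that] \<open>x 0 \<noteq> 0\<close> by simp
  qed
  then show ?thesis by (intro exI[of _ "\<lambda>c. x c / x 0"] allI impI)
qed

text \<open>Moves a row vector by the lower triangular factor of the identity plus t times the
  rank one matrix with column x and row y, its columns rescaled by the leading minors.\<close>

definition lu_move :: "nat \<Rightarrow> (nat \<Rightarrow> 'a::field) \<Rightarrow> (nat \<Rightarrow> 'a) \<Rightarrow> (nat \<Rightarrow> 'a) \<Rightarrow> nat \<Rightarrow> 'a" where
  "lu_move n x y r c = (\<Sum>l\<in>{1..c}. x l * y l) * r c + y c * (\<Sum>l\<in>{c<..n}. r l * x l)"

lemma lu_move_sum:
  "lu_move n x y (\<lambda>c. \<Sum>r\<in>I. a r * g r c) c = (\<Sum>r\<in>I. a r * lu_move n x y (g r) c)"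
proof -
  define A F where "A = (\<Sum>l\<in>{1..c}. x l * y l)" and "F = (\<lambda>r. \<Sum>l\<in>{c<..n}. g r l * x l)"
  have 1: "(\<Sum>l\<in>{c<..n}. (\<Sum>r\<in>I. a r * g r l) * x l) = (\<Sum>r\<in>I. a r * F r)"
    by (simp add: F_def sum_distrib_right sum_distrib_left mult.assoc sum.swap[of _ I])
  show ?thesis
    unfolding lu_move_def 1 A_def[symmetric] F_def[symmetric, THEN fun_cong]
    by (simp add: distrib_left sum.distrib sum_distrib_left mult_ac)
qed

lemma lu_move_cong:
  "(\<And>c. c \<in> {1..n} \<Longrightarrow> r c = r' c) \<Longrightarrow> c \<in> {1..n} \<Longrightarrow> lu_move n x y r c = lu_move n x y r' c"
proof -
  assume r: "\<And>c. c \<in> {1..n} \<Longrightarrow> r c = r' c" and c: "c \<in> {1..n}"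
  have "(\<Sum>l\<in>{c<..n}. r l * x l) = (\<Sum>l\<in>{c<..n}. r' l * x l)"
    using c by (intro sum.cong) (auto simp: r)
  then show ?thesis unfolding lu_move_def r[OF c] by simp
qed

text \<open>The definition suits rows of \<open>G\<close>, which have a last nonzero entry; this
  form suits rows of \<open>H\<close>, which have a first nonzero entry and a known pairing
  \<open>e\<close> with \<open>x\<close>.\<close>

lemma lu_move_eq:
  assumes "(\<Sum>l\<in>{1..n}. r l * x l) = e" "c \<le> n"
  shows "lu_move n x y r c = (\<Sum>l\<in>{1..c}. x l * y l) * r c + y c * (e - (\<Sum>l\<in>{1..c}. r l * x l))"
proof -
  have "{1..n} = {1..c} \<union> {c<..n}" using assms(2) by auto
  then have "e = (\<Sum>l\<in>{1..c}. r l * x l) + (\<Sum>l\<in>{c<..n}. r l * x l)"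
    using assms(1) sum.union_disjoint[of "{1..c}" "{c<..n}" "\<lambda>l. r l * x l"]
    by (simp add: disjoint_iff)
  then show ?thesis by (simp add: lu_move_def)
qed

lemma sum_upto_single:
  fixes f :: "nat \<Rightarrow> 'a::comm_monoid_add"
  assumes "\<And>l. l \<in> {1..n} \<Longrightarrow> l < c \<Longrightarrow> f l = 0" "c \<in> {1..n}"
  shows "(\<Sum>l\<in>{1..c}. f l) = f c"
proof -
  have "(\<Sum>l\<in>{1..c}. f l) = (\<Sum>l\<in>{c}. f l)" by (rule sum.mono_neutral_right) (use assms in auto)
  then show ?thesis by simp
qed

lemma sum_upto_zero:
  fixes f :: "nat \<Rightarrow> 'a::comm_monoid_add"
  assumes "\<And>l. l \<in> {1..n} \<Longrightarrow> l < p \<Longrightarrow> f l = 0" "c < p" "c \<le> n"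
  shows "(\<Sum>l\<in>{1..c}. f l) = 0"
proof (rule sum.neutral, rule ballI)
  fix l assume "l \<in> {1..c}"
  then have "l \<in> {1..n}" "l < p" using assms(2,3) by auto
  then show "f l = 0" by (rule assms(1))
qed

text \<open>Let \<open>x\<close> be column \<open>i\<close> of the inverse of \<open>H\<close>, and
  \<open>y\<close> row \<open>j\<close> of \<open>H\<close>. Right multiplication by the identity
  plus \<open>t\<close> times the rank one matrix of \<open>x\<close> and \<open>y\<close> adds
  \<open>t\<close> times row \<open>j\<close> of \<open>H\<close> to row \<open>i\<close>, moving
  the leading position of that row to \<open>v j\<close>. It could destroy the final positions
  \<open>w\<close>. Its lower triangular factor alone preserves them, and dropping the upper
  triangular factor does not change leading positions. Clearing the leading minors
  \<open>1 + t * s c\<close> makes the curve linear in \<open>t\<close>.\<close>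

lemma richardson_swap_curve:
  fixes G :: "nat \<Rightarrow> nat \<Rightarrow> 'a::field"
  assumes "richardson n v w G" and v: "bij_betw v {..<n} {1..n}" and w: "bij_betw w {..<n} {1..n}"
    and ij: "i < j" "j < n" "v j < v i"
  shows "\<exists>B s. \<forall>t. t \<noteq> 0 \<longrightarrow> (\<forall>c\<le>n. 1 + t * s c \<noteq> 0) \<longrightarrow>
    richardson n (v(i := v j, j := v i)) w (\<lambda>i c. G i c + t * B i c)"
proof -
  from assms(1) obtain L H where up: "richardson_up n w G"
    and rc: "row_combination n L G H" and ec: "echelon n v H" by (auto simp: richardson_def)
  have i: "i < n" using ij by simp
  obtain x where x: "\<And>m. m < n \<Longrightarrow> (\<Sum>c\<in>{1..n}. H m c * x c) = (if m = i then 1 else 0)"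
    using echelon_solve[OF ec v, of "\<lambda>m. if m = i then 1 else 0"] by blast
  define y where "y = H j"
  define s where "s = (\<lambda>c. \<Sum>l\<in>{1..c}. x l * y l)"
  define B where "B = (\<lambda>r. lu_move n x y (G r))"
  let ?v = "v(i := v j, j := v i)"
  have vr: "v m \<in> {1..n}" if "m < n" for m using v that by (auto simp: bij_betw_def)
  have wr: "w m \<in> {1..n}" if "m < n" for m using w that by (auto simp: bij_betw_def)
  have HL: "H m c = (\<Sum>r\<le>m. L m r * G r c)" if "m < n" "c \<in> {1..n}" for m c
    using rc that unfolding row_combination_def by blast
  have H0: "H m c = 0" if "m < n" "c \<in> {1..n}" "c < v m" for m c using ec that unfolding echelon_def by auto
  have H1: "H m (v m) \<noteq> 0" if "m < n" for m using ec that unfolding echelon_def by auto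
  have s_step: "s c = s (c - 1) + x c * y c" if "c \<in> {1..n}" for c
  proof -
    from that have "c = Suc (c - 1)" by simp
    then obtain c' where c': "c = Suc c'" ..
    show ?thesis unfolding c' s_def by simp
  qed
  have "richardson n ?v w (\<lambda>i c. G i c + t * B i c)" if t: "t \<noteq> 0" "\<forall>c\<le>n. 1 + t * s c \<noteq> 0" for t
  proof -
    define T where "T = (\<lambda>r c. r c + t * lu_move n x y r c)"
    have G': "(\<lambda>i c. G i c + t * B i c) = (\<lambda>i. T (G i))" by (simp add: T_def B_def)
    have Tc: "T r c = (1 + t * s c) * r c + t * y c * (e - (\<Sum>l\<in>{1..c}. r l * x l))"
      if "(\<Sum>l\<in>{1..n}. r l * x l) = e" "c \<in> {1..n}" for r e c
    proof -
      have eq: "lu_move n x y r c = s c * r c + y c * (e - (\<Sum>l\<in>{1..c}. r l * x l))"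
        unfolding s_def by (rule lu_move_eq[OF that(1)]) (use that(2) in simp)
      show ?thesis unfolding T_def eq by (simp add: distrib_left distrib_right mult.assoc)
    qed
    have Tsum: "T (H m) c = (\<Sum>r\<le>m. L m r * T (G r) c)" if "m < n" "c \<in> {1..n}" for m c
    proof -
      have "lu_move n x y (H m) c = lu_move n x y (\<lambda>c. \<Sum>r\<le>m. L m r * G r c) c"
        by (rule lu_move_cong[OF HL]) (use that in auto)
      also have "\<dots> = (\<Sum>r\<le>m. L m r * lu_move n x y (G r) c)" by (rule lu_move_sum)
      finally show ?thesis unfolding T_def HL[OF that]
        by (simp add: distrib_left sum.distrib sum_distrib_left mult_ac)
    qed
    have up': "richardson_up n w (\<lambda>i. T (G i))"
      unfolding richardson_up_def
    proof (intro allI impI conjI ballI)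
      fix m assume m: "m < n"
      have z: "G m c = 0" if "c \<in> {1..n}" "w m < c" for c using up m that unfolding richardson_up_def by auto
      have "(\<Sum>l\<in>{w m<..n}. G m l * x l) = 0" by (rule sum.neutral) (use z in auto)
      then have "T (G m) (w m) = (1 + t * s (w m)) * G m (w m)"
        by (simp add: T_def lu_move_def s_def algebra_simps)
      then show "T (G m) (w m) \<noteq> 0"
        using up m t wr[OF m] unfolding richardson_up_def by auto
      fix c assume c: "c \<in> {1..n}" "w m < c"
      have "(\<Sum>l\<in>{c<..n}. G m l * x l) = 0" by (rule sum.neutral) (use z c in auto)
      then show "T (G m) c = 0" using z[OF c] by (simp add: T_def lu_move_def)
    qed
    \<comment> \<open>The moved row \<open>i\<close> starts like \<open>t * y\<close>, at
      \<open>v j\<close>. Subtracting \<open>t\<close> times row \<open>j\<close> from it gives a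
      row starting at \<open>v i\<close>, which replaces row \<open>j\<close>; this exchanges the
      two leading positions.\<close>
    define L' where "L' = (\<lambda>m r. if m = j then (if r \<le> i then L i r else 0) - t * L j r else L m r)"
    define H' where "H' = (\<lambda>m c. if m = j then T (H i) c - t * T (H j) c else T (H m) c)"
    have rc': "row_combination n L' (\<lambda>i. T (G i)) H'"
      unfolding row_combination_def
    proof (intro allI impI conjI ballI)
      fix m assume m: "m < n"
      have "L j j \<noteq> 0" "L m m \<noteq> 0" using rc ij m unfolding row_combination_def by auto
      then show "L' m m \<noteq> 0" using t ij by (auto simp: L'_def)
      fix c assume c: "c \<in> {1..n}"
      show "H' m c = (\<Sum>r\<le>m. L' m r * T (G r) c)"
      proof (cases "m = j")
        case True
        have "(\<Sum>r\<le>i. L i r * T (G r) c) = (\<Sum>r\<le>j. (if r \<le> i then L i r else 0) * T (G r) c)"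
          using ij by (intro sum.mono_neutral_cong_left) auto
        then show ?thesis using True Tsum[OF i c] Tsum[OF ij(2) c]
          by (simp add: H'_def L'_def left_diff_distrib sum_subtractf sum_distrib_left mult.assoc)
      next
        case False
        then show ?thesis using Tsum[OF m c] by (simp add: H'_def L'_def)
      qed
    qed
    \<comment> \<open>Row \<open>j\<close> is fixed by the move: it equals \<open>y\<close> and
      pairs to zero with \<open>x\<close>, so the two correction terms cancel.\<close>
    have Tj: "T (H j) c = H j c" if c: "c \<in> {1..n}" for c
    proof -
      have "T (H j) c = (1 + t * s c) * H j c + t * y c * (0 - (\<Sum>l\<in>{1..c}. H j l * x l))"
        using x[OF ij(2)] ij by (intro Tc[OF _ c]) auto
      also have "(\<Sum>l\<in>{1..c}. H j l * x l) = s c" unfolding s_def y_def by (intro sum.cong) (auto simp: mult.commute)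
      finally show ?thesis by (simp add: y_def algebra_simps)
    qed
    have Ti: "T (H i) c = (1 + t * s c) * H i c + t * y c * (1 - (\<Sum>l\<in>{1..c}. H i l * x l))" if "c \<in> {1..n}" for c
      using x[OF i] by (intro Tc[OF _ that]) auto
    have Ti0: "T (H i) c = t * y c" if c: "c \<in> {1..n}" "c < v i" for c
    proof -
      have "(\<Sum>l\<in>{1..c}. H i l * x l) = 0"
        by (rule sum_upto_zero[of n "v i"]) (use H0[OF i] c in auto)
      then show ?thesis using Ti[OF c(1)] H0[OF i c] by simp
    qed
    have ec': "echelon n ?v H'"
      unfolding echelon_def
    proof (intro allI impI)
      fix m assume m: "m < n"
      consider (i) "m = i" | (j) "m = j" | (o) "m \<noteq> i" "m \<noteq> j" by blast
      then show "H' m (?v m) \<noteq> 0 \<and> (\<forall>c\<in>{1..n}. c < ?v m \<longrightarrow> H' m c = 0)"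
      proof cases
        case i
        have "H' i c = t * y c" if "c \<in> {1..n}" "c < v i" for c
          using Ti0[OF that] ij by (simp add: H'_def)
        then show ?thesis using i ij t H1[OF ij(2)] H0[OF ij(2)] vr[OF ij(2)] by (auto simp: y_def)
      next
        case j
        have z: "H' j c = 0" if "c \<in> {1..n}" "c < v i" for c
          using Ti0[OF that] Tj[OF that(1)] by (simp add: H'_def y_def)
        have c: "v i \<in> {1..n}" using vr[OF \<open>i < n\<close>] .
        have "(\<Sum>l\<in>{1..v i}. H i l * x l) = H i (v i) * x (v i)"
          by (rule sum_upto_single[of n]) (use H0[OF \<open>i < n\<close>] c in auto)
        then have "H' j (v i) = (1 + t * (s (v i) - x (v i) * y (v i))) * H i (v i)"
          using Ti[OF c] Tj[OF c] by (simp add: H'_def y_def algebra_simps)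
        \<comment> \<open>The pivot is multiplied by the preceding leading minor, which is nonzero
          by the choice of \<open>t\<close>.\<close>
        then have "H' j (v i) = (1 + t * s (v i - 1)) * H i (v i)" using s_step[OF c] by simp
        then have "H' j (v i) \<noteq> 0" using H1[OF \<open>i < n\<close>] t c by auto
        then show ?thesis using j z by simp
      next
        case o
        have c: "v m \<in> {1..n}" using vr[OF m] .
        have Tm: "T (H m) c = (1 + t * s c) * H m c + t * y c * (0 - (\<Sum>l\<in>{1..c}. H m l * x l))" if "c \<in> {1..n}" for c
          using x[OF m] o by (intro Tc[OF _ that]) auto
        have "(\<Sum>l\<in>{1..v m}. H m l * x l) = H m (v m) * x (v m)"
          by (rule sum_upto_single[of n]) (use H0[OF m] c in auto)
        then have "T (H m) (v m) = (1 + t * (s (v m) - x (v m) * y (v m))) * H m (v m)"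
          using Tm[OF c] by (simp add: algebra_simps)
        then have "T (H m) (v m) = (1 + t * s (v m - 1)) * H m (v m)" using s_step[OF c] by simp
        then have "T (H m) (v m) \<noteq> 0" using H1[OF m] t c by auto
        moreover have "T (H m) c = 0" if c: "c \<in> {1..n}" "c < v m" for c
        proof -
          have "(\<Sum>l\<in>{1..c}. H m l * x l) = 0"
            by (rule sum_upto_zero[of n "v m"]) (use H0[OF m] c in auto)
          then show ?thesis using Tm[OF c(1)] H0[OF m c] by simp
        qed
        ultimately show ?thesis using o by (simp add: H'_def)
      qed
    qed
    show ?thesis unfolding richardson_def G' using up' rc' ec' by blast
  qed
  then show ?thesis by blast
qed

section \<open>Polynomials on Richardson strata\<close>

lemma VarsD: "a \<in> Vars k n \<Longrightarrow> finite a \<and> card a = k \<and> a \<subseteq> {1..n}"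
  unfolding Vars_def by (auto intro: finite_subset)

text \<open>Exchanges of elements and complements are easier to compare through counts than through
  sorted lists, so the Plucker order is used in this form from here on.\<close>

lemma pl_le_iff_card:
  assumes "a \<in> Vars k n" "b \<in> Vars k n"
  shows "pl_le k a b \<longleftrightarrow> (\<forall>y. card (b \<inter> {..y}) \<le> card (a \<inter> {..y}))"
proof -
  have fin: "finite a" "card a = k" "finite b" "card b = k" using assms VarsD by blast+
  have ia: "i < card (a \<inter> {..y}) \<longleftrightarrow> i < k \<and> sorted_list_of_set a ! i \<le> y" for i y
    using nth_sorted_less_iff[OF fin(1), of i "Suc y"] fin by (simp add: lessThan_Suc_atMost less_Suc_eq_le)
  have ib: "i < card (b \<inter> {..y}) \<longleftrightarrow> i < k \<and> sorted_list_of_set b ! i \<le> y" for i y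
    using nth_sorted_less_iff[OF fin(3), of i "Suc y"] fin by (simp add: lessThan_Suc_atMost less_Suc_eq_le)
  show ?thesis
  proof
    assume le: "pl_le k a b"
    show "\<forall>y. card (b \<inter> {..y}) \<le> card (a \<inter> {..y})"
    proof (intro allI, rule ccontr)
      fix y assume "\<not> card (b \<inter> {..y}) \<le> card (a \<inter> {..y})"
      then have "card (a \<inter> {..y}) < card (b \<inter> {..y})" by simp
      then have "card (a \<inter> {..y}) < k" "sorted_list_of_set b ! card (a \<inter> {..y}) \<le> y" using ib by blast+
      then have "card (a \<inter> {..y}) < card (a \<inter> {..y})" using le ia unfolding pl_le_def by (meson order_trans)
      then show False by simp
    qed
  next
    assume c: "\<forall>y. card (b \<inter> {..y}) \<le> card (a \<inter> {..y})"
    show "pl_le k a b" unfolding pl_le_def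
    proof (intro allI impI)
      fix i assume "i < k"
      then have "i < card (b \<inter> {..sorted_list_of_set b ! i})" using ib by simp
      then have "i < card (a \<inter> {..sorted_list_of_set b ! i})" using c by (meson order_less_le_trans)
      then show "sorted_list_of_set a ! i \<le> sorted_list_of_set b ! i" using ia by simp
    qed
  qed
qed

lemma lin_indep_cols_subset:
  assumes "lin_indep_cols k M U" "U' \<subseteq> U" "finite U"
  shows "lin_indep_cols k M U'"
  unfolding lin_indep_cols_def
proof (intro allI impI)
  fix c assume c: "\<forall>r<k. (\<Sum>l\<in>U'. c l * M r l) = 0"
  let ?c = "\<lambda>l. if l \<in> U' then c l else 0"
  have "(\<Sum>l\<in>U. ?c l * M r l) = (\<Sum>l\<in>U'. c l * M r l)" for r
    using assms by (intro sum.mono_neutral_cong_right) auto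
  then have "\<forall>r<k. (\<Sum>l\<in>U. ?c l * M r l) = 0" using c by simp
  then have "\<forall>l\<in>U. ?c l = 0"
    using assms(1) unfolding lin_indep_cols_def by (elim allE[of _ ?c] impE)
  then show "\<forall>l\<in>U'. c l = 0" using assms(2) by (metis subsetD)
qed

lemma plk_nonzero_iff:
  fixes M :: "nat \<Rightarrow> nat \<Rightarrow> 'a::field"
  assumes "finite a" "card a = k"
  shows "plk k M a \<noteq> 0 \<longleftrightarrow> lin_indep_cols k M a"
proof -
  let ?l = "sorted_list_of_set a"
  let ?A = "mat k k (\<lambda>(i, j). M i (?l ! j))"
  have bij: "bij_betw (\<lambda>j. ?l ! j) {0..<k} a"
    using bij_betw_nth[OF distinct_sorted_list_of_set[of a], of "{0..<k}" a] assms by (auto simp: atLeast0LessThan)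
  have row: "(?A *\<^sub>v v) $ i = (\<Sum>j\<in>{0..<k}. M i (?l ! j) * v $ j)" if "i < k" "v \<in> carrier_vec k" for i v
    using that by (auto simp: scalar_prod_def)
  have re: "(\<Sum>l\<in>a. c l * M i l) = (\<Sum>j\<in>{0..<k}. c (?l ! j) * M i (?l ! j))" for c i
    using sum.reindex_bij_betw[OF bij, of "\<lambda>l. c l * M i l"] by simp
  have "plk k M a = 0 \<longleftrightarrow> (\<exists>v. v \<in> carrier_vec k \<and> v \<noteq> 0\<^sub>v k \<and> ?A *\<^sub>v v = 0\<^sub>v k)"
    unfolding plk_def by (rule det_0_iff_vec_prod_zero_field) simp
  also have "\<dots> \<longleftrightarrow> \<not> lin_indep_cols k M a"
  proof
    assume "\<exists>v. v \<in> carrier_vec k \<and> v \<noteq> 0\<^sub>v k \<and> ?A *\<^sub>v v = 0\<^sub>v k"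
    then obtain v where v: "v \<in> carrier_vec k" "v \<noteq> 0\<^sub>v k" "?A *\<^sub>v v = 0\<^sub>v k" by blast
    define c where "c = (\<lambda>l. v $ (the_inv_into {0..<k} (\<lambda>j. ?l ! j) l))"
    have cj: "c (?l ! j) = v $ j" if "j < k" for j
      unfolding c_def using the_inv_into_f_f[of "\<lambda>j. ?l ! j" "{0..<k}" j] bij that by (auto simp: bij_betw_def)
    have "(\<Sum>l\<in>a. c l * M i l) = 0" if "i < k" for i
    proof -
      have "(\<Sum>l\<in>a. c l * M i l) = (\<Sum>j\<in>{0..<k}. M i (?l ! j) * v $ j)"
        unfolding re by (intro sum.cong) (auto simp: cj)
      also have "\<dots> = (?A *\<^sub>v v) $ i" using row[OF that v(1)] by simp
      finally show ?thesis using v(3) that by simp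
    qed
    moreover obtain j where j: "j < k" "v $ j \<noteq> 0" using v(1,2) by (metis carrier_vecD eq_vecI index_zero_vec(1) index_zero_vec(2))
    moreover have "?l ! j \<in> a" using bij j by (auto simp: bij_betw_def)
    ultimately show "\<not> lin_indep_cols k M a" unfolding lin_indep_cols_def using cj by metis
  next
    assume "\<not> lin_indep_cols k M a"
    then obtain c l where c: "\<forall>i<k. (\<Sum>l\<in>a. c l * M i l) = 0" "l \<in> a" "c l \<noteq> 0" unfolding lin_indep_cols_def by auto
    define v where "v = vec k (\<lambda>j. c (?l ! j))"
    have v: "v \<in> carrier_vec k" unfolding v_def by simp
    have "?A *\<^sub>v v = 0\<^sub>v k"
    proof (rule eq_vecI)
      fix i assume "i < dim_vec (0\<^sub>v k :: 'a vec)"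
      then have i: "i < k" by simp
      have "(?A *\<^sub>v v) $ i = (\<Sum>j\<in>{0..<k}. M i (?l ! j) * v $ j)" by (rule row[OF i v])
      also have "\<dots> = (\<Sum>l\<in>a. c l * M i l)" unfolding re by (intro sum.cong) (auto simp: v_def)
      finally show "(?A *\<^sub>v v) $ i = 0\<^sub>v k $ i" using c(1) i by simp
    qed simp
    moreover have "v \<noteq> 0\<^sub>v k"
    proof
      assume v0: "v = 0\<^sub>v k"
      have "l \<in> (\<lambda>j. ?l ! j) ` {0..<k}" using bij c(2) by (simp add: bij_betw_def)
      then obtain j where j: "j < k" "l = ?l ! j" by auto
      then have "v $ j = c l" by (simp add: v_def)
      then show False using v0 j c(3) by simp
    qed
    ultimately show "\<exists>v. v \<in> carrier_vec k \<and> v \<noteq> 0\<^sub>v k \<and> ?A *\<^sub>v v = 0\<^sub>v k" using v by blast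
  qed
  finally show ?thesis by blast
qed

section \<open>Values and degrees of monomials\<close>

abbreviation keys :: "('b \<Rightarrow>\<^sub>0 'c::zero) \<Rightarrow> 'b set" where
  "keys \<equiv> Poly_Mapping.keys"

abbreviation lookup :: "('b \<Rightarrow>\<^sub>0 'c::zero) \<Rightarrow> 'b \<Rightarrow> 'c" where
  "lookup \<equiv> Poly_Mapping.lookup"

definition mon_eval :: "(nat set \<Rightarrow>\<^sub>0 nat) \<Rightarrow> (nat set \<Rightarrow> 'a::comm_ring_1) \<Rightarrow> 'a" where
  "mon_eval m x = (\<Prod>v \<in> keys m. x v ^ lookup m v)"

lemma peval_mon_eval: "peval p x = (\<Sum>m \<in> keys p. lookup p m * mon_eval m x)"
  by (simp add: peval_def mon_eval_def)

lemma mon_eval_superset: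
  assumes "finite V" "keys m \<subseteq> V"
  shows "mon_eval m x = (\<Prod>v\<in>V. x v ^ lookup m v)"
  unfolding mon_eval_def using assms by (intro prod.mono_neutral_left) (auto simp: in_keys_iff)

lemma mon_eval_add: "mon_eval (m + m') x = mon_eval m x * mon_eval m' x"
proof -
  let ?V = "keys m \<union> keys m'"
  have "keys (m + m') \<subseteq> ?V" by (rule Poly_Mapping.keys_add)
  then show ?thesis
    by (simp add: mon_eval_superset[of ?V] lookup_add power_add prod.distrib)
qed

lemma mon_eval_single: "mon_eval (Poly_Mapping.single a (Suc 0)) x = x a"
  by (simp add: mon_eval_def)

lemma mon_eval_zero: "mon_eval 0 x = 1"
  by (simp add: mon_eval_def)

lemma mdeg_superset:
  assumes "finite V" "keys m \<subseteq> V"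
  shows "mdeg m = (\<Sum>v\<in>V. lookup m v)"
  unfolding mdeg_def using assms by (intro sum.mono_neutral_left) (auto simp: in_keys_iff)

lemma mdeg_add: "mdeg (m + m') = mdeg m + mdeg m'"
proof -
  let ?V = "keys m \<union> keys m'"
  have "keys (m + m') \<subseteq> ?V" by (rule Poly_Mapping.keys_add)
  then show ?thesis by (simp add: mdeg_superset[of ?V] lookup_add sum.distrib)
qed

lemma mdeg_single: "mdeg (Poly_Mapping.single a (Suc 0)) = 1"
  by (simp add: mdeg_def)

lemma mon_eval_scale: "mon_eval m (\<lambda>a. s * x a) = s ^ mdeg m * mon_eval m x"
  unfolding mon_eval_def mdeg_def by (simp add: power_mult_distrib prod.distrib power_sum)

section \<open>Polynomial functions of one parameter\<close>

definition poly_function :: "('a::comm_ring_1 \<Rightarrow> 'a) \<Rightarrow> bool" where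
  "poly_function f \<longleftrightarrow> (\<exists>P. \<forall>t. f t = poly P t)"

lemma poly_function_const: "poly_function (\<lambda>t. c)"
  unfolding poly_function_def by (intro exI[of _ "[:c:]"]) simp

lemma poly_function_linear: "poly_function (\<lambda>t. a + t * b)"
  unfolding poly_function_def by (intro exI[of _ "[:a, b:]"]) simp

lemma poly_function_add: "poly_function f \<Longrightarrow> poly_function g \<Longrightarrow> poly_function (\<lambda>t. f t + g t)"
  unfolding poly_function_def by (metis poly_add)

lemma poly_function_mult: "poly_function f \<Longrightarrow> poly_function g \<Longrightarrow> poly_function (\<lambda>t. f t * g t)"
  unfolding poly_function_def by (metis poly_mult)

lemma poly_function_sum: "(\<And>i. i \<in> I \<Longrightarrow> poly_function (f i)) \<Longrightarrow> poly_function (\<lambda>t. \<Sum>i\<in>I. f i t)"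
  by (induction I rule: infinite_finite_induct) (auto intro: poly_function_add poly_function_const)

lemma poly_function_prod: "(\<And>i. i \<in> I \<Longrightarrow> poly_function (f i)) \<Longrightarrow> poly_function (\<lambda>t. \<Prod>i\<in>I. f i t)"
  by (induction I rule: infinite_finite_induct) (auto intro: poly_function_mult poly_function_const)

lemma poly_function_power: "poly_function f \<Longrightarrow> poly_function (\<lambda>t. f t ^ e)"
  by (induction e) (auto intro: poly_function_mult poly_function_const)

lemma poly_function_plk: "poly_function (\<lambda>t. plk k (\<lambda>i c. A i c + t * B i c) a)"
proof -
  let ?l = "sorted_list_of_set a"
  have "plk k (\<lambda>i c. A i c + t * B i c) a = (\<Sum>p\<in>{p. p permutes {0..<k}}.
      signof p * (\<Prod>i\<in>{0..<k}. A i (?l ! p i) + t * B i (?l ! p i)))" for t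
    unfolding plk_def by (subst det_def'[of _ k]) (auto intro!: sum.cong prod.cong)
  then show ?thesis
    by (simp only:) (intro poly_function_sum poly_function_mult poly_function_prod poly_function_linear poly_function_const)
qed

lemma poly_function_zero:
  fixes f :: "'a::{field_char_0} \<Rightarrow> 'a"
  assumes "poly_function f" "finite Z" "\<And>t. t \<notin> Z \<Longrightarrow> f t = 0"
  shows "f t = 0"
proof -
  obtain P where P: "\<And>t. f t = poly P t" using assms(1) unfolding poly_function_def by blast
  have "- Z \<subseteq> {t. poly P t = 0}" using assms(3) P by auto
  moreover have "infinite (- Z)" using assms(2) infinite_UNIV_char_0
    by (metis Compl_eq_Diff_UNIV Diff_infinite_finite)
  ultimately have "P = 0" using poly_roots_finite finite_subset by blast
  then show ?thesis using P by simp
qed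

text \<open>For each swap, a line through \<open>G\<close> lies in the next stratum except for
  finitely many parameters, so a polynomial vanishing on that stratum also vanishes at
  \<open>t = 0\<close>. In effect, the stratum of \<open>v\<close> lies in the closure of the
  stratum of the smaller \<open>u\<close>.\<close>

lemma vanishing_closed:
  fixes c :: "(nat set \<Rightarrow>\<^sub>0 nat) \<Rightarrow> 'a::field_char_0"
  assumes "bruhat_reach n v u" and "bij_betw v {..<n} {1..n}" and w: "bij_betw w {..<n} {1..n}"
    and "\<And>G. richardson n u w G \<Longrightarrow> (\<Sum>m\<in>Q. c m * mon_eval m (plk k G)) = 0"
    and "richardson n v w G"
  shows "(\<Sum>m\<in>Q. c m * mon_eval m (plk k G)) = 0"
  using assms(1,2,4,5)
proof (induction arbitrary: G rule: bruhat_reach.induct)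
  case (bruhat_refl v)
  then show ?case by blast
next
  case (bruhat_swap i j v u)
  let ?v = "v(i := v j, j := v i)"
  have bij: "bij_betw ?v {..<n} {1..n}"
  proof -
    have "?v = v \<circ> transpose i j" by (auto simp: transpose_def fun_eq_iff)
    moreover have "bij_betw (transpose i j) {..<n} {..<n}"
      using bruhat_swap.hyps permutes_imp_bij[OF permutes_swap_id[of i "{..<n}" j]] by auto
    ultimately show ?thesis using bij_betw_trans[OF _ bruhat_swap.prems(1)] by metis
  qed
  obtain B s where Bs: "\<forall>t. t \<noteq> 0 \<longrightarrow> (\<forall>c\<le>n. 1 + t * s c \<noteq> 0) \<longrightarrow>
    richardson n ?v w (\<lambda>i c. G i c + t * B i c)"
    using richardson_swap_curve[OF bruhat_swap.prems(3,1) w bruhat_swap.hyps(1-3)] by blast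
  define f where "f = (\<lambda>t. \<Sum>m\<in>Q. c m * mon_eval m (plk k (\<lambda>i c. G i c + t * B i c)))"
  have "poly_function f"
    unfolding f_def mon_eval_def
    by (intro poly_function_sum poly_function_mult poly_function_const poly_function_prod
        poly_function_power poly_function_plk)
  moreover have "finite (insert 0 (\<Union>c\<le>n. {t. 1 + t * s c = 0}))"
  proof -
    have "finite {t. 1 + t * s c = 0}" for c
    proof (cases "s c = 0")
      case False
      then have "{t. 1 + t * s c = 0} \<subseteq> {- 1 / s c}" by (auto simp: field_simps eq_neg_iff_add_eq_0)
      then show ?thesis using finite_subset by blast
    qed simp
    then show ?thesis by simp
  qed
  moreover have "f t = 0" if "t \<notin> insert 0 (\<Union>c\<le>n. {t. 1 + t * s c = 0})" for t
  proof -
    have "richardson n ?v w (\<lambda>i c. G i c + t * B i c)" using Bs that by auto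
    then show ?thesis unfolding f_def using bruhat_swap.IH[OF bij bruhat_swap.prems(2)] by blast
  qed
  ultimately have "f 0 = 0" by (rule poly_function_zero)
  then show ?case by (simp add: f_def)
qed

lemma richardson_scale:
  assumes "richardson n u w G" "s \<noteq> 0"
  shows "richardson n u w (\<lambda>i c. s * G i c)"
proof -
  from assms(1) obtain L H where up: "richardson_up n w G"
    and rc: "row_combination n L G H" and ec: "echelon n u H" by (auto simp: richardson_def)
  have "richardson_up n w (\<lambda>i c. s * G i c)" using up assms(2) by (simp add: richardson_up_def)
  moreover have "echelon n u (\<lambda>i c. s * H i c)" using ec assms(2) by (simp add: echelon_def)
  moreover have "row_combination n L (\<lambda>i c. s * G i c) (\<lambda>i c. s * H i c)"
    using rc by (auto simp: row_combination_def sum_distrib_left mult_ac)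
  ultimately show ?thesis by (auto simp: richardson_def)
qed

lemma plk_scale: "plk k (\<lambda>i c. s * M i c) a = s ^ k * plk k M a"
proof -
  let ?A = "mat k k (\<lambda>(i, j). M i (sorted_list_of_set a ! j))"
  have "mat k k (\<lambda>(i, j). s * M i (sorted_list_of_set a ! j)) = s \<cdot>\<^sub>m ?A" by (rule eq_matI) auto
  then show ?thesis unfolding plk_def by simp
qed

text \<open>Scaling the matrix by \<open>s\<close> multiplies its Plucker coordinates by
  \<open>s ^ k\<close>, so the sum becomes a polynomial in \<open>s\<close> whose coefficients are
  the graded pieces; \<open>1 \<le> k\<close> keeps the degrees apart. Members of \<open>Jf\<close>
  may be inhomogeneous, whereas columns are peeled off within one degree.\<close>

lemma vanishing_homogeneous:
  fixes c :: "(nat set \<Rightarrow>\<^sub>0 nat) \<Rightarrow> 'a::field_char_0"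
  assumes "finite Q" "1 \<le> k"
    and van: "\<And>G. richardson n u w G \<Longrightarrow> (\<Sum>m\<in>Q. c m * mon_eval m (plk k G)) = 0"
    and G: "richardson n u w G"
  shows "(\<Sum>m\<in>{m\<in>Q. mdeg m = e}. c m * mon_eval m (plk k G)) = 0"
proof -
  let ?x = "plk k G"
  define P where "P = (\<Sum>m\<in>Q. monom (c m * mon_eval m ?x) (k * mdeg m))"
  have "poly P s = 0" if "s \<noteq> 0" for s
  proof -
    have "poly P s = (\<Sum>m\<in>Q. c m * mon_eval m (plk k (\<lambda>i c. s * G i c)))"
    proof -
      have "plk k (\<lambda>i c. s * G i c) = (\<lambda>a. s ^ k * ?x a)" by (rule ext) (rule plk_scale)
      then have "mon_eval m (plk k (\<lambda>i c. s * G i c)) = s ^ (k * mdeg m) * mon_eval m ?x" for m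
        by (simp add: mon_eval_scale power_mult)
      then show ?thesis unfolding P_def by (simp add: poly_sum poly_monom mult_ac)
    qed
    also have "\<dots> = 0" using van[OF richardson_scale[OF G that]] .
    finally show ?thesis .
  qed
  then have z: "\<And>s. s \<notin> {0} \<Longrightarrow> poly P s = 0" by simp
  have "poly_function (poly P)" unfolding poly_function_def by blast
  then have "poly P s = 0" for s
    by (rule poly_function_zero[where Z = "{0}"]) (use z in auto)
  then have "P = 0" using poly_all_0_iff_0 by blast
  then have "0 = coeff P (k * e)" by simp
  also have "\<dots> = (\<Sum>m\<in>Q. if mdeg m = e then c m * mon_eval m ?x else 0)"
    unfolding P_def coeff_sum using assms(2) by (intro sum.cong) auto
  also have "\<dots> = (\<Sum>m\<in>{m\<in>Q. mdeg m = e}. c m * mon_eval m ?x)"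
    using assms(1) by (simp add: sum.inter_filter)
  finally show ?thesis by simp
qed

lemma richardson_plk_nonzero:
  assumes "richardson n u w G" "k \<le> n" and u: "bij_betw u {..<n} {1..n}"
  shows "plk k G (u ` {..<k}) \<noteq> 0"
proof -
  have inj: "inj_on u {..<k}" using u assms(2) by (auto simp: bij_betw_def intro: inj_on_subset)
  have "lin_indep_cols k G (u ` {..<k})"
    using assms by (intro richardson_indep) (auto simp: bij_betw_def)
  then show ?thesis using plk_nonzero_iff[of "u ` {..<k}" k G] inj by (simp add: card_image)
qed

text \<open>The elements of \<open>b\<close> up to \<open>y\<close> index independent columns. Their
  number is bounded by \<open>richardson_wrapped_rank\<close> with \<open>c = k\<close> and
  \<open>X = Suc n\<close>, where the wrapped interval degenerates to \<open>{1..y}\<close>.\<close>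

lemma richardson_plk_ge:
  assumes "richardson n u w G" "k \<le> n" and u: "bij_betw u {..<n} {1..n}" and w: "bij_betw w {..<n} {1..n}"
    and b: "b \<in> Vars k n" "plk k G b \<noteq> 0"
  shows "pl_le k (u ` {..<k}) b"
proof -
  have inj: "inj_on u {..<k}" using u assms(2) by (auto simp: bij_betw_def intro: inj_on_subset)
  have im: "u ` {..<k} \<subseteq> {1..n}" using u assms(2) by (auto simp: bij_betw_def)
  have a: "u ` {..<k} \<in> Vars k n" using inj im by (simp add: Vars_def card_image)
  have bf: "finite b" "card b = k" "b \<subseteq> {1..n}" using VarsD[OF b(1)] by auto
  have ind: "lin_indep_cols k G b" using plk_nonzero_iff[OF bf(1,2)] b(2) by blast
  have "card (b \<inter> {..y}) \<le> card (u ` {..<k} \<inter> {..y})" for y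
  proof -
    have wl: "w i < Suc n" if "i < k" for i
    proof -
      have "w i \<in> {1..n}" using w that assms(2) by (intro bij_betwE[OF w, rule_format]) auto
      then show ?thesis by simp
    qed
    have "card (b \<inter> {..y}) + card {i. i < k \<and> y < u i} \<le> k"
    proof (rule richardson_wrapped_rank[OF assms(1,2) order_refl wl])
      show "b \<inter> {..y} \<subseteq> {1..n} - {y<..<Suc n}" using bf by auto
      show "lin_indep_cols k G (b \<inter> {..y})" by (rule lin_indep_cols_subset[OF ind _ bf(1)]) auto
    qed
    moreover have "card {i. i < k \<and> y < u i} + card {i. i < k \<and> u i \<le> y} = k"
    proof -
      have "card {i. i < k \<and> y < u i} + card {i. i < k \<and> u i \<le> y}
          = card ({i. i < k \<and> y < u i} \<union> {i. i < k \<and> u i \<le> y})"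
        by (rule card_Un_disjoint[symmetric]) auto
      also have "{i. i < k \<and> y < u i} \<union> {i. i < k \<and> u i \<le> y} = {..<k}" by auto
      finally show ?thesis by simp
    qed
    moreover have "u ` {i. i < k \<and> u i \<le> y} = u ` {..<k} \<inter> {..y}" by auto
    then have "card {i. i < k \<and> u i \<le> y} = card (u ` {..<k} \<inter> {..y})"
      using card_image[OF inj_on_subset[OF inj, of "{i. i < k \<and> u i \<le> y}"]]
      by (metis (no_types, lifting) lessThan_iff mem_Collect_eq subsetI)
    ultimately show ?thesis by linarith
  qed
  then show ?thesis using pl_le_iff_card[OF a b(1)] by blast
qed

text \<open>The permutation matrix of \<open>w\<close> provides a point of the last stratum, needed
  once all columns have been peeled off.\<close>

lemma richardson_base:
  assumes "bij_betw w {..<n} {1..n}"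
  shows "richardson n w w (\<lambda>i c. if c = w i then 1 else 0)"
proof -
  have "row_combination n (\<lambda>i r. if r = i then 1 else 0) (\<lambda>i c. if c = w i then 1 else 0)
     (\<lambda>i c. if c = w i then 1 else (0::'a))"
    by (auto simp: row_combination_def if_distrib[of "\<lambda>z. z * _"] cong: if_cong)
  moreover have "echelon n w (\<lambda>i c. if c = w i then 1 else (0::'a))" by (auto simp: echelon_def)
  moreover have "richardson_up n w (\<lambda>i c. if c = w i then 1 else (0::'a))" by (auto simp: richardson_up_def)
  ultimately show ?thesis unfolding richardson_def by blast
qed

section \<open>Monomials of chains of columns\<close>

abbreviation var_mon :: "nat set \<Rightarrow> (nat set \<Rightarrow>\<^sub>0 nat)" where
  "var_mon a \<equiv> Poly_Mapping.single a (Suc 0)"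

abbreviation chain_mon :: "nat set list \<Rightarrow> (nat set \<Rightarrow>\<^sub>0 nat)" where
  "chain_mon cs \<equiv> sum_list (map var_mon cs)"

lemma lookup_chain_mon: "lookup (chain_mon cs) a = count_list cs a"
  by (induction cs) (auto simp: lookup_add lookup_single when_def)

lemma mdeg_chain_mon: "mdeg (chain_mon cs) = length cs"
  by (induction cs) (simp_all add: mdeg_add mdeg_single, simp add: mdeg_def)

lemma keys_chain_mon: "keys (chain_mon cs) = set cs"
proof -
  have "a \<in> keys (chain_mon cs) \<longleftrightarrow> a \<in> set cs" for a
    unfolding in_keys_iff lookup_chain_mon by (metis count_list_0_iff)
  then show ?thesis by blast
qed

lemma mdeg_zero_iff: "mdeg m = 0 \<longleftrightarrow> m = 0"
proof
  assume "mdeg m = 0"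
  then have "\<forall>v\<in>keys m. lookup m v = 0" unfolding mdeg_def by simp
  then show "m = 0" by (intro poly_mapping_eqI) (metis in_keys_iff lookup_zero)
qed (simp add: mdeg_def)

lemma revlex_less_cancel:
  "revlex_less \<omega> (l + m1) (l + m2) \<longleftrightarrow> revlex_less \<omega> m1 m2"
  by (simp add: revlex_less_def mdeg_add lookup_add)

lemma single_plus_diff:
  assumes "1 \<le> lookup m a"
  shows "var_mon a + (m - var_mon a) = (m :: nat set \<Rightarrow>\<^sub>0 nat)"
  by (rule poly_mapping_eqI) (use assms in \<open>auto simp: lookup_add lookup_minus lookup_single when_def\<close>)

text \<open>Cancel the smallest variable: on the stratum of the first column it is nonzero, while every
  monomial with a variable that is not above it vanishes.\<close>

lemma standard_mon_not_lead:
  fixes c :: "(nat set \<Rightarrow>\<^sub>0 nat) \<Rightarrow> 'a::field_char_0"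
  assumes "1 \<le> k" "k \<le> n" and le: "lin_ext k n \<omega>" and w: "bij_betw w {..<n} {1..n}"
    and "cs \<noteq> []" "length us = length cs" "set cs \<subseteq> Vars k n \<and> sorted_wrt (pl_le k) cs"
    and "\<And>j. j < length cs \<Longrightarrow> bij_betw (us ! j) {..<n} {1..n}"
    and "\<And>j. j < length cs \<Longrightarrow> us ! j ` {..<k} = cs ! j"
    and "\<And>j. Suc j < length cs \<Longrightarrow> bruhat_reach n (us ! Suc j) (us ! j)"
    and "last us = w"
    and "finite Q" "\<And>m. m \<in> Q \<Longrightarrow> keys m \<subseteq> Vars k n"
    and "\<And>m. m \<in> Q \<Longrightarrow> mdeg m = length cs"
    and "chain_mon cs \<in> Q" "c (chain_mon cs) \<noteq> 0"
    and "\<And>m. m \<in> Q \<Longrightarrow> m \<noteq> chain_mon cs \<Longrightarrow> revlex_less \<omega> m (chain_mon cs)"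
    and "\<And>G. richardson n (hd us) w G \<Longrightarrow> (\<Sum>m\<in>Q. c m * mon_eval m (plk k G)) = 0"
  shows False
  using assms(5-)
proof (induction cs arbitrary: us Q c)
  case Nil
  then show ?case by simp
next
  case (Cons a cs)
  note P = Cons.prems
  obtain u us' where us: "us = u # us'" using P(2) by (cases us) auto
  have u: "bij_betw u {..<n} {1..n}" "u ` {..<k} = a" using P(4)[of 0] P(5)[of 0] us by auto
  have aV: "a \<in> Vars k n" using P(3) by simp
  define Q0 where "Q0 = {m \<in> Q. \<forall>b\<in>keys m. pl_le k a b}"
  have Q0Q: "Q0 \<subseteq> Q" and finQ0: "finite Q0" using P(8) by (auto simp: Q0_def)
  \<comment> \<open>If \<open>a\<close> did not divide \<open>m\<close>, the variable deciding the
    revlex comparison would be at most \<open>a\<close> in the variable order, because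
    \<open>a\<close> divides the chain monomial. But that variable occurs in \<open>m\<close>, so it
    lies above \<open>a\<close> in the poset and is larger.\<close>
  have la: "1 \<le> lookup m a" if m: "m \<in> Q0" for m
  proof (cases "m = chain_mon (a # cs)")
    case True
    then show ?thesis by (simp add: lookup_chain_mon del: map_map) (simp add: lookup_add)
  next
    case False
    show ?thesis
    proof (rule ccontr)
      assume "\<not> ?thesis"
      then have l0: "lookup m a = 0" by simp
      have "revlex_less \<omega> m (chain_mon (a # cs))" using P(13)[of m] m Q0Q False by blast
      moreover have "mdeg m = mdeg (chain_mon (a # cs))" using P(10)[of m] m Q0Q by (auto simp: mdeg_chain_mon mdeg_add mdeg_single)
      ultimately obtain x where x: "lookup m x > lookup (chain_mon (a # cs)) x"
        "\<forall>y. lookup m y \<noteq> lookup (chain_mon (a # cs)) y \<longrightarrow> \<omega> x \<le> \<omega> y"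
        unfolding revlex_less_def by auto
      have "lookup (chain_mon (a # cs)) a \<noteq> 0" by (simp add: lookup_add)
      then have wx: "\<omega> x \<le> \<omega> a" using x(2) l0 by metis
      have xk: "x \<in> keys m" using x(1) by (simp add: in_keys_iff)
      then have "pl_le k a x" "x \<in> Vars k n" "x \<noteq> a"
        using m P(9)[of m] Q0Q l0 by (auto simp: Q0_def in_keys_iff)
      then have "\<omega> a < \<omega> x" using le aV unfolding lin_ext_def by auto
      with wx show False by simp
    qed
  qed
  define Q' where "Q' = (\<lambda>m. m - var_mon a) ` Q0"
  define c' where "c' = (\<lambda>m. c (var_mon a + m))"
  have inj: "inj_on (\<lambda>m. m - var_mon a) Q0"
    by (rule inj_onI) (metis la single_plus_diff)
  have chQ: "chain_mon (a # cs) \<in> Q0"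
  proof -
    have "pl_le k a b" if "b \<in> set (a # cs)" for b
    proof (cases "b = a")
      case True then show ?thesis by (simp add: pl_le_def)
    next
      case False
      then show ?thesis using that P(3) by simp
    qed
    then show ?thesis using P(11) keys_chain_mon[of "a # cs"] unfolding Q0_def by auto
  qed
  have van: "(\<Sum>m\<in>Q'. c' m * mon_eval m (plk k G)) = 0" if G: "richardson n u w G" for G
  proof -
    have "0 = (\<Sum>m\<in>Q. c m * mon_eval m (plk k G))" using P(14)[of G] G us by simp
    also have "\<dots> = (\<Sum>m\<in>Q0. c m * mon_eval m (plk k G))"
    proof (rule sum.mono_neutral_right)
      show "\<forall>m\<in>Q - Q0. c m * mon_eval m (plk k G) = 0"
      proof
        fix m assume m: "m \<in> Q - Q0"
        then obtain b where b: "b \<in> keys m" "\<not> pl_le k a b" by (auto simp: Q0_def)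
        then have "b \<in> Vars k n" using P(9)[of m] m by blast
        then have "plk k G b = 0" using richardson_plk_ge[OF G assms(2) u(1) w] b(2) u(2) by blast
        then have "mon_eval m (plk k G) = 0"
          unfolding mon_eval_def using b(1) by (intro prod_zero) (auto simp: in_keys_iff intro!: bexI[of _ b])
        then show "c m * mon_eval m (plk k G) = 0" by simp
      qed
    qed (use P(8) Q0Q in auto)
    also have "\<dots> = (\<Sum>m\<in>Q0. plk k G a * (c' (m - var_mon a) * mon_eval (m - var_mon a) (plk k G)))"
    proof (rule sum.cong[OF refl])
      fix m assume "m \<in> Q0"
      then have e: "var_mon a + (m - var_mon a) = m" by (intro single_plus_diff la)
      have "mon_eval m (plk k G) = plk k G a * mon_eval (m - var_mon a) (plk k G)"
        by (subst e[symmetric], subst mon_eval_add, simp add: mon_eval_single)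
      then show "c m * mon_eval m (plk k G) = plk k G a * (c' (m - var_mon a) * mon_eval (m - var_mon a) (plk k G))"
        by (simp add: c'_def e)
    qed
    also have "\<dots> = plk k G a * (\<Sum>m\<in>Q'. c' m * mon_eval m (plk k G))"
      unfolding Q'_def sum.reindex[OF inj] by (simp add: sum_distrib_left)
    finally show ?thesis using richardson_plk_nonzero[OF G assms(2) u(1)] u(2) by simp
  qed
  have chQ': "chain_mon cs \<in> Q'"
    unfolding Q'_def by (rule image_eqI[OF _ chQ]) simp
  have Q'mem: "var_mon a + m \<in> Q0" if "m \<in> Q'" for m
    using that single_plus_diff[OF la] unfolding Q'_def by auto
  have deg': "mdeg m = length cs" if "m \<in> Q'" for m
    using P(10)[of "var_mon a + m"] Q'mem[OF that] Q0Q by (auto simp: mdeg_add mdeg_single)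
  have finQ': "finite Q'" unfolding Q'_def using finQ0 by simp
  have cne: "c' (chain_mon cs) \<noteq> 0" using P(12) by (simp add: c'_def)
  show ?case
  proof (cases "cs = []")
    case True
    \<comment> \<open>Only the constant monomial is left, and a single point of the last stratum
      forces its coefficient to be zero.\<close>
    have "Q' \<subseteq> {0}" using deg' True by (auto simp: mdeg_zero_iff)
    then have "Q' = {0}" using chQ' by auto
    then have "(\<Sum>m\<in>Q'. c' m * mon_eval m x) = c' 0" for x :: "nat set \<Rightarrow> 'a" by (simp add: mon_eval_zero)
    moreover have "u = w" using P(2,7) us True by auto
    ultimately have "c' 0 = 0" using van[of "\<lambda>i c. if c = w i then 1 else 0"] richardson_base[OF w, where 'a = 'a] by simp
    then show False using cne True by simp
  next
    case False
    have ne: "us' \<noteq> []" using P(2) us False by auto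
    show False
    proof (rule Cons.IH[of us' Q' c'])
      show "cs \<noteq> []" by fact
      show "length us' = length cs" using P(2) us by simp
      show "set cs \<subseteq> Vars k n \<and> sorted_wrt (pl_le k) cs" using P(3) by simp
      show "bij_betw (us' ! j) {..<n} {1..n}" if "j < length cs" for j using P(4)[of "Suc j"] that us by simp
      show "us' ! j ` {..<k} = cs ! j" if "j < length cs" for j using P(5)[of "Suc j"] that us by simp
      show "bruhat_reach n (us' ! Suc j) (us' ! j)" if "Suc j < length cs" for j
        using P(6)[of "Suc j"] that us by simp
      show "last us' = w" using P(7) us ne by simp
      show "finite Q'" by fact
      show "keys m \<subseteq> Vars k n" if "m \<in> Q'" for m
      proof -
        have "keys m \<subseteq> keys (var_mon a + m)" by (auto simp: in_keys_iff lookup_add)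
        then show ?thesis using P(9) Q'mem[OF that] Q0Q by blast
      qed
      show "mdeg m = length cs" if "m \<in> Q'" for m using deg'[OF that] .
      show "chain_mon cs \<in> Q'" by fact
      show "c' (chain_mon cs) \<noteq> 0" by fact
      show "revlex_less \<omega> m (chain_mon cs)" if "m \<in> Q'" "m \<noteq> chain_mon cs" for m
      proof -
        have "revlex_less \<omega> (var_mon a + m) (chain_mon (a # cs))"
          using P(13)[of "var_mon a + m"] Q'mem[OF that(1)] that(2) Q0Q by auto
        then show ?thesis using revlex_less_cancel[of \<omega> "var_mon a" m "chain_mon cs"] by simp
      qed
      have "hd us' = us ! 1" using us ne by (simp add: hd_conv_nth)
      then have br: "bruhat_reach n (hd us') u" "bij_betw (hd us') {..<n} {1..n}"
        using P(6)[of 0] P(4)[of 1] False us by auto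
      \<comment> \<open>The next permutation is larger in Bruhat order, so its stratum lies in the
        closure of the present one.\<close>
      show "(\<Sum>m\<in>Q'. c' m * mon_eval m (plk k G)) = 0" if "richardson n (hd us') w G" for G
        by (rule vanishing_closed[OF br w van that])
    qed
  qed
qed

section \<open>Antisymmetrized products of minors\<close>

text \<open>One shape for two uses. With \<open>q = N\<close> it is a minor on the columns listed by
  \<open>l\<close>. With \<open>N = n\<close>, \<open>q = n - k\<close>, unit vectors for
  \<open>B\<close> and the rows of the matrix for \<open>A\<close>, it is up to sign the minor on
  the columns not listed.\<close>

definition list_det :: "nat \<Rightarrow> nat \<Rightarrow> (nat \<Rightarrow> nat \<Rightarrow> 'a::field) \<Rightarrow> (nat \<Rightarrow> nat \<Rightarrow> 'a) \<Rightarrow> nat list \<Rightarrow> 'a" where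
  "list_det N q B A l = det (mat N N (\<lambda>(r, c). if r < q then B (l ! r) c else A r c))"

lemma list_det_swap:
  assumes "p < q" "p' < q" "p \<noteq> p'" "length l = q" "q \<le> N"
  shows "list_det N q B A (l[p := l ! p', p' := l ! p]) = - list_det N q B A l"
proof -
  let ?M = "\<lambda>l. mat N N (\<lambda>(r, c). if r < q then B (l ! r) c else A r c)"
  have "?M (l[p := l ! p', p' := l ! p]) = swaprows p p' (?M l)"
    using assms by (intro eq_matI) (auto simp: nth_list_update)
  then show ?thesis using assms unfolding list_det_def by (simp add: det_swaprows[of _ N])
qed

text \<open>The determinant is linear in row \<open>p\<close>. The relation turns that row into a
  combination of rows \<open>A r\<close> that already stand further down, and each of these gives a
  repeated row.\<close>

lemma list_det_relation:
  fixes B A :: "nat \<Rightarrow> nat \<Rightarrow> 'a::field"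
  assumes "p < q" "length l = q" "q \<le> N"
    and rel: "\<And>c. c < N \<Longrightarrow> (\<Sum>s\<in>D. co s * B s c) = (\<Sum>r\<in>{q..<N}. lam r * A r c)"
  shows "(\<Sum>s\<in>D. co s * list_det N q B A (l[p := s])) = 0"
proof -
  define M where "M = (\<lambda>v. mat N N (\<lambda>(r, c). if r = p then v c else if r < q then B (l ! r) c else A r c))"
  have carr: "M v \<in> carrier_mat N N" for v by (simp add: M_def)
  have p: "p < N" using assms by simp
  define C where "C = cofactor (M (\<lambda>_. 0)) p"
  have cof: "cofactor (M v) p = C" for v
  proof -
    have "mat_delete (M v) p j = mat_delete (M (\<lambda>_. 0)) p j" for j
      unfolding mat_delete_def M_def by (rule eq_matI) auto
    then show ?thesis unfolding C_def cofactor_def by simp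
  qed
  have det: "det (M v) = (\<Sum>c<N. v c * C c)" for v
    using laplace_expansion_row[OF carr p, of v] p by (simp add: cof) (simp add: M_def)
  have ld: "list_det N q B A (l[p := s]) = det (M (B s))" for s
    unfolding list_det_def M_def using assms(1,2)
    by (intro arg_cong[where f = det] eq_matI) (auto simp: nth_list_update)
  have zero: "det (M (A r)) = 0" if "r \<in> {q..<N}" for r
  proof (rule det_identical_rows[OF carr])
    show "p \<noteq> r" "p < N" "r < N" using that assms p by auto
    show "row (M (A r)) p = row (M (A r)) r"
      using that assms p by (intro eq_vecI) (auto simp: M_def)
  qed
  have "(\<Sum>s\<in>D. co s * list_det N q B A (l[p := s])) = (\<Sum>c<N. (\<Sum>s\<in>D. co s * B s c) * C c)"
    unfolding ld det by (simp add: sum_distrib_left sum_distrib_right mult.assoc sum.swap[of _ D])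
  also have "\<dots> = (\<Sum>c<N. (\<Sum>r\<in>{q..<N}. lam r * A r c) * C c)"
    by (intro sum.cong refl) (simp add: rel)
  also have "\<dots> = (\<Sum>r\<in>{q..<N}. lam r * det (M (A r)))"
    unfolding det by (simp add: sum_distrib_left sum_distrib_right mult.assoc sum.swap[of _ "{q..<N}"])
  also have "\<dots> = 0" using zero by (intro sum.neutral) auto
  finally show ?thesis .
qed

text \<open>\<open>\<gamma>\<close> cuts \<open>D\<close> into blocks, the block of \<open>j\<close>
  lying inside the list \<open>Ls j\<close>. The lists are either the columns themselves or their
  complements.\<close>

locale column_exchange =
  fixes D :: "nat set" and \<gamma> :: "nat \<Rightarrow> nat" and d q :: nat and Ls :: "nat \<Rightarrow> nat list"
  assumes finD: "finite D" and \<gamma>: "\<And>s. s \<in> D \<Longrightarrow> \<gamma> s < d"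
    and mem: "\<And>s. s \<in> D \<Longrightarrow> s \<in> set (Ls (\<gamma> s))"
    and dist: "\<And>j. j < d \<Longrightarrow> distinct (Ls j)" and len: "\<And>j. j < d \<Longrightarrow> length (Ls j) = q"
begin

definition exchange :: "(nat \<Rightarrow> nat) \<Rightarrow> nat \<Rightarrow> nat list" where
  "exchange x j = map (\<lambda>s. if s \<in> D \<and> \<gamma> s = j then x s else s) (Ls j)"

lemma length_exchange: "j < d \<Longrightarrow> length (exchange x j) = q"
  by (simp add: exchange_def len)

lemma exchange_index:
  assumes "s \<in> D" obtains p where "p < q" "Ls (\<gamma> s) ! p = s"
  using mem[OF assms] len[OF \<gamma>[OF assms]] by (metis in_set_conv_nth)

lemma exchange_update:
  assumes "s \<in> D" "p < q" "Ls (\<gamma> s) ! p = s" "\<And>r. r \<in> D \<Longrightarrow> r \<noteq> s \<Longrightarrow> x' r = x r"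
  shows "exchange x' (\<gamma> s) = (exchange x (\<gamma> s))[p := x' s]"
proof (rule nth_equalityI)
  show "length (exchange x' (\<gamma> s)) = length ((exchange x (\<gamma> s))[p := x' s])" by (simp add: exchange_def)
next
  fix i assume "i < length (exchange x' (\<gamma> s))"
  then have i: "i < q" using length_exchange[OF \<gamma>[OF assms(1)]] by simp
  have lq: "length (Ls (\<gamma> s)) = q" using len[OF \<gamma>[OF assms(1)]] .
  show "exchange x' (\<gamma> s) ! i = (exchange x (\<gamma> s))[p := x' s] ! i"
  proof (cases "i = p")
    case True
    then show ?thesis using assms i lq by (simp add: exchange_def)
  next
    case False
    then have "Ls (\<gamma> s) ! i \<noteq> s"
      using nth_eq_iff_index_eq[OF dist[OF \<gamma>[OF assms(1)]], of i p] i assms(2,3) lq by auto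
    then show ?thesis using False assms(4) i lq by (auto simp: exchange_def)
  qed
qed

lemma exchange_cong: "(\<And>s. s \<in> D \<Longrightarrow> \<gamma> s = j \<Longrightarrow> x s = x' s) \<Longrightarrow> exchange x j = exchange x' j"
  by (auto simp: exchange_def)

lemma exchange_transpose:
  assumes "s \<in> D" "t \<in> D" "s \<noteq> t" "\<gamma> s = \<gamma> t" and p: "p < q" "Ls (\<gamma> s) ! p = s"
    and p': "p' < q" "Ls (\<gamma> s) ! p' = t"
  shows "exchange (x \<circ> transpose s t) (\<gamma> s) =
    (exchange x (\<gamma> s))[p := exchange x (\<gamma> s) ! p', p' := exchange x (\<gamma> s) ! p]"
proof -
  have lq: "length (Ls (\<gamma> s)) = q" using len[OF \<gamma>[OF assms(1)]] .
  have e: "exchange x (\<gamma> s) ! p = x s" "exchange x (\<gamma> s) ! p' = x t"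
    using assms lq by (simp_all add: exchange_def)
  have "exchange (x(s := x t)) (\<gamma> s) = (exchange x (\<gamma> s))[p := x t]"
    using exchange_update[OF assms(1) p, of "x(s := x t)" x] by simp
  moreover have "exchange (x \<circ> transpose s t) (\<gamma> t) = (exchange (x(s := x t)) (\<gamma> t))[p' := (x \<circ> transpose s t) t]"
    using p' assms by (intro exchange_update[OF assms(2)]) (auto simp: transpose_def)
  ultimately show ?thesis using e assms(4) by simp
qed

text \<open>The relabelling \<open>x\<close> of \<open>D\<close> is a variable so that alternation
  can be expressed as a symmetry in \<open>x\<close>; the relation sought is the case
  \<open>x = id\<close>.\<close>

definition alt_sum :: "(nat list \<Rightarrow> 'a::field_char_0) \<Rightarrow> (nat \<Rightarrow> nat) \<Rightarrow> 'a" where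
  "alt_sum \<Delta> x = (\<Sum>\<sigma>\<in>{\<sigma>. \<sigma> permutes D}. of_int (sign \<sigma>) * (\<Prod>j<d. \<Delta> (exchange (x \<circ> \<sigma>) j)))"

lemma alt_sum_transpose:
  assumes "s \<in> D" "t \<in> D" "s \<noteq> t"
  shows "alt_sum \<Delta> (x \<circ> transpose s t) = - alt_sum \<Delta> x"
proof -
  let ?\<tau> = "transpose s t"
  let ?f = "\<lambda>\<sigma>. of_int (sign \<sigma>) * (\<Prod>j<d. \<Delta> (exchange (x \<circ> \<sigma>) j))"
  have \<tau>: "?\<tau> permutes D" using assms(1,2) by (rule permutes_swap_id)
  have "- alt_sum \<Delta> x = - (\<Sum>\<sigma>\<in>{\<sigma>. \<sigma> permutes D}. ?f (?\<tau> \<circ> \<sigma>))"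
    unfolding alt_sum_def using setum_permutations_compose_left[OF \<tau>, of ?f] by simp
  also have "\<dots> = (\<Sum>\<sigma>\<in>{\<sigma>. \<sigma> permutes D}. of_int (sign \<sigma>) * (\<Prod>j<d. \<Delta> (exchange (x \<circ> ?\<tau> \<circ> \<sigma>) j)))"
    unfolding sum_negf[symmetric]
  proof (rule sum.cong, simp)
    fix \<sigma> assume "\<sigma> \<in> {\<sigma>. \<sigma> permutes D}"
    then have "permutation \<sigma>" using finD by (auto intro: permutes_imp_permutation)
    then have "sign (?\<tau> \<circ> \<sigma>) = - sign \<sigma>"
      using assms(3) by (simp add: sign_compose permutation_swap_id sign_swap_id)
    then show "- ?f (?\<tau> \<circ> \<sigma>) = of_int (sign \<sigma>) * (\<Prod>j<d. \<Delta> (exchange (x \<circ> ?\<tau> \<circ> \<sigma>) j))"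
      by (simp add: comp_assoc)
  qed
  finally show ?thesis by (simp add: alt_sum_def)
qed

text \<open>Swapping \<open>s\<close> and \<open>t\<close> both fixes and negates the sum, and
  \<open>2\<close> is invertible.\<close>

lemma alt_sum_coincide:
  assumes "s \<in> D" "t \<in> D" "s \<noteq> t" "x s = x t"
  shows "alt_sum \<Delta> x = (0::'a::field_char_0)"
proof -
  have "x \<circ> transpose s t = x" using assms(4) by (auto simp: fun_eq_iff transpose_def)
  then have "alt_sum \<Delta> x = - alt_sum \<Delta> x" using alt_sum_transpose[OF assms(1-3), of \<Delta> x] by simp
  then have "2 * alt_sum \<Delta> x = 0" by (metis add.right_inverse mult_2)
  then show ?thesis by simp
qed

text \<open>Substitute the linear relation for the entry \<open>s0\<close>: every substitution other than \<open>s0\<close> itself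
  repeats an entry of \<open>D\<close>, so that only \<open>co s0\<close> times the alternating sum survives.\<close>

lemma alt_sum_vanishes:
  fixes \<Delta> :: "nat list \<Rightarrow> 'a::field_char_0"
  assumes rel: "\<And>l p. length l = q \<Longrightarrow> p < q \<Longrightarrow> (\<Sum>s\<in>D. co s * \<Delta> (l[p := s])) = 0"
    and s0: "s0 \<in> D" "co s0 \<noteq> 0"
  shows "alt_sum \<Delta> id = 0"
proof -
  have "(\<Sum>s\<in>D. co s * alt_sum \<Delta> (id(s0 := s))) = (\<Sum>s\<in>D. \<Sum>\<sigma>\<in>{\<sigma>. \<sigma> permutes D}.
      of_int (sign \<sigma>) * (co s * (\<Prod>j<d. \<Delta> (exchange (id(s0 := s) \<circ> \<sigma>) j))))"
    unfolding alt_sum_def by (simp add: sum_distrib_left mult_ac)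
  also have "\<dots> = (\<Sum>\<sigma>\<in>{\<sigma>. \<sigma> permutes D}. of_int (sign \<sigma>) *
      (\<Sum>s\<in>D. co s * (\<Prod>j<d. \<Delta> (exchange (id(s0 := s) \<circ> \<sigma>) j))))"
    by (subst sum.swap) (simp add: sum_distrib_left)
  also have "\<dots> = 0"
  proof (rule sum.neutral, rule ballI)
    fix \<sigma> assume "\<sigma> \<in> {\<sigma>. \<sigma> permutes D}"
    then have \<sigma>: "\<sigma> permutes D" by simp
    have "s0 \<in> \<sigma> ` D" using permutes_image[OF \<sigma>] s0(1) by simp
    then obtain r where r: "r \<in> D" "\<sigma> r = s0" by auto
    have inj: "\<sigma> t \<noteq> s0" if "t \<noteq> r" for t using r that permutes_inj[OF \<sigma>] by (metis injD)
    obtain p where p: "p < q" "Ls (\<gamma> r) ! p = r" using exchange_index[OF r(1)] .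
    let ?j = "\<gamma> r"
    have j: "?j < d" using \<gamma>[OF r(1)] .
    \<comment> \<open>Substituting for \<open>s0\<close> affects only the slot of its preimage
      \<open>r\<close>, hence a single factor of the product, to which the linear relation
      applies.\<close>
    have ex1: "exchange (id(s0 := s) \<circ> \<sigma>) ?j = (exchange \<sigma> ?j)[p := s]" for s
      using exchange_update[OF r(1) p, of "id(s0 := s) \<circ> \<sigma>" \<sigma>] inj r(2) by auto
    have ex2: "exchange (id(s0 := s) \<circ> \<sigma>) j' = exchange \<sigma> j'" if "j' \<noteq> ?j" for j' s
    proof (rule exchange_cong)
      fix t assume "t \<in> D" "\<gamma> t = j'"
      then have "t \<noteq> r" using that by auto
      then have "\<sigma> t \<noteq> s0" by (rule inj)
      then show "(id(s0 := s) \<circ> \<sigma>) t = \<sigma> t" by simp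
    qed
    have pr: "(\<Prod>j<d. \<Delta> (exchange (id(s0 := s) \<circ> \<sigma>) j)) =
        (\<Prod>j\<in>{..<d} - {?j}. \<Delta> (exchange \<sigma> j)) * \<Delta> ((exchange \<sigma> ?j)[p := s])" for s
    proof -
      have "(\<Prod>j<d. \<Delta> (exchange (id(s0 := s) \<circ> \<sigma>) j)) =
        \<Delta> (exchange (id(s0 := s) \<circ> \<sigma>) ?j) * (\<Prod>j\<in>{..<d} - {?j}. \<Delta> (exchange (id(s0 := s) \<circ> \<sigma>) j))"
        using j by (subst prod.remove[of _ ?j]) auto
      also have "(\<Prod>j\<in>{..<d} - {?j}. \<Delta> (exchange (id(s0 := s) \<circ> \<sigma>) j)) = (\<Prod>j\<in>{..<d} - {?j}. \<Delta> (exchange \<sigma> j))"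
        by (intro prod.cong) (auto simp: ex2)
      also have "\<Delta> (exchange (id(s0 := s) \<circ> \<sigma>) ?j) * (\<Prod>j\<in>{..<d} - {?j}. \<Delta> (exchange \<sigma> j)) =
        (\<Prod>j\<in>{..<d} - {?j}. \<Delta> (exchange \<sigma> j)) * \<Delta> ((exchange \<sigma> ?j)[p := s])"
        unfolding ex1 by (rule mult.commute)
      finally show ?thesis .
    qed
    have "(\<Sum>s\<in>D. co s * (\<Prod>j<d. \<Delta> (exchange (id(s0 := s) \<circ> \<sigma>) j))) =
        (\<Prod>j\<in>{..<d} - {?j}. \<Delta> (exchange \<sigma> j)) * (\<Sum>s\<in>D. co s * \<Delta> ((exchange \<sigma> ?j)[p := s]))"
      unfolding pr sum_distrib_left by (rule sum.cong[OF refl]) (rule mult.left_commute)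
    also have "(\<Sum>s\<in>D. co s * \<Delta> ((exchange \<sigma> ?j)[p := s])) = 0"
      by (rule rel) (use length_exchange[OF j] p in auto)
    finally show "of_int (sign \<sigma>) * (\<Sum>s\<in>D. co s * (\<Prod>j<d. \<Delta> (exchange (id(s0 := s) \<circ> \<sigma>) j))) = 0"
      by (simp only: mult_zero_right)
  qed
  finally have "0 = (\<Sum>s\<in>D. co s * alt_sum \<Delta> (id(s0 := s)))" by simp
  also have "\<dots> = (\<Sum>s\<in>{s0}. co s * alt_sum \<Delta> (id(s0 := s)))"
  proof (rule sum.mono_neutral_right)
    show "\<forall>s\<in>D - {s0}. co s * alt_sum \<Delta> (id(s0 := s)) = 0"
    proof
      fix s assume s: "s \<in> D - {s0}"
      then have "alt_sum \<Delta> (id(s0 := s)) = 0"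
        by (intro alt_sum_coincide[OF s0(1), of s]) (simp_all add: eq_commute)
      then show "co s * alt_sum \<Delta> (id(s0 := s)) = 0" by simp
    qed
  qed (use s0 finD in auto)
  finally show ?thesis using s0(2) by (simp add: fun_upd_idem)
qed

text \<open>Following \<open>\<sigma>\<close> by the transposition that returns
  \<open>\<sigma> s\<close> to \<open>s\<close> leaves fewer moved points and stays inside the
  blocks. This is used to see that all block-preserving permutations contribute the same term to the
  alternating sum.\<close>

lemma block_alternating:
  fixes \<Psi> :: "(nat \<Rightarrow> nat) \<Rightarrow> 'a::field_char_0"
  assumes alt: "\<And>x s t. s \<in> D \<Longrightarrow> t \<in> D \<Longrightarrow> s \<noteq> t \<Longrightarrow> \<gamma> s = \<gamma> t \<Longrightarrow> \<Psi> (x \<circ> transpose s t) = - \<Psi> x"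
    and "\<sigma> permutes D" "\<And>s. s \<in> D \<Longrightarrow> \<gamma> (\<sigma> s) = \<gamma> s"
  shows "\<Psi> (x \<circ> \<sigma>) = of_int (sign \<sigma>) * \<Psi> x"
  using assms(2,3)
proof (induction "card {s. \<sigma> s \<noteq> s}" arbitrary: \<sigma> x rule: less_induct)
  case less
  show ?case
  proof (cases "\<sigma> = id")
    case True then show ?thesis by simp
  next
    case False
    then obtain s where s: "\<sigma> s \<noteq> s" by (auto simp: fun_eq_iff)
    then have sD: "s \<in> D" using less.prems(1) by (auto simp: permutes_def)
    have tD: "\<sigma> s \<in> D" using permutes_in_image[OF less.prems(1)] sD by simp
    let ?\<tau> = "transpose s (\<sigma> s)"
    let ?\<rho> = "?\<tau> \<circ> \<sigma>"
    have \<tau>: "?\<tau> permutes D" using sD tD by (rule permutes_swap_id)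
    have \<rho>: "?\<rho> permutes D" using permutes_compose[OF less.prems(1) \<tau>] .
    have \<rho>\<gamma>: "\<gamma> (?\<rho> r) = \<gamma> r" if "r \<in> D" for r
      using less.prems(2)[OF that] less.prems(2)[OF sD] by (auto simp: transpose_def)
    have moved: "{r. \<sigma> r \<noteq> r} \<subseteq> D" using less.prems(1) by (auto simp: permutes_def)
    have sub: "{r. ?\<rho> r \<noteq> r} \<subset> {r. \<sigma> r \<noteq> r}"
    proof (rule psubsetI)
      show "{r. ?\<rho> r \<noteq> r} \<subseteq> {r. \<sigma> r \<noteq> r}"
      proof (rule subsetI, rule ccontr)
        fix r assume r: "r \<in> {r. ?\<rho> r \<noteq> r}" "r \<notin> {r. \<sigma> r \<noteq> r}"
        then have "\<sigma> r = r" "?\<tau> r \<noteq> r" by auto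
        then have "r = s \<or> r = \<sigma> s" by (auto simp: transpose_def split: if_splits)
        then show False using \<open>\<sigma> r = r\<close> s permutes_inj[OF less.prems(1)] by (metis injD)
      qed
      have "?\<rho> s = s" by simp
      then show "{r. ?\<rho> r \<noteq> r} \<noteq> {r. \<sigma> r \<noteq> r}" using s by blast
    qed
    then have "card {r. ?\<rho> r \<noteq> r} < card {r. \<sigma> r \<noteq> r}"
      using finite_subset[OF moved finD] by (rule psubset_card_mono[rotated])
    then have IH: "\<Psi> (x' \<circ> ?\<rho>) = of_int (sign ?\<rho>) * \<Psi> x'" for x' using less.hyps \<rho> \<rho>\<gamma> by blast
    have \<sigma>eq: "\<sigma> = ?\<tau> \<circ> ?\<rho>" by (simp add: fun_eq_iff)
    have "permutation ?\<rho>" using \<rho> finD by (auto intro: permutes_imp_permutation)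
    then have sg: "sign \<sigma> = - sign ?\<rho>"
      using s by (subst \<sigma>eq, subst sign_compose) (auto simp: permutation_swap_id sign_swap_id)
    have "\<Psi> (x \<circ> \<sigma>) = \<Psi> ((x \<circ> ?\<tau>) \<circ> ?\<rho>)" by (subst \<sigma>eq) (simp add: comp_assoc)
    also have "\<dots> = of_int (sign ?\<rho>) * \<Psi> (x \<circ> ?\<tau>)" by (rule IH)
    also have "\<Psi> (x \<circ> ?\<tau>) = - \<Psi> x" using alt[OF sD tD] s less.prems(2)[OF sD] by auto
    finally show ?thesis unfolding sg by (simp only: of_int_minus mult_minus_left mult_minus_right)
  qed
qed

end

section \<open>Reverse lexicographic comparison and leading monomials\<close>

lemma revlex_less_asym:
  assumes inj: "inj_on \<omega> (Vars k n)" and "keys m1 \<subseteq> Vars k n" "keys m2 \<subseteq> Vars k n"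
    and 12: "revlex_less \<omega> m1 m2" and 21: "revlex_less \<omega> m2 m1"
  shows False
proof -
  have deg: "mdeg m1 = mdeg m2" using 12 21 unfolding revlex_less_def by linarith
  obtain x where x: "lookup m1 x > lookup m2 x"
    "\<forall>y. lookup m1 y \<noteq> lookup m2 y \<longrightarrow> \<omega> x \<le> \<omega> y"
    using 12 deg unfolding revlex_less_def by auto
  obtain x' where x': "lookup m2 x' > lookup m1 x'"
    "\<forall>y. lookup m2 y \<noteq> lookup m1 y \<longrightarrow> \<omega> x' \<le> \<omega> y"
    using 21 deg unfolding revlex_less_def by auto
  have "\<omega> x = \<omega> x'" using x x' by (metis le_antisym less_irrefl)
  moreover have "x \<in> Vars k n" "x' \<in> Vars k n" using x(1) x'(1) assms(2,3) by (auto simp: in_keys_iff)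
  ultimately have "x = x'" using inj by (simp add: inj_on_eq_iff)
  then show False using x(1) x'(1) by simp
qed

lemma lead_monI:
  assumes inj: "inj_on \<omega> (Vars k n)" and p: "p \<in> R k n" and m: "m \<in> keys p"
    and max: "\<And>m'. m' \<in> keys p \<Longrightarrow> m' \<noteq> m \<Longrightarrow> revlex_less \<omega> m' m"
  shows "lead_mon \<omega> p = m"
  unfolding lead_mon_def
proof (rule the_equality)
  show "m \<in> keys p \<and> (\<forall>m'\<in>keys p. m' \<noteq> m \<longrightarrow> revlex_less \<omega> m' m)" using m max by blast
next
  fix m' assume m': "m' \<in> keys p \<and> (\<forall>m''\<in>keys p. m'' \<noteq> m' \<longrightarrow> revlex_less \<omega> m'' m')"
  show "m' = m"
  proof (rule ccontr)
    assume ne: "m' \<noteq> m"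
    have "keys m \<subseteq> Vars k n" "keys m' \<subseteq> Vars k n" using p m m' unfolding R_def by auto
    moreover have "revlex_less \<omega> m' m" using max[of m'] m' ne by simp
    moreover have "revlex_less \<omega> m m'" using m' m ne by metis
    ultimately show False using revlex_less_asym[OF inj, of m m'] by simp
  qed
qed

text \<open>\<open>bs\<close> need not be sorted. Once the common prefix is cancelled, the smallest
  remaining variable of \<open>bs\<close> is smaller than every remaining variable of
  \<open>cs\<close>, among which \<open>cs ! j0\<close> is smallest because \<open>cs\<close> is a
  chain. That variable decides the comparison.\<close>

lemma revlex_less_chain:
  assumes le: "lin_ext k n \<omega>" and "length bs = length cs" "j0 < length cs"
    and V: "set bs \<subseteq> Vars k n" "set cs \<subseteq> Vars k n" and sorted: "sorted_wrt (pl_le k) cs"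
    and eq: "\<And>j. j < j0 \<Longrightarrow> bs ! j = cs ! j" and lt: "\<omega> (bs ! j0) < \<omega> (cs ! j0)"
  shows "revlex_less \<omega> (chain_mon bs) (chain_mon cs)"
proof -
  let ?b = "drop j0 bs" and ?c = "drop j0 cs"
  have take: "take j0 bs = take j0 cs" using assms(2,3) eq by (intro nth_equalityI) auto
  have cb: "count_list bs a = count_list (take j0 cs) a + count_list ?b a" for a
    by (metis take append_take_drop_id count_list_append)
  have cc: "count_list cs a = count_list (take j0 cs) a + count_list ?c a" for a
    by (metis append_take_drop_id count_list_append)
  have bmem: "bs ! j0 \<in> set ?b" using assms(2,3) by (metis Cons_nth_drop_Suc list.set_intros(1))
  have clow: "\<omega> (cs ! j0) \<le> \<omega> a" if "a \<in> set ?c" for a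
  proof -
    from that obtain i where i: "i < length ?c" "a = ?c ! i" unfolding in_set_conv_nth by blast
    have a: "a = cs ! (j0 + i)" "j0 + i < length cs" using i assms(3) by simp_all
    show ?thesis
    proof (cases "a = cs ! j0")
      case False
      then have "0 < i" using a by (cases i) auto
      then have "pl_le k (cs ! j0) a" using sorted a by (auto simp: sorted_wrt_iff_nth_less)
      moreover have "cs ! j0 \<in> Vars k n" "a \<in> Vars k n" using V assms(3) a by auto
      ultimately have "\<omega> (cs ! j0) < \<omega> a" using le False unfolding lin_ext_def by auto
      then show ?thesis by simp
    qed simp
  qed
  define v where "v = arg_min_on \<omega> (set ?b)"
  have vb: "v \<in> set ?b" unfolding v_def using bmem by (intro arg_min_if_finite(1)) auto
  have vmin: "\<omega> v \<le> \<omega> a" if "a \<in> set ?b" for a unfolding v_def using that by (intro arg_min_least) auto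
  have vlt: "\<omega> v < \<omega> (cs ! j0)" using vmin[OF bmem] lt by simp
  have vc: "v \<notin> set ?c" using clow[of v] vlt by auto
  have 1: "count_list bs v > count_list cs v"
  proof -
    have "count_list ?c v = 0" using vc by simp
    moreover have "count_list ?b v \<noteq> 0" using vb by (simp add: count_list_0_iff)
    ultimately show ?thesis unfolding cb cc by simp
  qed
  have 2: "\<omega> v \<le> \<omega> a" if "count_list bs a \<noteq> count_list cs a" for a
  proof -
    have "count_list ?b a \<noteq> 0 \<or> count_list ?c a \<noteq> 0" using that unfolding cb cc by auto
    then have "a \<in> set ?b \<or> a \<in> set ?c" by (metis count_list_0_iff)
    then show ?thesis using vmin[of a] clow[of a] vlt by auto
  qed
  show ?thesis unfolding revlex_less_def mdeg_chain_mon lookup_chain_mon using assms(2) 1 2 by auto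
qed

section \<open>Evaluation of sums of monomials\<close>

lemma peval_superset:
  assumes "finite V" "keys p \<subseteq> V"
  shows "peval p x = (\<Sum>m\<in>V. lookup p m * mon_eval m x)"
  unfolding peval_mon_eval using assms by (intro sum.mono_neutral_left) (auto simp: in_keys_iff)

lemma lookup_sum_single:
  "lookup (\<Sum>i\<in>S. Poly_Mapping.single (f i) (c i)) m = (\<Sum>i\<in>S. if f i = m then c i else 0)"
  by (induction S rule: infinite_finite_induct) (auto simp: lookup_add lookup_single when_def)

lemma peval_sum_single:
  assumes "finite S"
  shows "peval (\<Sum>i\<in>S. Poly_Mapping.single (f i) (c i)) x = (\<Sum>i\<in>S. c i * mon_eval (f i) x)"
proof -
  let ?p = "\<Sum>i\<in>S. Poly_Mapping.single (f i) (c i)"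
  have "keys ?p \<subseteq> f ` S"
  proof
    fix m assume "m \<in> keys ?p"
    then have "(\<Sum>i\<in>S. if f i = m then c i else 0) \<noteq> 0" by (simp add: in_keys_iff lookup_sum_single)
    then obtain i where "i \<in> S" "(if f i = m then c i else 0) \<noteq> 0"
      by (rule sum.not_neutral_contains_not_neutral)
    then show "m \<in> f ` S" by (auto split: if_splits)
  qed
  then have "peval ?p x = (\<Sum>m\<in>f ` S. (\<Sum>i\<in>S. if f i = m then c i else 0) * mon_eval m x)"
    using assms by (subst peval_superset[of "f ` S"]) (auto simp: lookup_sum_single)
  also have "\<dots> = (\<Sum>m\<in>f ` S. \<Sum>i\<in>S. if f i = m then c i * mon_eval (f i) x else 0)"
    by (intro sum.cong refl) (auto simp: sum_distrib_right intro!: sum.cong)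
  also have "\<dots> = (\<Sum>i\<in>S. \<Sum>m\<in>f ` S. if f i = m then c i * mon_eval (f i) x else 0)" by (rule sum.swap)
  also have "\<dots> = (\<Sum>i\<in>S. c i * mon_eval (f i) x)" using assms by (intro sum.cong refl) simp
  finally show ?thesis .
qed

lemma mon_eval_chain: "mon_eval (chain_mon cs) x = prod_list (map x cs)"
  by (induction cs) (simp_all add: mon_eval_add mon_eval_single mon_eval_zero)

text \<open>Phrased for a set of matrices instead of an ideal, so that relations can be built
  directly on rank varieties.\<close>

definition vanishing_lead ::
  "nat \<Rightarrow> nat \<Rightarrow> (nat set \<Rightarrow> nat) \<Rightarrow> (nat set \<Rightarrow>\<^sub>0 nat) \<Rightarrow> (nat \<Rightarrow> nat \<Rightarrow> 'a::field) set \<Rightarrow> bool" where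
  "vanishing_lead k n \<omega> m Z \<longleftrightarrow>
    (\<exists>g\<in>R k n. g \<noteq> 0 \<and> lead_mon \<omega> g = m \<and> (\<forall>M\<in>Z. peval g (plk k M) = 0))"

context column_exchange
begin

lemma exchange_id: "exchange id j = Ls j"
  by (simp add: exchange_def map_idI)

lemma set_exchange:
  "j < d \<Longrightarrow> set (exchange x j) = (set (Ls j) - {s \<in> D. \<gamma> s = j}) \<union> x ` {s \<in> D. \<gamma> s = j}"
  using mem by (auto simp: exchange_def)

text \<open>Common part of the two constructions of relations. \<open>\<kappa>\<close> turns a list
  into a Plucker index, \<open>sg\<close> is the sign of the list, zero in case of repetitions, and
  \<open>low\<close> is the order condition: the first block moved by \<open>\<sigma>\<close>
  produces a strictly smaller column. The polynomial is \<open>alt_sum\<close> at \<open>id\<close>,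
  read as a formal expression. Permutations preserving every block give the chain monomial; the
  others give revlex-smaller ones or zero.\<close>

lemma exchange_poly:
  fixes sg :: "nat list \<Rightarrow> 'a::field_char_0" and \<kappa> :: "nat list \<Rightarrow> nat set"
    and Z :: "(nat \<Rightarrow> nat \<Rightarrow> 'a) set"
  assumes le: "lin_ext k n \<omega>" and cs: "length cs = d" "set cs \<subseteq> Vars k n" "sorted_wrt (pl_le k) cs"
    and Ln: "\<And>j. j < d \<Longrightarrow> set (Ls j) \<subseteq> {1..n}" and \<kappa>L: "\<And>j. j < d \<Longrightarrow> \<kappa> (Ls j) = cs ! j"
    and \<kappa>set: "\<And>l l'. set l = set l' \<Longrightarrow> \<kappa> l = \<kappa> l'"
    and \<kappa>V: "\<And>l. distinct l \<Longrightarrow> length l = q \<Longrightarrow> set l \<subseteq> {1..n} \<Longrightarrow> \<kappa> l \<in> Vars k n"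
    and sgL: "\<And>j. j < d \<Longrightarrow> sg (Ls j) \<noteq> 0" and sg0: "\<And>l. \<not> distinct l \<Longrightarrow> sg l = 0"
    and sgswap: "\<And>l p p'. length l = q \<Longrightarrow> p < q \<Longrightarrow> p' < q \<Longrightarrow> p \<noteq> p' \<Longrightarrow>
      sg (l[p := l ! p', p' := l ! p]) = - sg l"
    and low: "\<And>\<sigma> j0. \<sigma> permutes D \<Longrightarrow> j0 < d \<Longrightarrow> distinct (exchange \<sigma> j0) \<Longrightarrow>
      (\<And>j. j < j0 \<Longrightarrow> \<sigma> ` {s \<in> D. \<gamma> s = j} = {s \<in> D. \<gamma> s = j}) \<Longrightarrow>
      \<sigma> ` {s \<in> D. \<gamma> s = j0} \<noteq> {s \<in> D. \<gamma> s = j0} \<Longrightarrow>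
      pl_le k (\<kappa> (exchange \<sigma> j0)) (cs ! j0) \<and> \<kappa> (exchange \<sigma> j0) \<noteq> cs ! j0"
    and \<Delta>: "\<And>M l. M \<in> Z \<Longrightarrow> length l = q \<Longrightarrow> set l \<subseteq> {1..n} \<Longrightarrow> \<Delta> M l = sg l * plk k M (\<kappa> l)"
    and rel: "\<And>M. M \<in> Z \<Longrightarrow> \<exists>co s0. s0 \<in> D \<and> co s0 \<noteq> 0 \<and>
      (\<forall>l p. length l = q \<longrightarrow> p < q \<longrightarrow> (\<Sum>s\<in>D. co s * \<Delta> M (l[p := s])) = 0)"
  shows "vanishing_lead k n \<omega> (chain_mon cs) Z"
proof -
  define S where "S = {\<sigma>. \<sigma> permutes D}"
  have finS: "finite S" unfolding S_def using finD by (rule finite_permutations)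
  have DL: "D \<subseteq> {1..n}" using mem Ln \<gamma> by blast
  have inr: "set (exchange \<sigma> j) \<subseteq> {1..n}" if "\<sigma> \<in> S" "j < d" for \<sigma> j
  proof -
    have "\<sigma> ` D = D" using that permutes_image unfolding S_def by blast
    then have "\<sigma> ` {s \<in> D. \<gamma> s = j} \<subseteq> {1..n}" using DL by blast
    then show ?thesis unfolding set_exchange[OF that(2)] using Ln[OF that(2)] by blast
  qed
  define bs where "bs = (\<lambda>\<sigma>. map (\<lambda>j. \<kappa> (exchange \<sigma> j)) [0..<d])"
  define co where "co = (\<lambda>\<sigma>. of_int (sign \<sigma>) * (\<Prod>j<d. sg (exchange \<sigma> j)))"
  define g where "g = (\<Sum>\<sigma>\<in>S. Poly_Mapping.single (chain_mon (bs \<sigma>)) (co \<sigma>))"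
  have distE: "distinct (exchange \<sigma> j)" if "co \<sigma> \<noteq> 0" "j < d" for \<sigma> j
  proof (rule ccontr)
    assume "\<not> ?thesis"
    then have "(\<Prod>j<d. sg (exchange \<sigma> j)) = 0" using sg0 that(2) by (intro prod_zero) auto
    then show False using that(1) by (simp add: co_def)
  qed
  have bsV: "set (bs \<sigma>) \<subseteq> Vars k n" if "\<sigma> \<in> S" "co \<sigma> \<noteq> 0" for \<sigma>
    using \<kappa>V distE[OF that(2)] length_exchange inr[OF that(1)] by (auto simp: bs_def)
  define c0 where "c0 = (\<Prod>j<d. sg (Ls j))"
  have c0: "c0 \<noteq> 0" unfolding c0_def using sgL by simp
  \<comment> \<open>The sign that rearranging the blocks causes in the factors \<open>sg\<close>
    cancels \<open>sign \<sigma>\<close>, so these terms add up instead of cancelling.\<close>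
  have stab: "bs \<sigma> = cs \<and> co \<sigma> = c0" if \<sigma>: "\<sigma> \<in> S" "\<And>j. j < d \<Longrightarrow> \<sigma> ` {s \<in> D. \<gamma> s = j} = {s \<in> D. \<gamma> s = j}" for \<sigma>
  proof
    have "set (exchange \<sigma> j) = set (Ls j)" if "j < d" for j
      unfolding set_exchange[OF that] \<sigma>(2)[OF that] using mem by auto
    then have "\<kappa> (exchange \<sigma> j) = cs ! j" if "j < d" for j using \<kappa>set \<kappa>L that by metis
    then show "bs \<sigma> = cs" using cs(1) by (intro nth_equalityI) (auto simp: bs_def)
  next
    define \<Psi> where "\<Psi> = (\<lambda>x. \<Prod>j<d. sg (exchange x j))"
    have alt: "\<Psi> (x \<circ> transpose s t) = - \<Psi> x" if st: "s \<in> D" "t \<in> D" "s \<noteq> t" "\<gamma> s = \<gamma> t" for x s t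
    proof -
      obtain p where p: "p < q" "Ls (\<gamma> s) ! p = s" using exchange_index[OF st(1)] .
      obtain p' where p': "p' < q" "Ls (\<gamma> s) ! p' = t" using exchange_index[OF st(2)] st(4) by metis
      have pp: "p \<noteq> p'" using p p' st(3) by auto
      have j: "\<gamma> s < d" using \<gamma>[OF st(1)] .
      have 1: "sg (exchange (x \<circ> transpose s t) (\<gamma> s)) = - sg (exchange x (\<gamma> s))"
        unfolding exchange_transpose[OF st p p'] by (rule sgswap[OF length_exchange[OF j] p(1) p'(1) pp])
      have 2: "exchange (x \<circ> transpose s t) j' = exchange x j'" if "j' \<noteq> \<gamma> s" for j'
        using that st(4) by (intro exchange_cong) (auto simp: transpose_def)
      have 3: "(\<Prod>j\<in>{..<d} - {\<gamma> s}. sg (exchange (x \<circ> transpose s t) j)) = (\<Prod>j\<in>{..<d} - {\<gamma> s}. sg (exchange x j))"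
        by (intro prod.cong refl) (simp add: 2)
      show ?thesis unfolding \<Psi>_def
        using j by (subst (1 2) prod.remove[of _ "\<gamma> s"]) (simp_all add: 1 3)
    qed
    have g\<sigma>: "\<gamma> (\<sigma> s) = \<gamma> s" if "s \<in> D" for s
      using \<sigma>(2)[OF \<gamma>[OF that]] that by blast
    have perm: "\<sigma> permutes D" using \<sigma>(1) by (simp add: S_def)
    have "\<Psi> (id \<circ> \<sigma>) = of_int (sign \<sigma>) * \<Psi> id" using alt perm g\<sigma> by (rule block_alternating)
    moreover have "\<Psi> id = c0" unfolding \<Psi>_def exchange_id c0_def by simp
    ultimately have "\<Psi> \<sigma> = of_int (sign \<sigma>) * c0" by simp
    then have "co \<sigma> = of_int (sign \<sigma> * sign \<sigma>) * c0"
      unfolding co_def \<Psi>_def of_int_mult by (simp only: mult.assoc)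
    then show "co \<sigma> = c0" by simp
  qed
  have nonstab: "revlex_less \<omega> (chain_mon (bs \<sigma>)) (chain_mon cs)"
    if \<sigma>: "\<sigma> \<in> S" "co \<sigma> \<noteq> 0" "\<not> (\<forall>j<d. \<sigma> ` {s \<in> D. \<gamma> s = j} = {s \<in> D. \<gamma> s = j})" for \<sigma>
  proof -
    define j0 where "j0 = (LEAST j. j < d \<and> \<sigma> ` {s \<in> D. \<gamma> s = j} \<noteq> {s \<in> D. \<gamma> s = j})"
    have "\<exists>j. j < d \<and> \<sigma> ` {s \<in> D. \<gamma> s = j} \<noteq> {s \<in> D. \<gamma> s = j}" using \<sigma>(3) by blast
    then have j0: "j0 < d \<and> \<sigma> ` {s \<in> D. \<gamma> s = j0} \<noteq> {s \<in> D. \<gamma> s = j0}"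
      unfolding j0_def by (rule LeastI_ex)
    have below: "\<sigma> ` {s \<in> D. \<gamma> s = j} = {s \<in> D. \<gamma> s = j}" if "j < j0" for j
      using not_less_Least[of j "\<lambda>j. j < d \<and> \<sigma> ` {s \<in> D. \<gamma> s = j} \<noteq> {s \<in> D. \<gamma> s = j}"] that j0
      unfolding j0_def[symmetric] by auto
    have perm: "\<sigma> permutes D" using \<sigma>(1) by (simp add: S_def)
    have lw: "pl_le k (\<kappa> (exchange \<sigma> j0)) (cs ! j0) \<and> \<kappa> (exchange \<sigma> j0) \<noteq> cs ! j0"
    proof (rule low[OF perm])
      show "j0 < d" "\<sigma> ` {s \<in> D. \<gamma> s = j0} \<noteq> {s \<in> D. \<gamma> s = j0}" using j0 by simp_all
      then show "distinct (exchange \<sigma> j0)" using distE[OF \<sigma>(2)] by simp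
      show "\<sigma> ` {s \<in> D. \<gamma> s = j} = {s \<in> D. \<gamma> s = j}" if "j < j0" for j by (rule below[OF that])
    qed
    have same: "bs \<sigma> ! j = cs ! j" if "j < j0" for j
    proof -
      have jd: "j < d" using that j0 by simp
      have "set (exchange \<sigma> j) = set (Ls j)"
        unfolding set_exchange[OF jd] below[OF that] using mem by auto
      then have "\<kappa> (exchange \<sigma> j) = \<kappa> (Ls j)" by (rule \<kappa>set)
      then show ?thesis using \<kappa>L[OF jd] jd by (simp add: bs_def)
    qed
    have bj: "bs \<sigma> ! j0 = \<kappa> (exchange \<sigma> j0)" using j0 by (simp add: bs_def)
    have lb: "length (bs \<sigma>) = d" by (simp add: bs_def)
    have "bs \<sigma> ! j0 \<in> set (bs \<sigma>)" "cs ! j0 \<in> set cs" using lb cs(1) j0 by auto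
    then have "bs \<sigma> ! j0 \<in> Vars k n" "cs ! j0 \<in> Vars k n"
      using bsV[OF \<sigma>(1,2)] cs(2) by blast+
    then have "\<omega> (bs \<sigma> ! j0) < \<omega> (cs ! j0)"
      using le lw unfolding lin_ext_def bj by blast
    then show ?thesis
      using revlex_less_chain[OF le, of "bs \<sigma>" cs j0] bsV[OF \<sigma>(1,2)] cs same lb j0 by simp
  qed
  have inj: "inj_on \<omega> (Vars k n)" using le by (simp add: lin_ext_def)
  have keysg: "\<exists>\<sigma>\<in>S. co \<sigma> \<noteq> 0 \<and> m = chain_mon (bs \<sigma>)" if "m \<in> keys g" for m
  proof -
    have "(\<Sum>\<sigma>\<in>S. if chain_mon (bs \<sigma>) = m then co \<sigma> else 0) \<noteq> 0"
      using that unfolding g_def in_keys_iff lookup_sum_single .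
    then obtain \<sigma> where "\<sigma> \<in> S" "(if chain_mon (bs \<sigma>) = m then co \<sigma> else 0) \<noteq> 0"
      by (rule sum.not_neutral_contains_not_neutral)
    then show ?thesis by (auto split: if_splits)
  qed
  have gR: "g \<in> R k n"
    unfolding R_def using keysg bsV keys_chain_mon by fastforce
  have csK: "keys (chain_mon cs) \<subseteq> Vars k n" using cs(2) keys_chain_mon by simp
  have single_coeff: "(if chain_mon (bs \<sigma>) = chain_mon cs then co \<sigma> else 0) =
      (if \<forall>j<d. \<sigma> ` {s \<in> D. \<gamma> s = j} = {s \<in> D. \<gamma> s = j} then c0 else 0)" if "\<sigma> \<in> S" for \<sigma>
  proof (cases "\<forall>j<d. \<sigma> ` {s \<in> D. \<gamma> s = j} = {s \<in> D. \<gamma> s = j}")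
    case True
    then show ?thesis using stab[OF that] by simp
  next
    case False
    show ?thesis
    proof (cases "co \<sigma> = 0")
      case nz: False
      have "chain_mon (bs \<sigma>) \<noteq> chain_mon cs"
        using nonstab[OF that nz False] revlex_less_asym[OF inj csK csK] by auto
      then show ?thesis using False by auto
    qed (use False in auto)
  qed
  define T where "T = {\<sigma>\<in>S. \<forall>j<d. \<sigma> ` {s \<in> D. \<gamma> s = j} = {s \<in> D. \<gamma> s = j}}"
  have "lookup g (chain_mon cs) = (\<Sum>\<sigma>\<in>S. if \<forall>j<d. \<sigma> ` {s \<in> D. \<gamma> s = j} = {s \<in> D. \<gamma> s = j} then c0 else 0)"
    unfolding g_def lookup_sum_single by (rule sum.cong[OF refl single_coeff])
  \<comment> \<open>\<open>T\<close> is the stabilizer of the blocks; its order is nonzero in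
    characteristic zero.\<close>
  also have "\<dots> = of_nat (card T) * c0" unfolding T_def using finS by (simp add: sum.inter_filter[symmetric])
  finally have lk: "lookup g (chain_mon cs) = of_nat (card T) * c0" .
  have "id \<in> T" unfolding T_def S_def by (simp add: permutes_id)
  moreover have "finite T" unfolding T_def using finS by simp
  ultimately have "card T \<noteq> 0" by auto
  then have csg: "chain_mon cs \<in> keys g" using lk c0 by (simp add: in_keys_iff)
  then have "g \<noteq> 0" by auto
  moreover have "lead_mon \<omega> g = chain_mon cs"
  proof (rule lead_monI[OF inj gR csg])
    fix m assume m: "m \<in> keys g" "m \<noteq> chain_mon cs"
    then obtain \<sigma> where \<sigma>: "\<sigma> \<in> S" "co \<sigma> \<noteq> 0" "m = chain_mon (bs \<sigma>)" using keysg by blast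
    then show "revlex_less \<omega> m (chain_mon cs)" using stab nonstab m(2) by blast
  qed
  moreover have "peval g (plk k M) = 0" if M: "M \<in> Z" for M
  proof -
    have "peval g (plk k M) = (\<Sum>\<sigma>\<in>S. co \<sigma> * mon_eval (chain_mon (bs \<sigma>)) (plk k M))"
      unfolding g_def by (rule peval_sum_single[OF finS])
    also have "\<dots> = alt_sum (\<Delta> M) id"
      unfolding alt_sum_def S_def[symmetric]
    proof (rule sum.cong[OF refl])
      fix \<sigma> assume \<sigma>: "\<sigma> \<in> S"
      have "mon_eval (chain_mon (bs \<sigma>)) (plk k M) = (\<Prod>j<d. plk k M (\<kappa> (exchange \<sigma> j)))"
        unfolding mon_eval_chain bs_def
        by (simp add: prod.list_conv_set_nth atLeast0LessThan)
      moreover have "(\<Prod>j<d. \<Delta> M (exchange \<sigma> j)) = (\<Prod>j<d. sg (exchange \<sigma> j) * plk k M (\<kappa> (exchange \<sigma> j)))"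
        using \<Delta>[OF M length_exchange inr[OF \<sigma>]] by (intro prod.cong) auto
      ultimately show "co \<sigma> * mon_eval (chain_mon (bs \<sigma>)) (plk k M) =
         of_int (sign \<sigma>) * (\<Prod>j<d. \<Delta> M (exchange (id \<circ> \<sigma>) j))"
        by (simp add: co_def prod.distrib)
    qed
    also have "\<dots> = 0"
      using rel[OF M] alt_sum_vanishes by blast
    finally show ?thesis .
  qed
  ultimately show ?thesis unfolding vanishing_lead_def using gR by blast
qed

end

section \<open>Relations with prescribed leading monomial\<close>

text \<open>As soon as \<open>E\<close> has an element up to \<open>y\<close>, everything of
  \<open>F\<close> above \<open>y\<close> belongs to \<open>E\<close>, so \<open>E'\<close> cannot
  have more elements above \<open>y\<close> than \<open>E\<close>.\<close>

lemma card_le_of_top_segment: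
  fixes E E' F :: "nat set"
  assumes "finite F" "E \<subseteq> F" "E' \<subseteq> F" "card E = card E'"
    and top: "\<And>s t. s \<in> E \<Longrightarrow> t \<in> F - E \<Longrightarrow> t < s"
  shows "card (E \<inter> {..y}) \<le> card (E' \<inter> {..y})"
proof (cases "E \<inter> {..y} = {}")
  case False
  then obtain e where e: "e \<in> E" "e \<le> y" by auto
  have fin: "finite E" "finite E'" using assms finite_subset by blast+
  have "E' \<inter> {y<..} \<subseteq> E \<inter> {y<..}"
  proof
    fix t assume t: "t \<in> E' \<inter> {y<..}"
    show "t \<in> E \<inter> {y<..}"
    proof (rule ccontr)
      assume "t \<notin> E \<inter> {y<..}"
      then have "t \<in> F - E" using t assms(3) by auto
      then have "t < e" by (rule top[OF e(1)])
      then show False using t e by auto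
    qed
  qed
  then have "card (E' \<inter> {y<..}) \<le> card (E \<inter> {y<..})" using fin by (intro card_mono) auto
  moreover have "card A = card (A \<inter> {..y}) + card (A \<inter> {y<..})" if "finite A" for A :: "nat set"
  proof -
    have "A = (A \<inter> {..y}) \<union> (A \<inter> {y<..})" by auto
    moreover have "card ((A \<inter> {..y}) \<union> (A \<inter> {y<..})) = card (A \<inter> {..y}) + card (A \<inter> {y<..})"
      using that by (intro card_Un_disjoint) auto
    ultimately show ?thesis by simp
  qed
  ultimately show ?thesis using fin assms(4) by (smt (verit) add_le_cancel_right add_mono_thms_linordered_semiring(2))
qed simp

text \<open>Mirror image: as soon as \<open>E\<close> reaches beyond \<open>y\<close>, everything of
  \<open>F\<close> up to \<open>y\<close> belongs to \<open>E\<close>.\<close>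

lemma card_le_of_bottom_segment:
  fixes E E' F :: "nat set"
  assumes "finite F" "E \<subseteq> F" "E' \<subseteq> F" "card E = card E'"
    and bot: "\<And>s t. s \<in> E \<Longrightarrow> t \<in> F - E \<Longrightarrow> s < t"
  shows "card (E' \<inter> {..y}) \<le> card (E \<inter> {..y})"
proof (cases "E \<subseteq> {..y}")
  case True
  have "finite E'" using assms finite_subset by blast
  then have "card (E' \<inter> {..y}) \<le> card E'" by (intro card_mono) auto
  also have "\<dots> = card (E \<inter> {..y})" using True assms(4) by (simp add: inf_absorb1)
  finally show ?thesis .
next
  case False
  then obtain e where e: "e \<in> E" "e \<notin> {..y}" by blast
  then have e: "e \<in> E" "y < e" by simp_all
  have "E' \<inter> {..y} \<subseteq> E \<inter> {..y}"
  proof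
    fix t assume t: "t \<in> E' \<inter> {..y}"
    show "t \<in> E \<inter> {..y}"
    proof (rule ccontr)
      assume "t \<notin> E \<inter> {..y}"
      then have "t \<in> F - E" using t assms(3) by auto
      then have "e < t" by (rule bot[OF e(1)])
      then show False using t e by auto
    qed
  qed
  then show ?thesis using assms(1,2) finite_subset by (intro card_mono) auto
qed

lemma card_exchange_Int:
  fixes A E E' :: "nat set"
  assumes "finite A" "E \<subseteq> A" "finite E'" "(A - E) \<inter> E' = {}"
  shows "card (((A - E) \<union> E') \<inter> Y) = card ((A - E) \<inter> Y) + card (E' \<inter> Y)"
    and "card (A \<inter> Y) = card ((A - E) \<inter> Y) + card (E \<inter> Y)"
proof -
  have finE: "finite E" using finite_subset[OF assms(2,1)] .
  have "((A - E) \<union> E') \<inter> Y = ((A - E) \<inter> Y) \<union> (E' \<inter> Y)" by auto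
  then show "card (((A - E) \<union> E') \<inter> Y) = card ((A - E) \<inter> Y) + card (E' \<inter> Y)"
    using assms by (simp only:) (rule card_Un_disjoint, auto)
  have "A \<inter> Y = ((A - E) \<inter> Y) \<union> (E \<inter> Y)" using assms(2) by auto
  moreover have "card (((A - E) \<inter> Y) \<union> (E \<inter> Y)) = card ((A - E) \<inter> Y) + card (E \<inter> Y)"
    using assms(1) finE by (intro card_Un_disjoint) auto
  ultimately show "card (A \<inter> Y) = card ((A - E) \<inter> Y) + card (E \<inter> Y)" by simp
qed

context column_exchange
begin

text \<open>Earlier blocks are mapped to themselves, so whatever enters list \<open>j0\<close> comes
  from block \<open>j0\<close> or a later one, that is, from \<open>F\<close>. The list trades
  \<open>E\<close> for \<open>E'\<close>, and distinctness keeps \<open>E'\<close> apart from its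
  remaining elements.\<close>

lemma exchange_first_change:
  assumes \<sigma>: "\<sigma> permutes D" and j0: "j0 < d" and dis: "distinct (exchange \<sigma> j0)"
    and below: "\<And>j. j < j0 \<Longrightarrow> \<sigma> ` {s \<in> D. \<gamma> s = j} = {s \<in> D. \<gamma> s = j}"
    and ne: "\<sigma> ` {s \<in> D. \<gamma> s = j0} \<noteq> {s \<in> D. \<gamma> s = j0}"
  obtains E E' F where "E = {s \<in> D. \<gamma> s = j0}" "F = {s \<in> D. j0 \<le> \<gamma> s}" "finite F" "E \<subseteq> F" "E' \<subseteq> F"
    "card E = card E'" "E \<subseteq> set (Ls j0)" "set (exchange \<sigma> j0) = (set (Ls j0) - E) \<union> E'"
    "(set (Ls j0) - E) \<inter> E' = {}" "set (exchange \<sigma> j0) \<noteq> set (Ls j0)"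
proof -
  define E E' F where "E = {s \<in> D. \<gamma> s = j0}" and "E' = \<sigma> ` E" and "F = {s \<in> D. j0 \<le> \<gamma> s}"
  have inj: "inj \<sigma>" using permutes_inj[OF \<sigma>] .
  have EF: "E \<subseteq> F" and finF: "finite F" using finD by (auto simp: E_def F_def)
  have finE: "finite E" using EF finF finite_subset by blast
  have cE: "card E = card E'" unfolding E'_def using inj by (metis card_image inj_on_subset subset_UNIV)
  have E'F: "E' \<subseteq> F"
  proof
    fix t assume "t \<in> E'"
    then obtain s where s: "s \<in> E" "t = \<sigma> s" unfolding E'_def by blast
    then have tD: "t \<in> D" using permutes_in_image[OF \<sigma>] by (simp add: E_def)
    have "\<not> \<gamma> t < j0"
    proof
      assume lt: "\<gamma> t < j0"
      then have "t \<in> \<sigma> ` {s \<in> D. \<gamma> s = \<gamma> t}" unfolding below[OF lt] using tD by simp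
      then obtain s' where s': "s' \<in> D" "\<gamma> s' = \<gamma> t" "t = \<sigma> s'" by blast
      then have "s' = s" using s(2) inj by (simp add: inj_eq)
      then show False using s(1) s'(2) lt by (simp add: E_def)
    qed
    then show "t \<in> F" using tD by (simp add: F_def)
  qed
  have EA: "E \<subseteq> set (Ls j0)" using mem by (auto simp: E_def)
  have setx: "set (exchange \<sigma> j0) = (set (Ls j0) - E) \<union> E'"
    using set_exchange[OF j0, of \<sigma>] unfolding E_def E'_def .
  have cA: "card (set (Ls j0)) = q" using distinct_card[OF dist[OF j0]] len[OF j0] by simp
  have cX: "card (set (exchange \<sigma> j0)) = q" using distinct_card[OF dis] length_exchange[OF j0] by simp
  have cAE: "card (set (Ls j0) - E) + card E = q" using card_Diff_subset[OF finE EA] cA card_mono[OF _ EA] by simp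
  have finE': "finite E'" using finE by (simp add: E'_def)
  have disj: "(set (Ls j0) - E) \<inter> E' = {}"
  proof -
    have "card ((set (Ls j0) - E) \<union> E') + card ((set (Ls j0) - E) \<inter> E') = card (set (Ls j0) - E) + card E'"
      using card_Un_Int[of "set (Ls j0) - E" E'] finE' by simp
    then have "card ((set (Ls j0) - E) \<inter> E') = 0" using cX setx cAE cE by simp
    then show ?thesis using finE' by simp
  qed
  have "set (exchange \<sigma> j0) \<noteq> set (Ls j0)"
  proof
    assume "set (exchange \<sigma> j0) = set (Ls j0)"
    then have "E' \<subseteq> E" using setx disj by blast
    then have "E' = E" using card_subset_eq[OF finE] cE by simp
    then show False using ne by (simp add: E_def E'_def)
  qed
  then show thesis using that[OF E_def F_def finF EF E'F cE EA setx disj] by blast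
qed

end

section \<open>Column ranks and the two kinds of relations\<close>

lemma col_rank_ge:
  assumes "finite S" "U \<subseteq> S" "lin_indep_cols k M U"
  shows "card U \<le> col_rank k M S"
proof -
  have "finite {card U | U. U \<subseteq> S \<and> lin_indep_cols k M U}"
    using assms(1) by (auto intro: finite_subset[of _ "card ` Pow S"])
  then show ?thesis unfolding col_rank_def using assms by (intro Max_ge) auto
qed

lemma col_rank_max:
  assumes "finite S"
  obtains U where "U \<subseteq> S" "lin_indep_cols k M U" "card U = col_rank k M S"
proof -
  let ?A = "{card U | U. U \<subseteq> S \<and> lin_indep_cols k M U}"
  have fin: "finite ?A" using assms by (auto intro: finite_subset[of _ "card ` Pow S"])
  have "lin_indep_cols k M {}" by (simp add: lin_indep_cols_def)
  then have "?A \<noteq> {}" by blast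
  then have "col_rank k M S \<in> ?A" unfolding col_rank_def using Max_in[OF fin] by blast
  then show thesis using that by auto
qed

lemma list_det_not_distinct:
  assumes "\<not> distinct l" "length l = q" "q \<le> N"
  shows "list_det N q B A l = 0"
proof -
  obtain i j where ij: "i < q" "j < q" "i \<noteq> j" "l ! i = l ! j"
    using assms(1,2) by (auto simp: distinct_conv_nth)
  show ?thesis unfolding list_det_def
    by (rule det_identical_rows[of _ N i j]) (use ij assms(3) in \<open>auto intro!: eq_vecI\<close>)
qed

lemma set_swap_list:
  assumes "p < length l" "p' < length l"
  shows "set (l[p := l ! p', p' := l ! p]) = set l" "distinct (l[p := l ! p', p' := l ! p]) \<longleftrightarrow> distinct l"
  using assms by (simp_all add: set_swap)

text \<open>On the rank variety the columns indexed by \<open>D\<close> are linearly dependent, and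
  this dependency is substituted into the minors. As larger elements of \<open>D\<close> sit in
  earlier columns, the block of the first changed column is a top segment of all that can still be
  exchanged, so a trade lowers that column.\<close>

lemma interval_lead:
  fixes S D :: "nat set"
  assumes le: "lin_ext k n \<omega>" and cs: "set cs \<subseteq> Vars k n" "sorted_wrt (pl_le k) cs"
    and S: "S \<subseteq> {1..n}" and D: "D \<subseteq> S" "r < card D"
    and \<gamma>: "\<And>s. s \<in> D \<Longrightarrow> \<gamma> s < length cs \<and> s \<in> cs ! \<gamma> s"
    and anti: "\<And>s t. s \<in> D \<Longrightarrow> t \<in> D \<Longrightarrow> s < t \<Longrightarrow> \<gamma> t \<le> \<gamma> s"
  shows "vanishing_lead k n \<omega> (chain_mon cs) (X_rank k n S r :: (nat \<Rightarrow> nat \<Rightarrow> 'a::field_char_0) set)"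
proof -
  have finS: "finite S" using finite_subset[OF S] by simp
  have finD: "finite D" using finite_subset[OF D(1) finS] .
  have V: "finite (cs ! j)" "card (cs ! j) = k" "cs ! j \<subseteq> {1..n}" "cs ! j \<in> Vars k n" if "j < length cs" for j
  proof -
    show "cs ! j \<in> Vars k n" using cs(1) nth_mem[OF that] by blast
    then show "finite (cs ! j)" "card (cs ! j) = k" "cs ! j \<subseteq> {1..n}" using VarsD[of "cs ! j" k n] by blast+
  qed
  interpret column_exchange D \<gamma> "length cs" k "\<lambda>j. sorted_list_of_set (cs ! j)"
    by unfold_locales (use finD \<gamma> V in simp_all)
  \<comment> \<open>Unit rows that place \<open>s\<close> at its rank in the sorted list of
    \<open>a\<close>. The determinant formed from them for a list is the sign of its sorting
    permutation.\<close>
  define E where "E = (\<lambda>a s c. if s = sorted_list_of_set (a::nat set) ! c then 1 else (0::'a))"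
  define sg where "sg = (\<lambda>l. if distinct l then list_det k k (E (set l)) (\<lambda>_ _. 0) l else 0)"
  have sorted1: "sg (sorted_list_of_set a) = 1" if "finite a" "card a = k" for a
  proof -
    have "mat k k (\<lambda>(r, c). if r < k then E a (sorted_list_of_set a ! r) c else 0) = 1\<^sub>m k"
      using that nth_eq_iff_index_eq[OF distinct_sorted_list_of_set[of a]]
      by (intro eq_matI) (auto simp: E_def)
    then show ?thesis using that by (simp add: sg_def list_det_def)
  qed
  show ?thesis
  proof (rule exchange_poly[where \<kappa> = set and sg = sg and \<Delta> = "\<lambda>M. list_det k k (\<lambda>s c. M c s) (\<lambda>_ _. 0)", OF le refl cs])
    show "set (sorted_list_of_set (cs ! j)) \<subseteq> {1..n}" "set (sorted_list_of_set (cs ! j)) = cs ! j"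
      if "j < length cs" for j using V[OF that] by auto
    show "set l = set l' \<Longrightarrow> set l = set l'" for l l' :: "nat list" .
    show "set l \<in> Vars k n" if "distinct l" "length l = k" "set l \<subseteq> {1..n}" for l
      using that distinct_card[of l] by (simp add: Vars_def)
    show "sg (sorted_list_of_set (cs ! j)) \<noteq> 0" if "j < length cs" for j using sorted1 V[OF that] by simp
    show "sg l = 0" if "\<not> distinct l" for l using that by (simp add: sg_def)
    show "sg (l[p := l ! p', p' := l ! p]) = - sg l" if "length l = k" "p < k" "p' < k" "p \<noteq> p'" for l p p'
      using that set_swap_list[of p l p'] list_det_swap[of p k p' l k "E (set l)" "\<lambda>_ _. 0"] by (simp add: sg_def)
  next
    fix \<sigma> j0
    assume \<sigma>: "\<sigma> permutes D" "j0 < length cs" "distinct (exchange \<sigma> j0)"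
      "\<And>j. j < j0 \<Longrightarrow> \<sigma> ` {s \<in> D. \<gamma> s = j} = {s \<in> D. \<gamma> s = j}"
      "\<sigma> ` {s \<in> D. \<gamma> s = j0} \<noteq> {s \<in> D. \<gamma> s = j0}"
    let ?A = "cs ! j0" and ?X = "set (exchange \<sigma> j0)"
    have setA: "set (sorted_list_of_set ?A) = ?A" using V[OF \<sigma>(2)] by simp
    obtain E E' F where E: "E = {s \<in> D. \<gamma> s = j0}" "F = {s \<in> D. j0 \<le> \<gamma> s}" "finite F" "E \<subseteq> F" "E' \<subseteq> F"
      "card E = card E'" "E \<subseteq> ?A" "?X = (?A - E) \<union> E'" "(?A - E) \<inter> E' = {}" "?X \<noteq> ?A"
      by (rule exchange_first_change[OF \<sigma>, unfolded setA])
    have top: "t < s" if "s \<in> E" "t \<in> F - E" for s t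
    proof (rule ccontr)
      assume "\<not> t < s"
      then have "s < t" using that by (cases "s = t") auto
      then have "\<gamma> t \<le> \<gamma> s" using anti that E(1,2) by auto
      then show False using that E(1,2) by auto
    qed
    have finE': "finite E'" using finite_subset[OF E(5,3)] .
    have fX: "?X \<subseteq> {1..n}"
    proof -
      have "F \<subseteq> {1..n}" using E(2) D(1) S by auto
      then show ?thesis using E(5,8) V[OF \<sigma>(2)] by blast
    qed
    have XV: "?X \<in> Vars k n"
      using fX distinct_card[OF \<sigma>(3)] length_exchange[OF \<sigma>(2)] by (simp add: Vars_def)
    have "card (?A \<inter> {..y}) \<le> card (?X \<inter> {..y})" for y
      unfolding E(8) card_exchange_Int[OF V(1)[OF \<sigma>(2)] E(7) finE' E(9)]
      using card_le_of_top_segment[OF E(3-6) top] by simp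
    then show "pl_le k ?X ?A \<and> ?X \<noteq> ?A" using pl_le_iff_card[OF XV V(4)[OF \<sigma>(2)]] E(10) by blast
  next
    fix M :: "nat \<Rightarrow> nat \<Rightarrow> 'a" and l assume l: "length l = k" "set l \<subseteq> {1..n}"
    show "list_det k k (\<lambda>s c. M c s) (\<lambda>_ _. 0) l = sg l * plk k M (set l)"
    proof (cases "distinct l")
      case False
      then show ?thesis using list_det_not_distinct[OF False l(1) order_refl] by (simp add: sg_def)
    next
      case True
      let ?s = "sorted_list_of_set (set l)"
      have ls: "length ?s = k" using True l(1) distinct_card by (simp add: distinct_card)
      let ?P = "mat k k (\<lambda>(r, c). if r < k then E (set l) (l ! r) c else 0)"
      let ?Q = "mat k k (\<lambda>(r, c). M c (?s ! r))"
      have "mat k k (\<lambda>(r, c). if r < k then M c (l ! r) else 0) = ?P * ?Q"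
      proof (rule eq_matI)
        fix i j assume "i < dim_row (?P * ?Q)" "j < dim_col (?P * ?Q)"
        then have ij: "i < k" "j < k" by auto
        have "l ! i \<in> set ?s" using ij l(1) by simp
        then obtain m where m: "m < k" "?s ! m = l ! i" using ls by (metis in_set_conv_nth)
        have "(?P * ?Q) $$ (i, j) = (\<Sum>c\<in>{0..<k}. (if l ! i = ?s ! c then 1 else 0) * M j (?s ! c))"
          using ij by (simp add: scalar_prod_def E_def)
        also have "\<dots> = (\<Sum>c\<in>{m}. (if l ! i = ?s ! c then 1 else 0) * M j (?s ! c))"
        proof (rule sum.mono_neutral_right)
          show "\<forall>c\<in>{0..<k} - {m}. (if l ! i = ?s ! c then 1 else 0) * M j (?s ! c) = 0"
          proof
            fix c assume c: "c \<in> {0..<k} - {m}"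
            then have "?s ! c \<noteq> ?s ! m"
              using nth_eq_iff_index_eq[OF distinct_sorted_list_of_set[of "set l"], of c m] ls m by auto
            then show "(if l ! i = ?s ! c then 1 else 0) * M j (?s ! c) = 0" using m by auto
          qed
        qed (use m in auto)
        finally show "mat k k (\<lambda>(r, c). if r < k then M c (l ! r) else 0) $$ (i, j) = (?P * ?Q) $$ (i, j)"
          using ij m by simp
      qed auto
      then have "list_det k k (\<lambda>s c. M c s) (\<lambda>_ _. 0) l = det ?P * det ?Q"
        unfolding list_det_def by (simp add: det_mult[of _ k])
      also have "det ?Q = plk k M (set l)"
      proof -
        have "?Q = transpose_mat (mat k k (\<lambda>(i, j). M i (?s ! j)))" by (rule eq_matI) auto
        then show ?thesis unfolding plk_def by (simp add: det_transpose[of _ k])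
      qed
      finally show ?thesis using True by (simp add: sg_def list_det_def)
    qed
  next
    fix M :: "nat \<Rightarrow> nat \<Rightarrow> 'a" assume M: "M \<in> X_rank k n S r"
    have "\<not> lin_indep_cols k M D"
      using col_rank_ge[OF finS D(1), of k M] D(2) M by (auto simp: X_rank_def)
    then obtain co s0 where co: "\<forall>i<k. (\<Sum>s\<in>D. co s * M i s) = 0" "s0 \<in> D" "co s0 \<noteq> 0"
      unfolding lin_indep_cols_def by auto
    have "(\<Sum>s\<in>D. co s * list_det k k (\<lambda>s c. M c s) (\<lambda>_ _. 0) (l[p := s])) = 0"
      if "length l = k" "p < k" for l p
      by (rule list_det_relation[where lam = "\<lambda>_. 0"]) (use that co(1) in auto)
    then show "\<exists>co s0. s0 \<in> D \<and> co s0 \<noteq> 0 \<and> (\<forall>l p. length l = k \<longrightarrow> p < k \<longrightarrow>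
        (\<Sum>s\<in>D. co s * list_det k k (\<lambda>s c. M c s) (\<lambda>_ _. 0) (l[p := s])) = 0)"
      using co(2,3) by blast
  qed
qed

lemma card_compl_Int:
  fixes Z A Y :: "nat set"
  assumes "finite A" "Z \<subseteq> A"
  shows "card ((A - Z) \<inter> Y) + card (Z \<inter> Y) = card (A \<inter> Y)"
proof -
  have "A \<inter> Y = ((A - Z) \<inter> Y) \<union> (Z \<inter> Y)" using assms(2) by auto
  moreover have "card (((A - Z) \<inter> Y) \<union> (Z \<inter> Y)) = card ((A - Z) \<inter> Y) + card (Z \<inter> Y)"
    using assms(1) finite_subset[OF assms(2,1)] by (intro card_Un_disjoint) auto
  ultimately show ?thesis by simp
qed

lemma covector_vanishes_on_span:
  fixes M :: "nat \<Rightarrow> nat \<Rightarrow> 'a::field"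
  assumes "finite S" and U: "U \<subseteq> S" "lin_indep_cols k M U" "card U = col_rank k M S"
    and lamU: "\<And>s. s \<in> U \<Longrightarrow> (\<Sum>i<k. lam i * M i s) = 0" and s: "s \<in> S"
  shows "(\<Sum>i<k. lam i * M i s) = 0"
proof (cases "s \<in> U")
  case False
  have finU: "finite U" using finite_subset[OF U(1) assms(1)] .
  have "\<not> lin_indep_cols k M (insert s U)"
    using col_rank_ge[OF assms(1), of "insert s U" k M] U(1,3) s False finU by auto
  then obtain c t where c: "\<forall>i<k. (\<Sum>l\<in>insert s U. c l * M i l) = 0" "t \<in> insert s U" "c t \<noteq> 0"
    unfolding lin_indep_cols_def by blast
  have cs: "c s \<noteq> 0"
  proof
    assume "c s = 0"
    then have "\<forall>i<k. (\<Sum>l\<in>U. c l * M i l) = 0" using c(1) False finU by simp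
    then have "\<forall>l\<in>U. c l = 0" using U(2) unfolding lin_indep_cols_def by blast
    then show False using c(2,3) \<open>c s = 0\<close> by blast
  qed
  have "0 = (\<Sum>i<k. lam i * (\<Sum>l\<in>insert s U. c l * M i l))" using c(1) by simp
  also have "\<dots> = (\<Sum>l\<in>insert s U. c l * (\<Sum>i<k. lam i * M i l))"
    unfolding sum_distrib_left by (subst sum.swap) (simp add: mult.left_commute)
  also have "\<dots> = c s * (\<Sum>i<k. lam i * M i s)" using finU False lamU by simp
  finally show ?thesis using cs by simp
qed (use lamU in simp)

lemma plk_covector_zero:
  fixes M :: "nat \<Rightarrow> nat \<Rightarrow> 'a::field"
  assumes "finite a" "card a = k" "plk k M a \<noteq> 0"
    and z: "\<And>s. s \<in> a \<Longrightarrow> (\<Sum>i<k. lam i * M i s) = 0" and "i < k"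
  shows "lam i = 0"
proof (rule ccontr)
  assume nz: "lam i \<noteq> 0"
  let ?A = "mat k k (\<lambda>(i, j). M i (sorted_list_of_set a ! j))" and ?v = "vec k lam"
  have A: "transpose_mat ?A \<in> carrier_mat k k" by simp
  have "transpose_mat ?A *\<^sub>v ?v = 0\<^sub>v k"
  proof (rule eq_vecI)
    fix j assume "j < dim_vec (0\<^sub>v k)"
    then have j: "j < k" by simp
    then have "sorted_list_of_set a ! j \<in> a" using assms(1,2) nth_mem[of j "sorted_list_of_set a"] by simp
    then show "(transpose_mat ?A *\<^sub>v ?v) $ j = 0\<^sub>v k $ j"
      using z j by (simp add: scalar_prod_def atLeast0LessThan mult.commute)
  qed simp
  moreover have "?v \<noteq> 0\<^sub>v k" using nz assms(5) by (metis index_vec index_zero_vec(1))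
  ultimately have "det (transpose_mat ?A) = 0"
    unfolding det_0_iff_vec_prod_zero_field[OF A] by (intro exI[of _ ?v]) simp
  then show False using assms(3) unfolding plk_def by (simp add: det_transpose[of _ k])
qed

text \<open>Reordering the columns as \<open>l\<close> followed by its complement makes the matrix
  block triangular, with an identity block and the minor as diagonal blocks. \<open>W\<close> is the
  matrix of this reordering; its determinant is the sign, which \<open>P\<close> expresses as a
  \<open>list_det\<close> again.\<close>

lemma complement_det:
  fixes M :: "nat \<Rightarrow> nat \<Rightarrow> 'a::field" and l :: "nat list"
    and k n :: nat
  defines "B \<equiv> \<lambda>s c. if Suc c = s then 1 else (0::'a)"
    and "P \<equiv> \<lambda>r c. if Suc c = sorted_list_of_set ({1..n} - set l) ! (r - (n - k)) then 1 else (0::'a)"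
  assumes l: "distinct l" "length l = n - k" "set l \<subseteq> {1..n}" and kn: "k \<le> n"
  shows "list_det n (n - k) B (\<lambda>r c. M (r - (n - k)) (Suc c)) l =
      list_det n (n - k) B P l * plk k M ({1..n} - set l)"
    and "list_det n (n - k) B P l \<noteq> 0"
proof -
  let ?a = "{1..n} - set l"
  let ?s = "sorted_list_of_set ?a"
  let ?q = "n - k"
  define p where "p = l @ ?s"
  have ca: "card ?a = k" using l kn distinct_card[OF l(1)] by (simp add: card_Diff_subset)
  have dp: "distinct p" using l by (simp add: p_def)
  have sp: "set p = {1..n}" using l(3) by (auto simp: p_def)
  have lp: "length p = n" using l(2) ca kn by (simp add: p_def)
  define W where "W = mat n n (\<lambda>(r, c). if Suc c = p ! r then 1 else (0::'a))"
  have W: "W \<in> carrier_mat n n" by (simp add: W_def)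
  have PW: "mat n n (\<lambda>(r, c). if r < ?q then B (l ! r) c else P r c) = W"
    unfolding W_def by (rule eq_matI) (auto simp: B_def P_def p_def nth_append l(2))
  have idx: "\<exists>m<n. p ! m = Suc c" if "c < n" for c
  proof -
    have "Suc c \<in> set p" using that sp by simp
    then show ?thesis using lp by (auto simp: in_set_conv_nth)
  qed
  have inj: "p ! i = p ! j \<longleftrightarrow> i = j" if "i < n" "j < n" for i j
    using nth_eq_iff_index_eq[OF dp] that lp by simp
  define X where "X = mat n n (\<lambda>(r, m). if r < ?q then (if r = m then 1 else 0) else M (r - ?q) (p ! m))"
  have X: "X \<in> carrier_mat n n" by (simp add: X_def)
  have "mat n n (\<lambda>(r, c). if r < ?q then B (l ! r) c else M (r - ?q) (Suc c)) = X * W"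
  proof (rule eq_matI)
    fix i j assume "i < dim_row (X * W)" "j < dim_col (X * W)"
    then have ij: "i < n" "j < n" using X W by auto
    obtain m where m: "m < n" "p ! m = Suc j" using idx[OF ij(2)] by blast
    have "(X * W) $$ (i, j) = (\<Sum>c\<in>{0..<n}. X $$ (i, c) * W $$ (c, j))"
      using ij X W by (simp add: scalar_prod_def)
    also have "\<dots> = (\<Sum>c\<in>{0..<n}. if c = m then X $$ (i, m) else 0)"
    proof (rule sum.cong[OF refl])
      fix c assume "c \<in> {0..<n}"
      then have c: "c < n" by simp
      show "X $$ (i, c) * W $$ (c, j) = (if c = m then X $$ (i, m) else 0)"
        using inj[OF c m(1)] c ij m by (auto simp: W_def)
    qed
    also have "\<dots> = X $$ (i, m)" using m by simp
    finally have e: "(X * W) $$ (i, j) = X $$ (i, m)" .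
    show "mat n n (\<lambda>(r, c). if r < ?q then B (l ! r) c else M (r - ?q) (Suc c)) $$ (i, j) = (X * W) $$ (i, j)"
    proof (cases "i < ?q")
      case True
      then have "l ! i = p ! i" using l(2) by (simp add: p_def nth_append)
      then show ?thesis unfolding e using True ij m inj[OF ij(1) m(1)] by (auto simp: X_def B_def)
    next
      case False
      then show ?thesis unfolding e using ij m by (simp add: X_def)
    qed
  qed (use X W in auto)
  then have "list_det n ?q B (\<lambda>r c. M (r - ?q) (Suc c)) l = det X * det W"
    unfolding list_det_def by (simp add: det_mult[OF X W])
  moreover have "det X = plk k M ?a"
  proof -
    define C where "C = mat k ?q (\<lambda>(i, j). M i (p ! j))"
    define Y where "Y = mat k k (\<lambda>(i, j). M i (?s ! j))"
    have "X = four_block_mat (1\<^sub>m ?q) (0\<^sub>m ?q k) C Y"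
      by (rule eq_matI) (use kn l(2) in \<open>auto simp: X_def C_def Y_def p_def nth_append\<close>)
    moreover have "det (four_block_mat (1\<^sub>m ?q) (0\<^sub>m ?q k) C Y) = det (1\<^sub>m ?q) * det Y"
      by (rule det_four_block_mat_upper_right_zero[of _ ?q _ k]) (simp_all add: C_def Y_def)
    ultimately show ?thesis by (simp add: plk_def Y_def)
  qed
  ultimately show "list_det n ?q B (\<lambda>r c. M (r - ?q) (Suc c)) l = list_det n ?q B P l * plk k M ?a"
    using PW by (simp add: list_det_def)
  have "W * transpose_mat W = 1\<^sub>m n"
  proof (rule eq_matI)
    fix i j assume "i < dim_row (1\<^sub>m n :: 'a mat)" "j < dim_col (1\<^sub>m n :: 'a mat)"
    then have ij: "i < n" "j < n" by auto
    have "p ! i \<in> {1..n}" using nth_mem[of i p] ij sp lp by simp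
    then obtain c0 where c0: "p ! i = Suc c0" "c0 < n" by (cases "p ! i") auto
    have "(W * transpose_mat W) $$ (i, j) = (\<Sum>c\<in>{0..<n}. W $$ (i, c) * W $$ (j, c))"
      using ij W by (simp add: scalar_prod_def)
    also have "\<dots> = (\<Sum>c\<in>{0..<n}. if c = c0 then W $$ (j, c0) else 0)"
      by (rule sum.cong[OF refl]) (use ij c0 in \<open>auto simp: W_def\<close>)
    also have "\<dots> = W $$ (j, c0)" using c0 by simp
    also have "\<dots> = 1\<^sub>m n $$ (i, j)" using ij c0 inj[OF ij] by (auto simp: W_def)
    finally show "(W * transpose_mat W) $$ (i, j) = 1\<^sub>m n $$ (i, j)" .
  qed (use W in auto)
  then have "det W * det (transpose_mat W) = 1" using det_mult[OF W, of "transpose_mat W"] W by simp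
  then show "list_det n ?q B P l \<noteq> 0" using PW by (auto simp: list_det_def)
qed

text \<open>The counterpart in the dual matroid, where the rank of \<open>T\<close> is at most
  \<open>card T + r - k\<close>, so that \<open>D\<close> is dependent. A dual dependency is a
  combination of the rows of \<open>M\<close> supported on \<open>D\<close>. Complements are
  exchanged here, so \<open>\<gamma>\<close> has to increase: a trade raises the complement and
  thereby lowers the column.\<close>

lemma complement_lead:
  fixes T D :: "nat set"
  assumes le: "lin_ext k n \<omega>" and kn: "k \<le> n" and cs: "set cs \<subseteq> Vars k n" "sorted_wrt (pl_le k) cs"
    and T: "T \<subseteq> {1..n}" and D: "D \<subseteq> T" "card T + r < card D + k"
    and \<gamma>: "\<And>s. s \<in> D \<Longrightarrow> \<gamma> s < length cs \<and> s \<notin> cs ! \<gamma> s"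
    and mono: "\<And>s t. s \<in> D \<Longrightarrow> t \<in> D \<Longrightarrow> s < t \<Longrightarrow> \<gamma> s \<le> \<gamma> t"
  shows "vanishing_lead k n \<omega> (chain_mon cs) (X_rank k n ({1..n} - T) r :: (nat \<Rightarrow> nat \<Rightarrow> 'a::field_char_0) set)"
proof -
  have finT: "finite T" using finite_subset[OF T] by simp
  have finD: "finite D" using finite_subset[OF D(1) finT] .
  have Dn: "D \<subseteq> {1..n}" using D(1) T by (rule order_trans)
  have V: "finite (cs ! j)" "card (cs ! j) = k" "cs ! j \<subseteq> {1..n}" "cs ! j \<in> Vars k n" if "j < length cs" for j
  proof -
    show "cs ! j \<in> Vars k n" using cs(1) nth_mem[OF that] by blast
    then show "finite (cs ! j)" "card (cs ! j) = k" "cs ! j \<subseteq> {1..n}" using VarsD[of "cs ! j" k n] by blast+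
  qed
  have cV: "card ({1..n} - cs ! j) = n - k" if "j < length cs" for j
    using V[OF that] by (simp add: card_Diff_subset)
  let ?Ls = "\<lambda>j. sorted_list_of_set ({1..n} - cs ! j)"
  have mem: "s \<in> set (?Ls (\<gamma> s))" if "s \<in> D" for s
  proof -
    have "s \<in> {1..n}" using Dn that by blast
    then show ?thesis using \<gamma>[OF that] by simp
  qed
  interpret column_exchange D \<gamma> "length cs" "n - k" ?Ls
    by unfold_locales (use finD \<gamma> mem cV in simp_all)
  define B where "B = (\<lambda>s c. if Suc c = s then 1 else (0::'a))"
  define P where "P = (\<lambda>a r c. if Suc c = sorted_list_of_set ({1..n} - a) ! (r - (n - k)) then 1 else (0::'a))"
  define sg where "sg = (\<lambda>l. if distinct l then list_det n (n - k) B (P (set l)) l else 0)"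
  define \<Delta> where "\<Delta> = (\<lambda>M. list_det n (n - k) B (\<lambda>r c. M (r - (n - k)) (Suc c)))"
  show ?thesis
  proof (rule exchange_poly[where \<kappa> = "\<lambda>l. {1..n} - set l" and sg = sg and \<Delta> = \<Delta>, OF le refl cs])
    show "set (?Ls j) \<subseteq> {1..n}" "{1..n} - set (?Ls j) = cs ! j"
      if "j < length cs" for j using V[OF that] by auto
    show "{1..n} - set l = {1..n} - set l'" if "set l = set l'" for l l' using that by simp
    show "{1..n} - set l \<in> Vars k n" if "distinct l" "length l = n - k" "set l \<subseteq> {1..n}" for l
      using that distinct_card[OF that(1)] kn by (auto simp: Vars_def card_Diff_subset)
    show "sg (?Ls j) \<noteq> 0" if "j < length cs" for j
      using complement_det(2)[of "?Ls j" n k] cV[OF that] kn by (simp add: sg_def B_def P_def)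
    show "sg l = 0" if "\<not> distinct l" for l using that by (simp add: sg_def)
    show "sg (l[p := l ! p', p' := l ! p]) = - sg l"
      if "length l = n - k" "p < n - k" "p' < n - k" "p \<noteq> p'" for l p p'
      using that set_swap_list[of p l p'] list_det_swap[of p "n - k" p' l n B "P (set l)"] by (simp add: sg_def)
  next
    fix \<sigma> j0
    assume \<sigma>: "\<sigma> permutes D" "j0 < length cs" "distinct (exchange \<sigma> j0)"
      "\<And>j. j < j0 \<Longrightarrow> \<sigma> ` {s \<in> D. \<gamma> s = j} = {s \<in> D. \<gamma> s = j}"
      "\<sigma> ` {s \<in> D. \<gamma> s = j0} \<noteq> {s \<in> D. \<gamma> s = j0}"
    let ?A = "{1..n} - cs ! j0" and ?X = "set (exchange \<sigma> j0)"
    have setA: "set (?Ls j0) = ?A" and fA: "finite ?A" by simp_all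
    obtain E E' F where E: "E = {s \<in> D. \<gamma> s = j0}" "F = {s \<in> D. j0 \<le> \<gamma> s}" "finite F" "E \<subseteq> F" "E' \<subseteq> F"
      "card E = card E'" "E \<subseteq> ?A" "?X = (?A - E) \<union> E'" "(?A - E) \<inter> E' = {}" "?X \<noteq> ?A"
      by (rule exchange_first_change[OF \<sigma>, unfolded setA])
    have bot: "s < t" if "s \<in> E" "t \<in> F - E" for s t
    proof (rule ccontr)
      assume "\<not> s < t"
      then have "t < s" using that by (cases "s = t") auto
      then have "\<gamma> t \<le> \<gamma> s" using mono that E(1,2) by auto
      then show False using that E(1,2) by auto
    qed
    have finE': "finite E'" using finite_subset[OF E(5,3)] .
    have fX: "?X \<subseteq> {1..n}"
    proof -
      have "F \<subseteq> {1..n}" using E(2) Dn by auto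
      then show ?thesis using E(5,8) by blast
    qed
    have XV: "{1..n} - ?X \<in> Vars k n"
      using fX distinct_card[OF \<sigma>(3)] length_exchange[OF \<sigma>(2)] kn by (auto simp: Vars_def card_Diff_subset)
    have ne: "{1..n} - ?X \<noteq> cs ! j0"
    proof
      assume "{1..n} - ?X = cs ! j0"
      then have "?A = {1..n} - ({1..n} - ?X)" by simp
      also have "\<dots> = ?X" using fX by blast
      finally show False using E(10) by simp
    qed
    have "card (cs ! j0 \<inter> {..y}) \<le> card (({1..n} - ?X) \<inter> {..y})" for y
    proof -
      have "card (?X \<inter> {..y}) \<le> card (?A \<inter> {..y})"
        unfolding E(8) card_exchange_Int[OF fA E(7) finE' E(9)]
        using card_le_of_bottom_segment[OF E(3-6) bot] by simp
      moreover have "card (({1..n} - ?X) \<inter> {..y}) + card (?X \<inter> {..y}) = card ({1..n} \<inter> {..y})"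
        by (rule card_compl_Int[OF _ fX]) simp
      moreover have "card (?A \<inter> {..y}) + card (cs ! j0 \<inter> {..y}) = card ({1..n} \<inter> {..y})"
        by (rule card_compl_Int[OF _ V(3)[OF \<sigma>(2)]]) simp
      ultimately show ?thesis by linarith
    qed
    then show "pl_le k ({1..n} - ?X) (cs ! j0) \<and> {1..n} - ?X \<noteq> cs ! j0"
      using pl_le_iff_card[OF XV V(4)[OF \<sigma>(2)]] ne by blast
  next
    fix M :: "nat \<Rightarrow> nat \<Rightarrow> 'a" and l assume l: "length l = n - k" "set l \<subseteq> {1..n}"
    show "\<Delta> M l = sg l * plk k M ({1..n} - set l)"
    proof (cases "distinct l")
      case False
      then show ?thesis using list_det_not_distinct[OF False l(1), of n] by (simp add: sg_def \<Delta>_def)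
    next
      case True
      then show ?thesis using complement_det(1)[OF True l kn, of M] by (simp add: sg_def \<Delta>_def B_def P_def)
    qed
  next
    fix M :: "nat \<Rightarrow> nat \<Rightarrow> 'a" assume M: "M \<in> X_rank k n ({1..n} - T) r"
    have fS: "finite ({1..n} - T)" by simp
    obtain U where U: "U \<subseteq> {1..n} - T" "lin_indep_cols k M U" "card U = col_rank k M ({1..n} - T)"
      by (rule col_rank_max[OF fS])
    have finU: "finite U" using finite_subset[OF U(1) fS] .
    have Ur: "card U \<le> r" using M U(3) by (simp add: X_rank_def)
    have "card (U \<union> (T - D)) \<le> card U + card (T - D)" by (rule card_Un_le)
    moreover have "card (T - D) = card T - card D" using finD D(1) by (rule card_Diff_subset)
    moreover have "card D \<le> card T" using card_mono[OF finT D(1)] .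
    ultimately have less: "card (U \<union> (T - D)) < card {..<k}" using Ur D(2) by simp
    \<comment> \<open>A covector killing a basis \<open>U\<close> of the columns outside
      \<open>T\<close> and all columns in \<open>T - D\<close>, which is fewer than \<open>k\<close>
      conditions. Its values on the columns are supported on \<open>D\<close>, and they are not all
      zero since \<open>M\<close> has full rank.\<close>
    obtain lam where lam: "\<exists>i\<in>{..<k}. lam i \<noteq> 0" "\<forall>s\<in>U \<union> (T - D). (\<Sum>i\<in>{..<k}. M i s * lam i) = 0"
      using homogeneous_system[OF _ _ less, of "\<lambda>s i. M i s"] finU finT by auto
    define co where "co = (\<lambda>s. \<Sum>i<k. lam i * M i s)"
    have co0: "co s = 0" if "s \<in> U \<union> (T - D)" for s using lam(2) that by (simp add: co_def mult.commute)
    have coS: "co s = 0" if "s \<in> {1..n} - T" for s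
      unfolding co_def by (rule covector_vanishes_on_span[OF fS U _ that]) (use co0 in \<open>simp add: co_def\<close>)
    have co: "co s = 0" if "s \<in> {1..n} - D" for s
      using that co0 coS by (cases "s \<in> T") simp_all
    have "\<exists>s0\<in>D. co s0 \<noteq> 0"
    proof (rule ccontr)
      assume "\<not> ?thesis"
      then have all: "co s = 0" if "s \<in> {1..n}" for s using co that by (cases "s \<in> D") auto
      obtain a where a: "a \<in> Vars k n" "plk k M a \<noteq> 0" using M by (auto simp: X_rank_def Gr_def)
      then have "finite a" "card a = k" "a \<subseteq> {1..n}" using VarsD by blast+
      then have "lam i = 0" if "i < k" for i
        using plk_covector_zero[OF _ _ a(2) _ that, of lam] all unfolding co_def by blast
      then show False using lam(1) by auto
    qed
    then obtain s0 where s0: "s0 \<in> D" "co s0 \<noteq> 0" by blast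
    have "(\<Sum>s\<in>D. co s * \<Delta> M (l[p := s])) = 0" if "length l = n - k" "p < n - k" for l p
      unfolding \<Delta>_def
    proof (rule list_det_relation[where lam = "\<lambda>r. lam (r - (n - k))"])
      fix c assume c: "c < n"
      have "(\<Sum>s\<in>D. co s * B s c) = (\<Sum>s\<in>D. if s = Suc c then co s else 0)"
        by (rule sum.cong) (auto simp: B_def)
      also have "\<dots> = co (Suc c)" using finD co[of "Suc c"] c by auto
      also have "\<dots> = (\<Sum>r\<in>{n - k..<n}. lam (r - (n - k)) * M (r - (n - k)) (Suc c))"
        unfolding co_def using kn
        by (intro sum.reindex_bij_witness[of _ "\<lambda>r. r - (n - k)" "\<lambda>i. i + (n - k)"]) auto
      finally show "(\<Sum>s\<in>D. co s * B s c) = (\<Sum>r\<in>{n - k..<n}. lam (r - (n - k)) * M (r - (n - k)) (Suc c))" .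
    qed (use that in auto)
    then show "\<exists>co s0. s0 \<in> D \<and> co s0 \<noteq> 0 \<and> (\<forall>l p. length l = n - k \<longrightarrow> p < n - k \<longrightarrow>
        (\<Sum>s\<in>D. co s * \<Delta> M (l[p := s])) = 0)"
      using s0 by blast
  qed
qed

section \<open>Permutations attached to a standard monomial\<close>

text \<open>For prefixes longer than \<open>k\<close>, compare the tails: both permutations have
  equally many values up to \<open>y\<close>, so more of them in the tail means fewer in the
  prefix.\<close>

lemma bruhat_reach_blockwise:
  assumes u: "bij_betw u {..<n} {1..n}" and v: "bij_betw v {..<n} {1..n}"
    and low: "\<And>i. i < k \<Longrightarrow> u i \<le> v i" and high: "\<And>i. k \<le> i \<Longrightarrow> i < n \<Longrightarrow> v i \<le> u i"
    and out: "\<And>i. n \<le> i \<Longrightarrow> v i = u i"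
  shows "bruhat_reach n v u"
proof (rule bruhat_reachI[OF u v _ out])
  fix c y assume c: "c \<le> n"
  have total: "prefix_count x c y + card {i. c \<le> i \<and> i < n \<and> x i \<le> y} = card ({1..n} \<inter> {..y})"
    if x: "bij_betw x {..<n} {1..n}" for x
  proof -
    have "x ` {i. i < n \<and> x i \<le> y} = {1..n} \<inter> {..y}"
      unfolding bij_betw_imp_surj_on[OF x, symmetric] by auto
    moreover have "inj_on x {i. i < n \<and> x i \<le> y}"
      using bij_betw_imp_inj_on[OF x] by (rule inj_on_subset) auto
    ultimately have "card ({1..n} \<inter> {..y}) = card {i. i < n \<and> x i \<le> y}" by (metis card_image)
    also have "{i. i < n \<and> x i \<le> y} = {i. i < c \<and> x i \<le> y} \<union> {i. c \<le> i \<and> i < n \<and> x i \<le> y}" using c by auto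
    also have "card \<dots> = prefix_count x c y + card {i. c \<le> i \<and> i < n \<and> x i \<le> y}"
      unfolding prefix_count_def by (intro card_Un_disjoint) auto
    finally show ?thesis by simp
  qed
  show "prefix_count v c y \<le> prefix_count u c y"
  proof (cases "c \<le> k")
    case True
    have "{i. i < c \<and> v i \<le> y} \<subseteq> {i. i < c \<and> u i \<le> y}"
    proof (rule subsetI, simp, elim conjE)
      fix i assume "i < c" "v i \<le> y"
      then show "u i \<le> y" using low[of i] True by simp
    qed
    then show ?thesis unfolding prefix_count_def by (intro card_mono) auto
  next
    case False
    have "{i. c \<le> i \<and> i < n \<and> u i \<le> y} \<subseteq> {i. c \<le> i \<and> i < n \<and> v i \<le> y}"
    proof (rule subsetI, simp, elim conjE)
      fix i assume "c \<le> i" "i < n" "u i \<le> y"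
      then show "v i \<le> y" using high[of i] False by simp
    qed
    then have "card {i. c \<le> i \<and> i < n \<and> u i \<le> y} \<le> card {i. c \<le> i \<and> i < n \<and> v i \<le> y}"
      by (intro card_mono) auto
    then show ?thesis using total[OF u] total[OF v] by linarith
  qed
qed

section \<open>Columns and their complements as chains of integer sets\<close>

lemma card_int_image_Int: "card (int ` a \<inter> {..z}) = card (a \<inter> {s. int s \<le> z})"
proof -
  have "int ` a \<inter> {..z} = int ` (a \<inter> {s. int s \<le> z})" by auto
  then show ?thesis by (simp add: card_image)
qed

lemma dominated_int:
  assumes "a \<in> Vars k n" "b \<in> Vars k n" "pl_le k a b"
  shows "dominated (int ` a) (int ` b)"
  unfolding dominated_def card_int_image_Int
proof
  fix z :: int
  show "card (b \<inter> {s. int s \<le> z}) \<le> card (a \<inter> {s. int s \<le> z})"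
  proof (cases "z < 0")
    case True
    then have "{s. int s \<le> z} = {}" by auto
    then show ?thesis by simp
  next
    case False
    then have "{s. int s \<le> z} = {..nat z}" by auto
    then show ?thesis using assms(3) unfolding pl_le_iff_card[OF assms(1,2)] by simp
  qed
qed

lemma card_neg_image_Int: "card ((\<lambda>s. - int s) ` a \<inter> {..z}) = card (a \<inter> {s. - z \<le> int s})"
proof -
  have "(\<lambda>s. - int s) ` a \<inter> {..z} = (\<lambda>s. - int s) ` (a \<inter> {s. - z \<le> int s})" by auto
  then show ?thesis by (simp add: card_image inj_on_def)
qed

text \<open>Complements reverse the Gale order and negation reverses it back, so
  \<open>greedy_chain\<close> applies to the negated complements too.\<close>

lemma dominated_neg_complement:
  assumes a: "a \<in> Vars k n" and b: "b \<in> Vars k n" and "pl_le k a b"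
  shows "dominated ((\<lambda>s. - int s) ` ({1..n} - a)) ((\<lambda>s. - int s) ` ({1..n} - b))"
  unfolding dominated_def card_neg_image_Int
proof
  fix z :: int
  let ?Y = "{s. - z \<le> int s}"
  have fin: "finite a" "finite b" "a \<subseteq> {1..n}" "b \<subseteq> {1..n}" "card a = k" "card b = k"
    using VarsD[OF a] VarsD[OF b] by simp_all
  have "card (a \<inter> ?Y) \<le> card (b \<inter> ?Y)"
  proof (cases "z < 0")
    case True
    define y where "y = nat (- z - 1)"
    have Y: "?Y = - {..y}" using True by (auto simp: y_def)
    have split: "card (c \<inter> - {..y}) + card (c \<inter> {..y}) = card c" if "finite c" for c :: "nat set"
      using card_compl_Int[OF that, of "c \<inter> {..y}" UNIV] by (simp add: Diff_Int Diff_eq Int_Un_distrib)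
    have "card (b \<inter> {..y}) \<le> card (a \<inter> {..y})" using assms(3) unfolding pl_le_iff_card[OF a b] by simp
    then show ?thesis unfolding Y using split[OF fin(1)] split[OF fin(2)] fin(5,6) by linarith
  next
    case False
    then have "?Y = UNIV" by auto
    then show ?thesis using fin by simp
  qed
  moreover have "card (({1..n} - a) \<inter> ?Y) + card (a \<inter> ?Y) = card ({1..n} \<inter> ?Y)"
    by (rule card_compl_Int) (use fin in simp_all)
  moreover have "card (({1..n} - b) \<inter> ?Y) + card (b \<inter> ?Y) = card ({1..n} \<inter> ?Y)"
    by (rule card_compl_Int) (use fin in simp_all)
  ultimately show "card (({1..n} - b) \<inter> ?Y) \<le> card (({1..n} - a) \<inter> ?Y)" by linarith
qed

text \<open>The values at positions below \<open>k\<close>. The witness consists of numbers missing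
  from columns, as \<open>complement_lead\<close> requires; \<open>c\<close> is the number of
  positions whose value in the last column is below \<open>X\<close>.\<close>

lemma low_positions:
  assumes "cs \<noteq> []" and cs: "set cs \<subseteq> Vars k n" "sorted_wrt (pl_le k) cs"
  shows "\<exists>f :: nat \<Rightarrow> nat \<Rightarrow> nat. (\<forall>j<length cs. bij_betw (f j) {..<k} (cs ! j)) \<and>
    (\<forall>j i. Suc j < length cs \<longrightarrow> i < k \<longrightarrow> f j i \<le> f (Suc j) i) \<and>
    (\<forall>y X. \<exists>D \<gamma> c. D \<subseteq> {y<..<X} \<and> (\<forall>s\<in>D. \<gamma> s < length cs \<and> s \<notin> cs ! \<gamma> s) \<and>
      (\<forall>s\<in>D. \<forall>t\<in>D. s < t \<longrightarrow> \<gamma> s \<le> \<gamma> t) \<and> c \<le> k \<and> (\<forall>i<c. f (length cs - 1) i < X) \<and>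
      card {y<..<X} \<le> card D + card {i. i < c \<and> y < f 0 i})"
proof -
  let ?As = "map (\<lambda>a. int ` a) cs"
  have V: "a \<in> Vars k n" if "a \<in> set cs" for a using that cs(1) by blast
  have 1: "?As \<noteq> []" using assms(1) by simp
  have 2: "\<forall>A\<in>set ?As. finite A \<and> card A = k" using VarsD[OF V] by (auto simp: card_image)
  have 3: "sorted_wrt dominated ?As" unfolding sorted_wrt_map
    using cs(2) by (rule sorted_wrt_mono_rel[rotated]) (use V dominated_int in blast)
  obtain bs where bs: "length bs = length ?As" "\<And>j. j < length ?As \<Longrightarrow> bij_betw (bs ! j) {..<k} (?As ! j)"
    "\<And>j i. Suc j < length ?As \<Longrightarrow> i < k \<Longrightarrow> (bs ! j) i \<le> (bs ! Suc j) i"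
    "\<And>i. i < k \<Longrightarrow> last bs i = sorted_list_of_set (last ?As) ! i"
    "\<And>y X. \<exists>D \<gamma>. D \<subseteq> {y<..<X} \<and> col_witness (\<lambda>j s. s \<notin> ?As ! j) (length ?As) D \<gamma> \<and>
      card {y<..<X} \<le> card D + card {i. i < card (last ?As \<inter> {..<X}) \<and> y < hd bs i}"
    using greedy_chain[OF 1 2 3] by blast
  define f where "f = (\<lambda>j i. nat ((bs ! j) i))"
  have int_f: "int (f j i) = (bs ! j) i" if "j < length cs" "i < k" for i j
  proof -
    have "(bs ! j) i \<in> int ` (cs ! j)" using bij_betwE[OF bs(2)[of j]] that by auto
    then show ?thesis by (auto simp: f_def)
  qed
  have bij: "bij_betw (f j) {..<k} (cs ! j)" if "j < length cs" for j
  proof -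
    have "bij_betw nat (int ` (cs ! j)) (cs ! j)" by (rule bij_betw_byWitness[of _ int]) auto
    moreover have "bij_betw (bs ! j) {..<k} (int ` (cs ! j))" using bs(2)[of j] that by simp
    ultimately have "bij_betw (nat \<circ> bs ! j) {..<k} (cs ! j)" by (rule bij_betw_trans[rotated])
    then show ?thesis by (simp add: f_def comp_def)
  qed
  have mono: "f j i \<le> f (Suc j) i" if "Suc j < length cs" "i < k" for j i
    using bs(3)[of j i] that by (simp add: f_def nat_mono)
  have lb: "length bs = length cs" using bs(1) by simp
  then have "bs \<noteq> []" using assms(1) by (cases bs) simp_all
  then have hd: "hd bs = bs ! 0" "last bs = bs ! (length cs - 1)"
    using lb by (simp_all add: hd_conv_nth last_conv_nth)
  have lastA: "last ?As = int ` last cs" using assms(1) by (simp add: last_map)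
  have cl: "card (last cs) = k" "finite (last cs)" using VarsD[OF V[of "last cs"]] assms(1) by simp_all
  have wit: "\<exists>D \<gamma> c. D \<subseteq> {y<..<X} \<and> (\<forall>s\<in>D. \<gamma> s < length cs \<and> s \<notin> cs ! \<gamma> s) \<and>
      (\<forall>s\<in>D. \<forall>t\<in>D. s < t \<longrightarrow> \<gamma> s \<le> \<gamma> t) \<and> c \<le> k \<and> (\<forall>i<c. f (length cs - 1) i < X) \<and>
      card {y<..<X} \<le> card D + card {i. i < c \<and> y < f 0 i}" for y X :: nat
  proof -
    obtain D \<gamma> where D: "D \<subseteq> {int y<..<int X}" "col_witness (\<lambda>j s. s \<notin> ?As ! j) (length ?As) D \<gamma>"
      "card {int y<..<int X} \<le> card D + card {i. i < card (last ?As \<inter> {..<int X}) \<and> int y < hd bs i}"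
      using bs(5) by blast
    define E where "E = {s. int s \<in> D}"
    define c where "c = card (last ?As \<inter> {..<int X})"
    have cA: "card (last ?As) = k" "finite (last ?As)" using cl by (simp_all add: lastA card_image)
    have ck: "c \<le> k" unfolding c_def cA(1)[symmetric] using cA(2) by (intro card_mono) auto
    have DE: "D = int ` E"
    proof
      show "D \<subseteq> int ` E"
      proof
        fix s assume s: "s \<in> D"
        then have "0 \<le> s" using D(1) by force
        then have "s = int (nat s)" by simp
        then show "s \<in> int ` E" using s unfolding E_def by (metis (mono_tags) image_eqI mem_Collect_eq)
      qed
    qed (auto simp: E_def)
    have cE: "card D = card E" unfolding DE by (simp add: card_image)
    have "E \<subseteq> {y<..<X}" using D(1) unfolding DE by auto
    moreover have "\<forall>s\<in>E. \<gamma> (int s) < length cs \<and> s \<notin> cs ! \<gamma> (int s)"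
      using D(2) unfolding col_witness_def DE by auto
    moreover have "\<forall>s\<in>E. \<forall>t\<in>E. s < t \<longrightarrow> \<gamma> (int s) \<le> \<gamma> (int t)"
      using D(2) unfolding col_witness_def DE by auto
    moreover have "\<forall>i<c. f (length cs - 1) i < X"
    proof (intro allI impI)
      fix i assume i: "i < c"
      then have ik: "i < k" using ck by simp
      have "sorted_list_of_set (last ?As) ! i < int X"
        using i nth_sorted_less_iff[OF cA(2), of i "int X"] by (simp add: c_def)
      then have "int (f (length cs - 1) i) < int X"
        using int_f[of "length cs - 1" i] ik assms(1) bs(4)[OF ik] hd(2) by simp
      then show "f (length cs - 1) i < X" by simp
    qed
    moreover have "{i. i < c \<and> int y < hd bs i} = {i. i < c \<and> y < f 0 i}"
    proof (rule Collect_cong, rule conj_cong[OF refl])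
      fix i assume "i < c"
      then have "int (f 0 i) = hd bs i" using int_f[of 0 i] ck assms(1) hd(1) by simp
      then show "int y < hd bs i \<longleftrightarrow> y < f 0 i" by linarith
    qed
    then have "card {y<..<X} \<le> card E + card {i. i < c \<and> y < f 0 i}"
      using D(3) cE by (simp add: c_def nat_diff_distrib')
    ultimately show ?thesis using ck by (intro exI[of _ E] exI[of _ "\<gamma> \<circ> int"] exI[of _ c]) simp
  qed
  show ?thesis by (intro exI[of _ f] conjI allI impI bij mono wit)
qed

text \<open>The values at positions from \<open>k\<close> on, from \<open>greedy_chain\<close> for
  negated complements. Positions are reversed so that the last permutation has its values of at
  least \<open>x\<close> at the end, as \<open>richardson_interval_rank\<close> requires. A number
  missing from a complement is an entry of the column, and negation makes the increasing witness
  decreasing.\<close>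

lemma high_positions:
  assumes "cs \<noteq> []" and kn: "k \<le> n" and cs: "set cs \<subseteq> Vars k n" "sorted_wrt (pl_le k) cs"
  shows "\<exists>f :: nat \<Rightarrow> nat \<Rightarrow> nat. (\<forall>j<length cs. bij_betw (f j) {k..<n} ({1..n} - cs ! j)) \<and>
    (\<forall>j i. Suc j < length cs \<longrightarrow> k \<le> i \<longrightarrow> i < n \<longrightarrow> f (Suc j) i \<le> f j i) \<and>
    (\<forall>x y. 1 \<le> x \<longrightarrow> y \<le> n \<longrightarrow> (\<exists>D \<gamma> c. D \<subseteq> {x..y} \<and> (\<forall>s\<in>D. \<gamma> s < length cs \<and> s \<in> cs ! \<gamma> s) \<and>
      (\<forall>s\<in>D. \<forall>t\<in>D. s < t \<longrightarrow> \<gamma> t \<le> \<gamma> s) \<and> k \<le> c \<and> c \<le> n \<and>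
      (\<forall>i. c \<le> i \<longrightarrow> i < n \<longrightarrow> x \<le> f (length cs - 1) i) \<and>
      card {x..y} \<le> card D + card {i. c \<le> i \<and> i < n \<and> f 0 i \<le> y}))"
proof -
  let ?neg = "\<lambda>s. - int s"
  let ?As = "map (\<lambda>a. ?neg ` ({1..n} - a)) cs"
  have V: "a \<in> Vars k n" if "a \<in> set cs" for a using that cs(1) by blast
  have injn: "inj_on ?neg A" for A by (simp add: inj_on_def)
  have cV: "card ({1..n} - a) = n - k" if "a \<in> set cs" for a
    using VarsD[OF V[OF that]] by (simp add: card_Diff_subset)
  have 1: "?As \<noteq> []" using assms(1) by simp
  have 2: "\<forall>A\<in>set ?As. finite A \<and> card A = n - k" using cV by (auto simp: card_image[OF injn])
  have 3: "sorted_wrt dominated ?As" unfolding sorted_wrt_map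
    using cs(2) by (rule sorted_wrt_mono_rel[rotated]) (use V dominated_neg_complement in blast)
  obtain bs where bs: "length bs = length ?As" "\<And>j. j < length ?As \<Longrightarrow> bij_betw (bs ! j) {..<n - k} (?As ! j)"
    "\<And>j i. Suc j < length ?As \<Longrightarrow> i < n - k \<Longrightarrow> (bs ! j) i \<le> (bs ! Suc j) i"
    "\<And>i. i < n - k \<Longrightarrow> last bs i = sorted_list_of_set (last ?As) ! i"
    "\<And>y X. \<exists>D \<gamma>. D \<subseteq> {y<..<X} \<and> col_witness (\<lambda>j s. s \<notin> ?As ! j) (length ?As) D \<gamma> \<and>
      card {y<..<X} \<le> card D + card {i. i < card (last ?As \<inter> {..<X}) \<and> y < hd bs i}"
    using greedy_chain[OF 1 2 3] by blast
  define f where "f = (\<lambda>j i. nat (- (bs ! j) (n - 1 - i)))"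
  have int_f: "int (f j i) = - (bs ! j) (n - 1 - i)" if "j < length cs" "k \<le> i" "i < n" for i j
  proof -
    have "n - 1 - i \<in> {..<n - k}" using that by auto
    then have "(bs ! j) (n - 1 - i) \<in> ?neg ` ({1..n} - cs ! j)" using bij_betwE[OF bs(2)[of j]] that by simp
    then show ?thesis by (auto simp: f_def)
  qed
  have bij: "bij_betw (f j) {k..<n} ({1..n} - cs ! j)" if "j < length cs" for j
  proof -
    have "bij_betw (\<lambda>i. n - 1 - i) {k..<n} {..<n - k}"
      by (rule bij_betw_byWitness[of _ "\<lambda>i. n - 1 - i"]) (use kn in auto)
    moreover have "bij_betw (bs ! j) {..<n - k} (?neg ` ({1..n} - cs ! j))" using bs(2)[of j] that by simp
    ultimately have "bij_betw (bs ! j \<circ> (\<lambda>i. n - 1 - i)) {k..<n} (?neg ` ({1..n} - cs ! j))" by (rule bij_betw_trans)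
    moreover have "bij_betw (\<lambda>z. nat (- z)) (?neg ` ({1..n} - cs ! j)) ({1..n} - cs ! j)"
      by (rule bij_betw_byWitness[of _ ?neg]) auto
    ultimately have "bij_betw ((\<lambda>z. nat (- z)) \<circ> (bs ! j \<circ> (\<lambda>i. n - 1 - i))) {k..<n} ({1..n} - cs ! j)"
      by (rule bij_betw_trans)
    then show ?thesis by (simp add: f_def comp_def)
  qed
  have mono: "f (Suc j) i \<le> f j i" if "Suc j < length cs" "k \<le> i" "i < n" for j i
  proof -
    have "n - 1 - i < n - k" using that by auto
    then show ?thesis using bs(3)[of j "n - 1 - i"] that(1) by (simp add: f_def nat_mono)
  qed
  have lb: "length bs = length cs" using bs(1) by simp
  then have "bs \<noteq> []" using assms(1) by (cases bs) simp_all
  then have hd: "hd bs = bs ! 0" "last bs = bs ! (length cs - 1)"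
    using lb by (simp_all add: hd_conv_nth last_conv_nth)
  have wit: "\<exists>D \<gamma> c. D \<subseteq> {x..y} \<and> (\<forall>s\<in>D. \<gamma> s < length cs \<and> s \<in> cs ! \<gamma> s) \<and>
      (\<forall>s\<in>D. \<forall>t\<in>D. s < t \<longrightarrow> \<gamma> t \<le> \<gamma> s) \<and> k \<le> c \<and> c \<le> n \<and>
      (\<forall>i. c \<le> i \<longrightarrow> i < n \<longrightarrow> x \<le> f (length cs - 1) i) \<and>
      card {x..y} \<le> card D + card {i. c \<le> i \<and> i < n \<and> f 0 i \<le> y}" if xy: "1 \<le> x" "y \<le> n" for x y
  proof -
    \<comment> \<open>The open interval from \<open>Y\<close> to \<open>Z\<close> is the negative of
      \<open>{x..y}\<close>.\<close>
    define Y Z where "Y = - int y - 1" and "Z = 1 - int x"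
    obtain D \<gamma> where D: "D \<subseteq> {Y<..<Z}" "col_witness (\<lambda>j s. s \<notin> ?As ! j) (length ?As) D \<gamma>"
      "card {Y<..<Z} \<le> card D + card {i. i < card (last ?As \<inter> {..<Z}) \<and> Y < hd bs i}"
      using bs(5) by blast
    define E where "E = {s. ?neg s \<in> D}"
    define c' where "c' = card (last ?As \<inter> {..<Z})"
    define c where "c = n - c'"
    have cA: "card (last ?As) = n - k" "finite (last ?As)" using 2 last_in_set[OF 1] by blast+
    have ck: "c' \<le> n - k" unfolding c'_def cA(1)[symmetric] using cA(2) by (intro card_mono) auto
    have kc: "k \<le> c" "c \<le> n" using ck kn by (auto simp: c_def)
    have DE: "D = ?neg ` E"
    proof
      show "D \<subseteq> ?neg ` E"
      proof
        fix s assume s: "s \<in> D"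
        then have "s \<le> 0" using D(1) xy unfolding Z_def by force
        then have "s = ?neg (nat (- s))" by simp
        then show "s \<in> ?neg ` E" using s unfolding E_def by (metis (mono_tags) image_eqI mem_Collect_eq)
      qed
    qed (auto simp: E_def)
    have cE: "card D = card E" unfolding DE by (simp add: card_image[OF injn])
    have Exy: "E \<subseteq> {x..y}" using D(1) unfolding DE Y_def Z_def by auto
    have "\<gamma> (?neg s) < length cs \<and> s \<in> cs ! \<gamma> (?neg s)" if "s \<in> E" for s
    proof -
      have sn: "s \<in> {1..n}" using Exy that xy by force
      have "?neg s \<in> D" using that by (simp add: E_def)
      then have j: "\<gamma> (?neg s) < length cs" "?neg s \<notin> ?As ! \<gamma> (?neg s)"
        using D(2) unfolding col_witness_def by auto
      then have "?neg s \<notin> ?neg ` ({1..n} - cs ! \<gamma> (?neg s))" by simp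
      then show ?thesis using j(1) sn by blast
    qed
    moreover have "\<gamma> (?neg t) \<le> \<gamma> (?neg s)" if "s \<in> E" "t \<in> E" "s < t" for s t
    proof -
      have "?neg s \<in> D" "?neg t \<in> D" "?neg t < ?neg s" using that by (simp_all add: E_def)
      then show ?thesis using D(2) unfolding col_witness_def by blast
    qed
    moreover have "x \<le> f (length cs - 1) i" if i: "c \<le> i" "i < n" for i
    proof -
      have l: "n - 1 - i < c'" using i by (auto simp: c_def)
      then have ik: "n - 1 - i < n - k" using ck by simp
      have "sorted_list_of_set (last ?As) ! (n - 1 - i) < Z"
        using l nth_sorted_less_iff[OF cA(2), of "n - 1 - i" Z] by (simp add: c'_def)
      then have "- int (f (length cs - 1) i) < Z"
        using int_f[of "length cs - 1" i] i kc assms(1) bs(4)[OF ik] hd(2) by simp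
      then show ?thesis by (simp add: Z_def)
    qed
    moreover have "card {i. i < c' \<and> Y < hd bs i} = card {i. c \<le> i \<and> i < n \<and> f 0 i \<le> y}"
    proof (rule bij_betw_same_card[of "\<lambda>i. n - 1 - i"], rule bij_betw_byWitness[of _ "\<lambda>i. n - 1 - i"])
      have key: "Y < hd bs (n - 1 - i) \<longleftrightarrow> f 0 i \<le> y" if "c \<le> i" "i < n" for i
        using int_f[of 0 i] that kc assms(1) hd(1) by (auto simp: Y_def)
      show "\<forall>i\<in>{i. i < c' \<and> Y < hd bs i}. n - 1 - (n - 1 - i) = i" using ck by auto
      show "\<forall>i\<in>{i. c \<le> i \<and> i < n \<and> f 0 i \<le> y}. n - 1 - (n - 1 - i) = i" by auto
      show "(\<lambda>i. n - 1 - i) ` {i. i < c' \<and> Y < hd bs i} \<subseteq> {i. c \<le> i \<and> i < n \<and> f 0 i \<le> y}"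
      proof (rule image_subsetI)
        fix i assume "i \<in> {i. i < c' \<and> Y < hd bs i}"
        then have i: "i < c'" "Y < hd bs i" by simp_all
        then have "c \<le> n - 1 - i" "n - 1 - i < n" "n - 1 - (n - 1 - i) = i" using ck by (auto simp: c_def)
        then show "n - 1 - i \<in> {i. c \<le> i \<and> i < n \<and> f 0 i \<le> y}" using key[of "n - 1 - i"] i(2) by simp
      qed
      show "(\<lambda>i. n - 1 - i) ` {i. c \<le> i \<and> i < n \<and> f 0 i \<le> y} \<subseteq> {i. i < c' \<and> Y < hd bs i}"
      proof (rule image_subsetI)
        fix i assume "i \<in> {i. c \<le> i \<and> i < n \<and> f 0 i \<le> y}"
        then have i: "c \<le> i" "i < n" "f 0 i \<le> y" by simp_all
        then have "n - 1 - i < c'" by (auto simp: c_def)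
        then show "n - 1 - i \<in> {i. i < c' \<and> Y < hd bs i}" using key[OF i(1,2)] i(3) by simp
      qed
    qed
    moreover have "card {Y<..<Z} = card {x..y}" by (simp add: Y_def Z_def nat_diff_distrib')
    ultimately show ?thesis using kc D(3) cE Exy
      by (intro exI[of _ E] exI[of _ "\<lambda>s. \<gamma> (?neg s)"] exI[of _ c]) (simp add: c'_def)
  qed
  show ?thesis by (intro exI[of _ f] conjI allI impI bij mono wit)
qed

section \<open>Initial ideals of positroid varieties\<close>

text \<open>With \<open>s\<close> the residue of \<open>\<alpha>\<close>, the interval wraps exactly
  when \<open>s + m\<close> exceeds \<open>n\<close>. The empty interval appears as
  \<open>x = Suc y\<close>, and the full circle with nonzero \<open>s\<close> as the complement of
  an empty gap.\<close>

lemma cyc_int_cases: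
  assumes "1 \<le> n" "m \<le> n"
  obtains x y where "1 \<le> x" "x \<le> Suc y" "y \<le> n" "cyc_int n \<alpha> m = {x..y}"
  | y X where "X \<le> Suc n" "cyc_int n \<alpha> m = {1..n} - {y<..<X}"
proof -
  define s where "s = nat (\<alpha> mod int n)"
  have s: "int s = \<alpha> mod int n" "s < n" using assms(1) by (simp_all add: s_def nat_less_iff)
  have col: "col n (\<alpha> + int t) = (if s + t \<le> n then s + t else s + t - n)" if "1 \<le> t" "t \<le> m" for t
  proof -
    have "(\<alpha> + int t - 1) mod int n = (\<alpha> + (int t - 1)) mod int n" by (simp add: algebra_simps)
    also have "\<dots> = (int s + (int t - 1)) mod int n" unfolding s(1) by (simp add: mod_add_left_eq)
    also have "int s + (int t - 1) = int (s + t - 1)" using that by simp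
    finally have "(\<alpha> + int t - 1) mod int n = int ((s + t - 1) mod n)" by (simp add: zmod_int)
    then have c: "col n (\<alpha> + int t) = (s + t - 1) mod n + 1" by (simp add: col_def)
    show ?thesis
    proof (cases "s + t \<le> n")
      case True
      then have "(s + t - 1) mod n = s + t - 1" using that by simp
      then show ?thesis using c True that by simp
    next
      case False
      then have "(s + t - 1) mod n = s + t - 1 - n"
        using that assms(2) s(2) by (simp add: mod_if)
      then show ?thesis using c False by simp
    qed
  qed
  have "cyc_int n \<alpha> m = (\<lambda>t. col n (\<alpha> + int t)) ` {1..m}" by (auto simp: cyc_int_def)
  also have "\<dots> = (\<lambda>t. if s + t \<le> n then s + t else s + t - n) ` {1..m}"
    by (rule image_cong[OF refl]) (simp add: col)
  finally have cyc: "cyc_int n \<alpha> m = (\<lambda>t. if s + t \<le> n then s + t else s + t - n) ` {1..m}" .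
  show thesis
  proof (cases "s + m \<le> n")
    case True
    have "cyc_int n \<alpha> m = (+) s ` {1..m}" unfolding cyc using True by (intro image_cong) auto
    then have "cyc_int n \<alpha> m = {Suc s..s + m}" by simp
    then show thesis using that(1)[of "Suc s" "s + m"] True by simp
  next
    case False
    have "cyc_int n \<alpha> m = {1..n} - {s + m - n<..<Suc s}"
    proof
      show "cyc_int n \<alpha> m \<subseteq> {1..n} - {s + m - n<..<Suc s}"
        unfolding cyc using False s(2) assms by auto
      show "{1..n} - {s + m - n<..<Suc s} \<subseteq> cyc_int n \<alpha> m"
      proof
        fix t assume t: "t \<in> {1..n} - {s + m - n<..<Suc s}"
        then consider "Suc s \<le> t" "t \<le> n" | "1 \<le> t" "t \<le> s + m - n" by auto
        then show "t \<in> cyc_int n \<alpha> m"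
        proof cases
          case 1
          then show ?thesis unfolding cyc using False by (intro image_eqI[of _ _ "t - s"]) auto
        next
          case 2
          then show ?thesis unfolding cyc using False s(2) by (intro image_eqI[of _ _ "t + n - s"]) auto
        qed
      qed
    qed
    then show thesis using that(2)[of "Suc s" "s + m - n"] s(2) by simp
  qed
qed

lemma revlex_less_trans:
  assumes inj: "inj_on \<omega> (Vars k n)" and "keys m1 \<subseteq> Vars k n" "keys m2 \<subseteq> Vars k n"
    and 12: "revlex_less \<omega> m1 m2" and 23: "revlex_less \<omega> m2 m3"
  shows "revlex_less \<omega> m1 m3"
proof (cases "mdeg m1 = mdeg m2 \<and> mdeg m2 = mdeg m3")
  case False
  then have "mdeg m1 < mdeg m3" using 12 23 unfolding revlex_less_def by linarith
  then show ?thesis by (simp add: revlex_less_def)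
next
  case True
  obtain x where x: "lookup m1 x > lookup m2 x"
    "\<And>y. lookup m1 y \<noteq> lookup m2 y \<Longrightarrow> \<omega> x \<le> \<omega> y"
    using 12 True unfolding revlex_less_def by auto
  obtain x' where x': "lookup m2 x' > lookup m3 x'"
    "\<And>y. lookup m2 y \<noteq> lookup m3 y \<Longrightarrow> \<omega> x' \<le> \<omega> y"
    using 23 True unfolding revlex_less_def by auto
  have V: "x \<in> Vars k n" "x' \<in> Vars k n" using x(1) x'(1) assms(2,3) by (auto simp: in_keys_iff)
  define z where "z = (if \<omega> x \<le> \<omega> x' then x else x')"
  have zx: "\<omega> z \<le> \<omega> x" "\<omega> z \<le> \<omega> x'" by (auto simp: z_def)
  have "lookup m1 z > lookup m3 z"
  proof (cases "\<omega> x" "\<omega> x'" rule: linorder_cases)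
    case less
    then have "lookup m2 x = lookup m3 x" using x'(2)[of x] by auto
    then show ?thesis using x(1) less by (simp add: z_def)
  next
    case equal
    then have "x = x'" using inj V by (simp add: inj_on_eq_iff)
    then show ?thesis using x(1) x'(1) by (simp add: z_def)
  next
    case greater
    then have "lookup m1 x' = lookup m2 x'" using x(2)[of x'] by auto
    then show ?thesis using x'(1) greater by (simp add: z_def)
  qed
  moreover have "\<omega> z \<le> \<omega> y" if y: "lookup m1 y \<noteq> lookup m3 y" for y
  proof (cases "lookup m1 y = lookup m2 y")
    case True
    then show ?thesis using x'(2)[of y] y zx by simp
  next
    case False
    then show ?thesis using x(2)[of y] zx by simp
  qed
  ultimately show ?thesis using True unfolding revlex_less_def by auto
qed

lemma revlex_less_total:
  assumes "m1 \<noteq> m2"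
  shows "revlex_less \<omega> m1 m2 \<or> revlex_less \<omega> m2 m1"
proof (cases "mdeg m1 = mdeg m2")
  case False
  then show ?thesis by (auto simp: revlex_less_def)
next
  case True
  let ?D = "{x. lookup m1 x \<noteq> lookup m2 x}"
  have "?D \<noteq> {}" using assms by (auto simp: poly_mapping_eq_iff fun_eq_iff)
  then obtain x0 where "x0 \<in> ?D" by blast
  then obtain x where "x \<in> ?D \<and> (\<forall>y. y \<in> ?D \<longrightarrow> \<omega> x \<le> \<omega> y)"
    using ex_has_least_nat[of "\<lambda>x. x \<in> ?D" x0 \<omega>] by blast
  then have ne: "lookup m1 x \<noteq> lookup m2 x"
    and min: "\<And>y. lookup m1 y \<noteq> lookup m2 y \<Longrightarrow> \<omega> x \<le> \<omega> y" by simp_all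
  show ?thesis
  proof (cases "lookup m1 x > lookup m2 x")
    case less: True
    have "revlex_less \<omega> m1 m2" unfolding revlex_less_def using True less min by blast
    then show ?thesis by simp
  next
    case False
    then have "lookup m2 x > lookup m1 x" using ne by simp
    moreover have "\<forall>y. lookup m2 y \<noteq> lookup m1 y \<longrightarrow> \<omega> x \<le> \<omega> y"
      using min by metis
    ultimately have "revlex_less \<omega> m2 m1" unfolding revlex_less_def using True by auto
    then show ?thesis by simp
  qed
qed

text \<open>\<open>lead_mon\<close> is a definite description, so its properties depend on the
  existence of a greatest monomial.\<close>

lemma lead_mon_greatest:
  fixes g :: "'a::comm_ring_1 plpoly"
  assumes inj: "inj_on \<omega> (Vars k n)" and g: "g \<in> R k n" "g \<noteq> 0"
  shows "lead_mon \<omega> g \<in> keys g"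
    and "\<And>m. m \<in> keys g \<Longrightarrow> m \<noteq> lead_mon \<omega> g \<Longrightarrow> revlex_less \<omega> m (lead_mon \<omega> g)"
proof -
  have "\<exists>m\<in>K. \<forall>m'\<in>K. m' \<noteq> m \<longrightarrow> revlex_less \<omega> m' m"
    if "finite K" "K \<noteq> {}" "\<And>m. m \<in> K \<Longrightarrow> keys m \<subseteq> Vars k n" for K
    using that
  proof (induction K rule: finite_ne_induct)
    case (insert a K)
    then obtain m where m: "m \<in> K" "\<And>m'. m' \<in> K \<Longrightarrow> m' \<noteq> m \<Longrightarrow> revlex_less \<omega> m' m" by blast
    have V: "keys b \<subseteq> Vars k n" if "b \<in> K" for b using insert.prems that by blast
    show ?case
    proof (cases "revlex_less \<omega> m a")
      case True
      have "revlex_less \<omega> m' a" if "m' \<in> K" for m'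
      proof (cases "m' = m")
        case False
        then show ?thesis
          using revlex_less_trans[OF inj V[OF that] V[OF m(1)] m(2)[OF that] True] by simp
      qed (use True in simp)
      then show ?thesis by blast
    next
      case False
      then have "revlex_less \<omega> a m" using revlex_less_total[of a m \<omega>] m(1) insert.hyps by blast
      then show ?thesis using m by (intro bexI[of _ m]) auto
    qed
  qed auto
  moreover have "keys g \<noteq> {}" using g(2) by simp
  ultimately obtain m where m: "m \<in> keys g"
    "\<And>m'. m' \<in> keys g \<Longrightarrow> m' \<noteq> m \<Longrightarrow> revlex_less \<omega> m' m"
    using g(1) unfolding R_def by (metis (mono_tags, lifting) finite_keys mem_Collect_eq)
  have "lead_mon \<omega> g = m" by (rule lead_monI[OF inj g(1) m])
  then show "lead_mon \<omega> g \<in> keys g"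
    and "\<And>m. m \<in> keys g \<Longrightarrow> m \<noteq> lead_mon \<omega> g \<Longrightarrow> revlex_less \<omega> m (lead_mon \<omega> g)"
    using m by simp_all
qed

section \<open>Monomials in initial ideals and the rank dichotomy\<close>

lemma lead_mon_in_In_ideal:
  fixes g :: "'a::comm_ring_1 plpoly"
  assumes "g \<in> J" "g \<noteq> 0"
  shows "Poly_Mapping.single (lead_mon \<omega> g) 1 \<in> In_ideal k n \<omega> J"
proof -
  have "(1 :: 'a plpoly) \<in> R k n" by (simp add: R_def)
  then show ?thesis unfolding In_ideal_def ideal_R_def using assms
    by (auto intro!: exI[of _ "{Poly_Mapping.single (lead_mon \<omega> g) 1}"] exI[of _ "\<lambda>_. 1"])
qed

lemma In_ideal_mono:
  assumes "J \<subseteq> J'"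
  shows "In_ideal k n \<omega> J \<subseteq> In_ideal k n \<omega> J'"
proof
  let ?L = "\<lambda>J. {Poly_Mapping.single (lead_mon \<omega> g) 1 | g. g \<in> J \<and> g \<noteq> 0}"
  fix p assume "p \<in> In_ideal k n \<omega> J"
  then obtain A q where A: "finite A" "A \<subseteq> ?L J" "\<forall>g\<in>A. q g \<in> R k n" "p = (\<Sum>g\<in>A. q g * g)"
    unfolding In_ideal_def ideal_R_def by auto
  have "?L J \<subseteq> ?L J'" using assms by blast
  then have "A \<subseteq> ?L J'" using A(2) by (rule order_trans[rotated])
  then show "p \<in> In_ideal k n \<omega> J'" unfolding In_ideal_def ideal_R_def
    using A(1,3,4) by (intro CollectI exI[of _ A] exI[of _ q] conjI)
qed

text \<open>Comparing coefficients of \<open>m\<close>, some summand must contain it, so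
  \<open>m\<close> is a multiple of a single leading monomial.\<close>

lemma monomial_in_In_idealE:
  fixes J :: "'a::comm_ring_1 plpoly set"
  assumes "Poly_Mapping.single m (1::'a) \<in> In_ideal k n \<omega> J"
  obtains g m0 where "g \<in> J" "g \<noteq> 0" "keys m0 \<subseteq> Vars k n" "m = m0 + lead_mon \<omega> g"
proof -
  obtain A q where A: "A \<subseteq> {Poly_Mapping.single (lead_mon \<omega> g) 1 | g. g \<in> J \<and> g \<noteq> 0}"
    "\<forall>h\<in>A. q h \<in> R k n" "Poly_Mapping.single m (1::'a) = (\<Sum>h\<in>A. q h * h)"
    using assms unfolding In_ideal_def ideal_R_def by blast
  have "(\<Sum>h\<in>A. lookup (q h * h) m) = 1"
    unfolding lookup_sum[symmetric] A(3)[symmetric] by simp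
  then have "(\<Sum>h\<in>A. lookup (q h * h) m) \<noteq> 0" by simp
  then obtain h where h: "h \<in> A" "lookup (q h * h) m \<noteq> 0"
    by (rule sum.not_neutral_contains_not_neutral)
  obtain g where g: "h = Poly_Mapping.single (lead_mon \<omega> g) 1" "g \<in> J" "g \<noteq> 0" using A(1) h(1) by blast
  have "m \<in> keys (q h * h)" using h(2) by (simp add: in_keys_iff)
  then obtain a b where ab: "a \<in> keys (q h)" "b \<in> keys h" "m = a + b"
    using keys_mult[of "q h" h] by blast
  have "b = lead_mon \<omega> g" using ab(2) g(1) by simp
  moreover have "keys a \<subseteq> Vars k n" using A(2) h(1) ab(1) unfolding R_def by blast
  ultimately show thesis using that[of g a] g ab(3) by simp
qed

text \<open>If \<open>G\<close> violates the rank condition, there is an independent set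
  \<open>U\<close> of more than \<open>r\<close> columns, and the hypotheses convert it into a
  monotone \<open>D\<close> large enough for \<open>interval_lead\<close> or
  \<open>complement_lead\<close>.\<close>

lemma X_rank_or_lead:
  fixes G :: "nat \<Rightarrow> nat \<Rightarrow> 'a::field_char_0"
  assumes "1 \<le> n" "m \<le> n" and kn: "k \<le> n" and le: "lin_ext k n \<omega>"
    and cs: "set cs \<subseteq> Vars k n" "sorted_wrt (pl_le k) cs" and Gr: "G \<in> Gr k n"
    and wrapped: "\<And>y X U. X \<le> Suc n \<Longrightarrow> U \<subseteq> {1..n} - {y<..<X} \<Longrightarrow> lin_indep_cols k G U \<Longrightarrow>
      \<exists>D \<gamma>. D \<subseteq> {y<..<X} \<and> (\<forall>s\<in>D. \<gamma> s < length cs \<and> s \<notin> cs ! \<gamma> s) \<and>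
        (\<forall>s\<in>D. \<forall>t\<in>D. s < t \<longrightarrow> \<gamma> s \<le> \<gamma> t) \<and> card {y<..<X} + card U \<le> card D + k"
    and interval: "\<And>x y U. 1 \<le> x \<Longrightarrow> x \<le> Suc y \<Longrightarrow> y \<le> n \<Longrightarrow> U \<subseteq> {x..y} \<Longrightarrow> lin_indep_cols k G U \<Longrightarrow>
      \<exists>D \<gamma>. D \<subseteq> {x..y} \<and> (\<forall>s\<in>D. \<gamma> s < length cs \<and> s \<in> cs ! \<gamma> s) \<and>
        (\<forall>s\<in>D. \<forall>t\<in>D. s < t \<longrightarrow> \<gamma> t \<le> \<gamma> s) \<and> card U \<le> card D"
  shows "G \<in> X_rank k n (cyc_int n \<alpha> m) r \<or>
    vanishing_lead k n \<omega> (chain_mon cs) (X_rank k n (cyc_int n \<alpha> m) r :: (nat \<Rightarrow> nat \<Rightarrow> 'a) set)"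
proof (rule ccontr)
  let ?S = "cyc_int n \<alpha> m"
  assume neg: "\<not> ?thesis"
  then have r: "r < col_rank k G ?S" using Gr by (simp add: X_rank_def)
  show False
  proof (cases rule: cyc_int_cases[OF assms(1,2), of \<alpha>])
    case (1 x y)
    have "finite ?S" using 1(4) by simp
    then obtain U where U: "U \<subseteq> ?S" "lin_indep_cols k G U" "card U = col_rank k G ?S" by (rule col_rank_max)
    obtain D \<gamma> where D: "D \<subseteq> {x..y}" "\<forall>s\<in>D. \<gamma> s < length cs \<and> s \<in> cs ! \<gamma> s"
      "\<forall>s\<in>D. \<forall>t\<in>D. s < t \<longrightarrow> \<gamma> t \<le> \<gamma> s" "card U \<le> card D"
      using interval[OF 1(1-3) U(1)[unfolded 1(4)] U(2)] by blast
    have "vanishing_lead k n \<omega> (chain_mon cs) (X_rank k n {x..y} r :: (nat \<Rightarrow> nat \<Rightarrow> 'a) set)"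
      by (rule interval_lead[OF le cs _ D(1), where \<gamma> = \<gamma>]) (use 1 D r U(3) in simp_all)
    then show False using neg unfolding 1(4) by blast
  next
    case (2 y X)
    have "finite ?S" using 2(2) by simp
    then obtain U where U: "U \<subseteq> ?S" "lin_indep_cols k G U" "card U = col_rank k G ?S" by (rule col_rank_max)
    obtain D \<gamma> where D: "D \<subseteq> {y<..<X}" "\<forall>s\<in>D. \<gamma> s < length cs \<and> s \<notin> cs ! \<gamma> s"
      "\<forall>s\<in>D. \<forall>t\<in>D. s < t \<longrightarrow> \<gamma> s \<le> \<gamma> t" "card {y<..<X} + card U \<le> card D + k"
      using wrapped[OF 2(1) U(1)[unfolded 2(2)] U(2)] by blast
    have T: "{y<..<X} \<subseteq> {1..n}" using 2(1) by auto
    have rD: "card {y<..<X} + r < card D + k" using D(4) r U(3) by linarith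
    have "vanishing_lead k n \<omega> (chain_mon cs) (X_rank k n ({1..n} - {y<..<X}) r :: (nat \<Rightarrow> nat \<Rightarrow> 'a) set)"
      by (rule complement_lead[OF le kn cs T D(1) rD, where \<gamma> = \<gamma>]) (use D in simp_all)
    then show False using neg unfolding 2(2) by blast
  qed
qed

text \<open>Along the chain, values at positions below \<open>k\<close> increase and the remaining
  ones decrease, which gives the Bruhat relation. The interval bounds of the two blocks feed the
  dichotomy of \<open>X_rank_or_lead\<close>.\<close>

lemma standard_chain_permutations:
  assumes "cs \<noteq> []" and n1: "1 \<le> n" and kn: "k \<le> n" and le: "lin_ext k n \<omega>" and cs: "set cs \<subseteq> Vars k n" "sorted_wrt (pl_le k) cs"
  shows "\<exists>us. length us = length cs \<and>
    (\<forall>j<length cs. bij_betw (us ! j) {..<n} {1..n}) \<and> (\<forall>j<length cs. us ! j ` {..<k} = cs ! j) \<and>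
    (\<forall>j. Suc j < length cs \<longrightarrow> bruhat_reach n (us ! Suc j) (us ! j)) \<and>
    (\<forall>G :: nat \<Rightarrow> nat \<Rightarrow> 'a::field_char_0. richardson n (hd us) (last us) G \<longrightarrow> G \<in> Gr k n \<and>
      (\<forall>\<alpha> m r. m \<le> n \<longrightarrow> G \<in> X_rank k n (cyc_int n \<alpha> m) r \<or>
        vanishing_lead k n \<omega> (chain_mon cs) (X_rank k n (cyc_int n \<alpha> m) r :: (nat \<Rightarrow> nat \<Rightarrow> 'a) set)))"
proof -
  obtain f where f: "\<And>j. j < length cs \<Longrightarrow> bij_betw (f j) {..<k} (cs ! j)"
    "\<And>j i. Suc j < length cs \<Longrightarrow> i < k \<Longrightarrow> f j i \<le> f (Suc j) i"
    "\<And>y X. \<exists>D \<gamma> c. D \<subseteq> {y<..<X} \<and> (\<forall>s\<in>D. \<gamma> s < length cs \<and> s \<notin> cs ! \<gamma> s) \<and>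
      (\<forall>s\<in>D. \<forall>t\<in>D. s < t \<longrightarrow> \<gamma> s \<le> \<gamma> t) \<and> c \<le> k \<and> (\<forall>i<c. f (length cs - 1) i < X) \<and>
      card {y<..<X} \<le> card D + card {i. i < c \<and> y < f 0 i}"
    using low_positions[OF assms(1) cs] by blast
  obtain h where h: "\<And>j. j < length cs \<Longrightarrow> bij_betw (h j) {k..<n} ({1..n} - cs ! j)"
    "\<And>j i. Suc j < length cs \<Longrightarrow> k \<le> i \<Longrightarrow> i < n \<Longrightarrow> h (Suc j) i \<le> h j i"
    "\<And>x y. 1 \<le> x \<Longrightarrow> y \<le> n \<Longrightarrow> \<exists>D \<gamma> c. D \<subseteq> {x..y} \<and> (\<forall>s\<in>D. \<gamma> s < length cs \<and> s \<in> cs ! \<gamma> s) \<and>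
      (\<forall>s\<in>D. \<forall>t\<in>D. s < t \<longrightarrow> \<gamma> t \<le> \<gamma> s) \<and> k \<le> c \<and> c \<le> n \<and>
      (\<forall>i. c \<le> i \<longrightarrow> i < n \<longrightarrow> x \<le> h (length cs - 1) i) \<and>
      card {x..y} \<le> card D + card {i. c \<le> i \<and> i < n \<and> h 0 i \<le> y}"
    using high_positions[OF assms(1) kn cs] by blast
  \<comment> \<open>The identity from \<open>n\<close> on makes all permutations of the chain agree
    outside the relevant positions, as \<open>bruhat_reachI\<close> demands.\<close>
  define u where "u = (\<lambda>j i. if i < k then f j i else if i < n then h j i else i)"
  define us where "us = map u [0..<length cs]"
  have len: "length us = length cs" by (simp add: us_def)
  have us: "us ! j = u j" if "j < length cs" for j using that by (simp add: us_def)
  have ne: "us \<noteq> []" using len assms(1) by (cases us) simp_all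
  have pos: "0 < length cs" using assms(1) by simp
  have hd: "hd us = u 0" using hd_conv_nth[OF ne] us[OF pos] by simp
  have last: "last us = u (length cs - 1)" using last_conv_nth[OF ne] us[of "length cs - 1"] pos len by simp
  have bij: "bij_betw (u j) {..<n} {1..n}" if j: "j < length cs" for j
  proof -
    have a: "cs ! j \<subseteq> {1..n}" using VarsD[of "cs ! j" k n] cs(1) nth_mem[OF j] by blast
    have "bij_betw (u j) {..<k} (cs ! j)" using f(1)[OF j] by (subst bij_betw_cong[of _ _ "f j"]) (simp_all add: u_def)
    moreover have "bij_betw (u j) {k..<n} ({1..n} - cs ! j)"
      using h(1)[OF j] by (subst bij_betw_cong[of _ _ "h j"]) (simp_all add: u_def)
    moreover have "cs ! j \<inter> ({1..n} - cs ! j) = {}" by blast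
    ultimately have "bij_betw (u j) ({..<k} \<union> {k..<n}) (cs ! j \<union> ({1..n} - cs ! j))" by (rule bij_betw_combine)
    moreover have "{..<k} \<union> {k..<n} = {..<n}" using kn by auto
    moreover have "cs ! j \<union> ({1..n} - cs ! j) = {1..n}" using a by blast
    ultimately show ?thesis by simp
  qed
  have img: "u j ` {..<k} = cs ! j" if "j < length cs" for j
    using bij_betw_imp_surj_on[OF f(1)[OF that]] by (simp add: u_def cong: image_cong_simp)
  have reach: "bruhat_reach n (us ! Suc j) (us ! j)" if j: "Suc j < length cs" for j
  proof -
    have "bruhat_reach n (u (Suc j)) (u j)"
      by (rule bruhat_reach_blockwise[where k = k]) (use bij j f(2) h(2) kn in \<open>simp_all add: u_def\<close>)
    then show ?thesis using us j by simp
  qed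
  have wrapped: "\<exists>D \<gamma>. D \<subseteq> {y<..<X} \<and> (\<forall>s\<in>D. \<gamma> s < length cs \<and> s \<notin> cs ! \<gamma> s) \<and>
        (\<forall>s\<in>D. \<forall>t\<in>D. s < t \<longrightarrow> \<gamma> s \<le> \<gamma> t) \<and> card {y<..<X} + card U \<le> card D + k"
    if G: "X \<le> Suc n" "richardson n (hd us) (last us) G" "U \<subseteq> {1..n} - {y<..<X}" "lin_indep_cols k G U"
    for y X U and G :: "nat \<Rightarrow> nat \<Rightarrow> 'a"
  proof -
    obtain D \<gamma> c where D: "D \<subseteq> {y<..<X}" "\<forall>s\<in>D. \<gamma> s < length cs \<and> s \<notin> cs ! \<gamma> s"
      "\<forall>s\<in>D. \<forall>t\<in>D. s < t \<longrightarrow> \<gamma> s \<le> \<gamma> t" "c \<le> k" "\<forall>i<c. f (length cs - 1) i < X"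
      "card {y<..<X} \<le> card D + card {i. i < c \<and> y < f 0 i}"
      using f(3)[of y X] by blast
    have "{i. i < c \<and> y < hd us i} = {i. i < c \<and> y < f 0 i}" using D(4) by (auto simp: hd u_def)
    moreover have "card U + card {i. i < c \<and> y < hd us i} \<le> k"
      by (rule richardson_wrapped_rank[OF G(2) kn D(4) _ G(3,4)]) (use D(4,5) in \<open>simp add: last u_def\<close>)
    ultimately have "card {y<..<X} + card U \<le> card D + k" using D(6) by simp
    then show ?thesis using D(1-3) by blast
  qed
  have interval: "\<exists>D \<gamma>. D \<subseteq> {x..y} \<and> (\<forall>s\<in>D. \<gamma> s < length cs \<and> s \<in> cs ! \<gamma> s) \<and>
        (\<forall>s\<in>D. \<forall>t\<in>D. s < t \<longrightarrow> \<gamma> t \<le> \<gamma> s) \<and> card U \<le> card D"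
    if G: "1 \<le> x" "x \<le> Suc y" "y \<le> n" "richardson n (hd us) (last us) G" "U \<subseteq> {x..y}" "lin_indep_cols k G U"
    for x y U and G :: "nat \<Rightarrow> nat \<Rightarrow> 'a"
  proof -
    obtain D \<gamma> c where D: "D \<subseteq> {x..y}" "\<forall>s\<in>D. \<gamma> s < length cs \<and> s \<in> cs ! \<gamma> s"
      "\<forall>s\<in>D. \<forall>t\<in>D. s < t \<longrightarrow> \<gamma> t \<le> \<gamma> s" "k \<le> c" "c \<le> n"
      "\<forall>i. c \<le> i \<longrightarrow> i < n \<longrightarrow> x \<le> h (length cs - 1) i"
      "card {x..y} \<le> card D + card {i. c \<le> i \<and> i < n \<and> h 0 i \<le> y}"
      using h(3)[OF G(1,3)] by blast
    have bu: "bij_betw (hd us) {..<n} {1..n}" "bij_betw (last us) {..<n} {1..n}"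
      using bij pos unfolding hd last by simp_all
    have "{i. c \<le> i \<and> i < n \<and> hd us i \<le> y} = {i. c \<le> i \<and> i < n \<and> h 0 i \<le> y}"
      using D(4) by (auto simp: hd u_def)
    moreover have "card U + card {i. c \<le> i \<and> i < n \<and> hd us i \<le> y} \<le> card {x..y}"
      by (rule richardson_interval_rank[OF G(4) D(4,5) bu _ G(1-3,5,6)]) (use D(4,6) in \<open>simp add: last u_def\<close>)
    ultimately have "card U + card {i. c \<le> i \<and> i < n \<and> h 0 i \<le> y} \<le> card {x..y}" by simp
    then have "card U \<le> card D" using D(7) by linarith
    then show ?thesis using D(1-3) by blast
  qed
  have Gr: "G \<in> Gr k n" if G: "richardson n (hd us) (last us) G" for G :: "nat \<Rightarrow> nat \<Rightarrow> 'a"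
  proof -
    have "plk k G (cs ! 0) \<noteq> 0"
      using richardson_plk_nonzero[OF G kn] bij[OF pos] img[OF pos] unfolding hd by simp
    then show ?thesis using cs(1) nth_mem[OF pos] by (auto simp: Gr_def)
  qed
  have bij': "bij_betw (us ! j) {..<n} {1..n}" if "j < length cs" for j using us bij that by simp
  have img': "us ! j ` {..<k} = cs ! j" if "j < length cs" for j using us img that by simp
  have lead: "G \<in> X_rank k n (cyc_int n \<alpha> m) r \<or>
      vanishing_lead k n \<omega> (chain_mon cs) (X_rank k n (cyc_int n \<alpha> m) r :: (nat \<Rightarrow> nat \<Rightarrow> 'a) set)"
    if G: "richardson n (hd us) (last us) G" and "m \<le> n" for G :: "nat \<Rightarrow> nat \<Rightarrow> 'a" and \<alpha> m r
    by (rule X_rank_or_lead[OF n1 that(2) kn le cs Gr[OF G] wrapped[OF _ G] interval[OF _ _ _ G]])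
  show ?thesis by (intro exI[of _ us] conjI allI impI len bij' img' reach Gr lead)
qed

theorem theorem4p12:
  fixes k n d :: nat and f :: "int \<Rightarrow> int" and F :: "(int \<Rightarrow> int) set"
    and w :: "nat set \<Rightarrow> nat"
  assumes "1 \<le> k" and "k < n"
    and "lin_ext k n w"
    and "f \<in> Bound k n"
    and "F \<subseteq> Bound k n"
    and "\<forall>g\<in>F. is_basic TYPE('a::{alg_closed_field, field_char_0}) k n g"
    and "(Pi_pos k n f :: (nat \<Rightarrow> nat \<Rightarrow> 'a) set) = (\<Inter>g\<in>F. Pi_pos k n g)"
    and "d \<ge> 1"
  shows "Bf TYPE('a) n k d w f = (\<Inter>g\<in>F. Bf TYPE('a) n k d w g)"
proof
  \<comment> \<open>A larger variety has a smaller ideal, hence a smaller initial ideal.\<close>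
  have "In_ideal k n w (Jf k n g :: 'a plpoly set) \<subseteq> In_ideal k n w (Jf k n f)" if "g \<in> F" for g
    using assms(7) that by (intro In_ideal_mono) (auto simp: Jf_def)
  then show "Bf TYPE('a) n k d w f \<subseteq> (\<Inter>g\<in>F. Bf TYPE('a) n k d w g)" by (auto simp: Bf_def)
next
  show "(\<Inter>g\<in>F. Bf TYPE('a) n k d w g) \<subseteq> Bf TYPE('a) n k d w f"
  proof
    fix m assume m: "m \<in> (\<Inter>g\<in>F. Bf TYPE('a) n k d w g)"
    have inj: "inj_on w (Vars k n)" using assms(3) by (simp add: lin_ext_def)
    \<comment> \<open>An empty \<open>F\<close> would make the intersection consist of all matrices.
      The zero matrix, all of whose Plucker coordinates vanish because \<open>1 \<le> k\<close>,
      rules this out.\<close>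
    have "(\<lambda>_ _. 0 :: 'a) \<notin> Pi_pos k n f"
    proof
      assume "(\<lambda>_ _. 0 :: 'a) \<in> Pi_pos k n f"
      then obtain a where "plk k (\<lambda>_ _. 0 :: 'a) a \<noteq> 0" by (auto simp: Pi_pos_def zar_closure_def Gr_def)
      moreover have "plk k (\<lambda>_ _. 0 :: 'a) a = 0" using plk_scale[of k 0 "\<lambda>_ _. 0" a] assms(1) by (simp add: power_0_left)
      ultimately show False by simp
    qed
    then have "F \<noteq> {}" using assms(7) by auto
    then have "m \<in> Bmon n k d" using m by (auto simp: Bf_def)
    then obtain cs where cs: "length cs = d" "set cs \<subseteq> Vars k n" "sorted_wrt (pl_le k) cs" "m = chain_mon cs"
      by (auto simp: Bmon_def)
    have ne: "cs \<noteq> []" using cs(1) assms(8) by auto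
    have kn: "k \<le> n" and n1: "1 \<le> n" using assms(1,2) by simp_all
    obtain us where us: "length us = length cs" "\<And>j. j < length cs \<Longrightarrow> bij_betw (us ! j) {..<n} {1..n}"
      "\<And>j. j < length cs \<Longrightarrow> us ! j ` {..<k} = cs ! j"
      "\<And>j. Suc j < length cs \<Longrightarrow> bruhat_reach n (us ! Suc j) (us ! j)"
      and rich: "\<And>G :: nat \<Rightarrow> nat \<Rightarrow> 'a. richardson n (hd us) (last us) G \<Longrightarrow> G \<in> Gr k n \<and>
        (\<forall>\<alpha> m r. m \<le> n \<longrightarrow> G \<in> X_rank k n (cyc_int n \<alpha> m) r \<or>
          vanishing_lead k n w (chain_mon cs) (X_rank k n (cyc_int n \<alpha> m) r :: (nat \<Rightarrow> nat \<Rightarrow> 'a) set))"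
      using standard_chain_permutations[where ?'a = 'a, OF ne n1 kn assms(3) cs(2,3)] by blast
    have une: "us \<noteq> []" using us(1) ne by (cases us) simp_all
    have pos: "0 < length cs" using ne by simp
    have lastu: "last us = us ! (length cs - 1)"
      using une us(1) by (simp add: last_conv_nth)
    have inPi: "G \<in> Pi_pos k n f" if G: "richardson n (hd us) (last us) G" for G :: "nat \<Rightarrow> nat \<Rightarrow> 'a"
    proof -
      have "G \<in> Pi_pos k n g" if g: "g \<in> F" for g
      proof -
        obtain \<alpha> l r where X: "l \<le> n" "(Pi_pos k n g :: (nat \<Rightarrow> nat \<Rightarrow> 'a) set) = X_rank k n (cyc_int n \<alpha> l) r"
          using assms(6) g unfolding is_basic_def by blast
        have "\<not> vanishing_lead k n w (chain_mon cs) (X_rank k n (cyc_int n \<alpha> l) r :: (nat \<Rightarrow> nat \<Rightarrow> 'a) set)"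
        proof
          assume "vanishing_lead k n w (chain_mon cs) (X_rank k n (cyc_int n \<alpha> l) r :: (nat \<Rightarrow> nat \<Rightarrow> 'a) set)"
          then obtain h where h: "h \<in> Jf k n g" "h \<noteq> (0 :: 'a plpoly)" "lead_mon w h = m"
            unfolding vanishing_lead_def Jf_def X(2) cs(4) by blast
          then have "Poly_Mapping.single m (1::'a) \<in> In_ideal k n w (Jf k n g)"
            using lead_mon_in_In_ideal[OF h(1,2), of w k n] by simp
          then show False using m g by (auto simp: Bf_def)
        qed
        then show ?thesis unfolding X(2) using rich[OF G] X(1) by blast
      qed
      then show ?thesis using assms(7) by blast
    qed
    have "Poly_Mapping.single m (1::'a) \<notin> In_ideal k n w (Jf k n f)"
    proof
      assume "Poly_Mapping.single m (1::'a) \<in> In_ideal k n w (Jf k n f)"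
      then obtain g :: "'a plpoly" and m0 where g: "g \<in> Jf k n f" "g \<noteq> 0" "keys m0 \<subseteq> Vars k n"
        "m = m0 + lead_mon w g" by (rule monomial_in_In_idealE)
      have gR: "g \<in> R k n" using g(1) by (simp add: Jf_def)
      \<comment> \<open>\<open>m\<close> is only known to be a multiple of the leading monomial of
        \<open>g\<close>, so all of \<open>g\<close> is multiplied by \<open>m0\<close>; afterwards
        only the part of degree \<open>d\<close> is kept.\<close>
      define Q where "Q = (+) m0 ` keys g"
      define c where "c = (\<lambda>\<nu>. lookup g (\<nu> - m0))"
      have van: "(\<Sum>\<nu>\<in>Q. c \<nu> * mon_eval \<nu> (plk k G)) = 0"
        if G: "richardson n (hd us) (last us) G" for G :: "nat \<Rightarrow> nat \<Rightarrow> 'a"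
      proof -
        have "peval g (plk k G) = 0" using g(1) inPi[OF G] by (simp add: Jf_def)
        moreover have "(\<Sum>\<nu>\<in>Q. c \<nu> * mon_eval \<nu> (plk k G)) = mon_eval m0 (plk k G) * peval g (plk k G)"
          unfolding Q_def peval_mon_eval sum_distrib_left
          by (subst sum.reindex) (simp_all add: c_def mon_eval_add mult.left_commute)
        ultimately show ?thesis by simp
      qed
      have van': "(\<Sum>\<nu>\<in>{\<nu>\<in>Q. mdeg \<nu> = length cs}. c \<nu> * mon_eval \<nu> (plk k G)) = 0"
        if "richardson n (hd us) (last us) G" for G :: "nat \<Rightarrow> nat \<Rightarrow> 'a"
        by (rule vanishing_homogeneous[OF _ assms(1) van that]) (simp_all add: Q_def)
      have lead: "lead_mon w g \<in> keys g" by (rule lead_mon_greatest(1)[OF inj gR g(2)])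
      have mQ: "chain_mon cs \<in> Q" unfolding Q_def cs(4)[symmetric] g(4) using lead by blast
      have keysQ: "keys \<nu> \<subseteq> Vars k n" if "\<nu> \<in> Q" for \<nu>
      proof -
        from that obtain \<mu> where \<mu>: "\<mu> \<in> keys g" "\<nu> = m0 + \<mu>" by (auto simp: Q_def)
        then have "keys \<mu> \<subseteq> Vars k n" using gR by (auto simp: R_def)
        then show ?thesis using g(3) Poly_Mapping.keys_add[of m0 \<mu>] \<mu>(2) by blast
      qed
      have cm: "c (chain_mon cs) \<noteq> 0" unfolding cs(4)[symmetric] g(4) c_def using lead by (simp add: in_keys_iff)
      have less: "revlex_less w \<nu> (chain_mon cs)" if \<nu>: "\<nu> \<in> Q" "\<nu> \<noteq> chain_mon cs" for \<nu>
      proof -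
        obtain \<mu> where \<mu>: "\<mu> \<in> keys g" "\<nu> = m0 + \<mu>" using \<nu>(1) by (auto simp: Q_def)
        then have "\<mu> \<noteq> lead_mon w g" using \<nu>(2) g(4) cs(4) by auto
        then have "revlex_less w \<mu> (lead_mon w g)" using lead_mon_greatest(2)[OF inj gR g(2) \<mu>(1)] by simp
        then show ?thesis unfolding cs(4)[symmetric] g(4) \<mu>(2) revlex_less_cancel .
      qed
      have lw: "bij_betw (last us) {..<n} {1..n}" unfolding lastu using us(2) pos by simp
      show False
        by (rule standard_mon_not_lead[where us = us and cs = cs and c = c and Q = "{\<nu>\<in>Q. mdeg \<nu> = length cs}",
              OF assms(1) kn assms(3) lw ne us(1) _ us(2,3,4) refl _ _ _ _ cm])
          (use cs(2,3) keysQ less mQ van' in \<open>simp_all add: Q_def mdeg_chain_mon\<close>)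
    qed
    then show "m \<in> Bf TYPE('a) n k d w f" using \<open>m \<in> Bmon n k d\<close> by (simp add: Bf_def)
  qed
qed

end
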